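(* (1) Every dominated function $u:E^N\to\mathbb R$ is differentiable almost everywhere and is a viscosity subsolution in $E^N$ of the Hamilton-Jacobi equation $|d_xu|^2=2U_\kappa(x)$. (2) If $u:E^N\to\mathbb R$ is a dominated function which is a fixed point of the Lax-Oleinik semigroup, i.e. $T^-_tu=u$ for all $t\ge 0$, then $u$ is a viscosity solution in $E^N$ of the Hamilton-Jacobi equation $|d_xu|^2=2U_\kappa(x)$.
   Context: Let $E$ be a finite-dimensional Euclidean space with $\dim E\ge 1$, scalar product $\langle\cdot,\cdot\rangle_E$ and norm $\|\cdot\|_E$, let $N\ge 2$, let $m_1,\dots,m_N>0$ be masses and let $\kappa\in(0,1)$. For $v=(v_1,\dots,v_N)\in E^N$ put $|v|^2=\sum_i m_i\|v_i\|_E^2$. For a covector $p\in (E^* )^N$, identified with $(p_1,\dots,p_N)\in E^N$ via $p(v)=\sum_i\langle p_i,v_i\rangle_E$, the dual norm is $|p|^2=\sum_i m_i^{-1}\|p_i\|_E^2$. The potential is $U_\kappa(x)=\sum_{i<j}m_im_j\|r_i-r_j\|_E^{-2\kappa}\in(0,+\infty]$ for $x=(r_1,\dots,r_N)\in E^N$ (equal to $+\infty$ if $r_i=r_j$ for some $i\ne j$). The action of an absolutely continuous curve $\gamma:[a,b]\to E^N$ is $A(\gamma)=\frac12\int_a^b|\dot\gamma(s)|^2ds+\int_a^bU_\kappa(\gamma(s))\,ds\in(0,+\infty]$. For $T>0$, $\mathcal C(x,y,T)$ is the set of absolutely continuous curves $\gamma:[0,T]\to E^N$ with $\gamma(0)=x$,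 $\gamma(T)=y$; $\phi(x,y,T)=\inf\{A(\gamma):\gamma\in\mathcal C(x,y,T)\}$; and $\phi(x,y)=\inf_{T>0}\phi(x,y,T)$. A function $u:E^N\to\mathbb R$ is dominated if $u(x)-u(y)\le\phi(x,y)$ for all $x,y\in E^N$. The Lax-Oleinik semigroup is defined by $T^-_0u=u$ and, for $t>0$, $T^-_tu(x)=\inf\{u(y)+\phi(x,y,t): y\in E^N\}$. A function $u:E^N\to\mathbb R$ is a viscosity subsolution of $|d_xu|^2=2U_\kappa(x)$ at $x_0\in E^N$ if for each $C^1$ function $\psi:E^N\to\mathbb R$ such that $x_0$ is a maximum of $u-\psi$ one has $|d_{x_0}\psi|^2\le 2U_\kappa(x_0)$. It is a viscosity supersolution at $x_0$ if for each $C^1$ function $\psi:E^N\to\mathbb R$ such that $x_0$ is a minimum of $u-\psi$ one has $|d_{x_0}\psi|^2\ge 2U_\kappa(x_0)$. (At points with $U_\kappa(x_0)=+\infty$ the subsolution condition is automatic, and the supersolution condition means that no such $\psi$ exists.) It is a viscosity sub/supersolution in $V\subset E^N$ if it is so at every point of $V$, and a viscosity solution in $V$ if it is continuous and both a subsolution and a supersolution in $V$. *)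

theory Defs
  imports "HOL-Analysis.Analysis"
begin

text \<open>
  The configuration space \<open>E\<^sup>N\<close> is the type \<open>('e, 'n) vec\<close>, i.e. \<open>'e ^ 'n\<close>, where \<open>'e\<close> is a
  Euclidean space and the finite index type \<open>'n\<close> has \<open>N\<close> elements. The library norm on it does not
  involve the masses and is used only for the topology and the differentiable structure. The index
  type is linearly ordered where sums over pairs \<open>i < j\<close> occur.
\<close>

definition mass_norm_sq :: "('n \<Rightarrow> real) \<Rightarrow> 'e::euclidean_space ^ 'n::finite \<Rightarrow> real" where
  "mass_norm_sq m v = (\<Sum>i\<in>UNIV. m i * (norm (v $ i))\<^sup>2)"

definition covector_components ::
  "('e::euclidean_space ^ 'n::finite \<Rightarrow> real) \<Rightarrow> 'e ^ 'n" where
  "covector_components p = (THE q. \<forall>v. p v = (\<Sum>i\<in>UNIV. (q $ i) \<bullet> (v $ i)))"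

definition dual_norm_sq ::
  "('n \<Rightarrow> real) \<Rightarrow> ('e::euclidean_space ^ 'n::finite \<Rightarrow> real) \<Rightarrow> real" where
  "dual_norm_sq m p = (\<Sum>i\<in>UNIV. inverse (m i) * (norm (covector_components p $ i))\<^sup>2)"

lemma covector_components:
  fixes p :: "'e::euclidean_space ^ 'n::finite \<Rightarrow> real"
  assumes "linear p"
  shows "p v = (\<Sum>i\<in>UNIV. (covector_components p $ i) \<bullet> (v $ i))"
proof -
  have ex: "\<forall>v. p v = (\<Sum>i\<in>UNIV. (adjoint p 1 $ i) \<bullet> (v $ i))"
    using adjoint_works[OF assms, of _ 1]
    by (simp add: inner_vec_def inner_commute)
  have "q = adjoint p 1" if "\<forall>v. p v = (\<Sum>i\<in>UNIV. (q $ i) \<bullet> (v $ i))" for q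
    using that ex by (intro vector_eq_rdot[THEN iffD1]) (simp add: inner_vec_def inner_commute)
  then have "covector_components p = adjoint p 1"
    unfolding covector_components_def using ex by (intro the_equality) auto
  then show ?thesis using ex by simp
qed

text \<open>Powers of \<open>0\<close> with negative exponent are \<open>0\<close> under \<open>powr\<close>, so collisions are
  treated separately.\<close>

definition potential ::
  "('n \<Rightarrow> real) \<Rightarrow> real \<Rightarrow> ('e::euclidean_space, 'n::{finite,linorder}) vec \<Rightarrow> ennreal" where
  "potential m \<kappa> x =
    (\<Sum>(i, j) | i < j.
       if x $ i = x $ j then \<infinity>
       else ennreal (m i * m j * norm (x $ i - x $ j) powr (- 2 * \<kappa>)))"

text \<open>The \<open>\<epsilon>\<close>-\<open>\<delta>\<close> definition, with finite families of
  non-overlapping intervals \<open>[s, t]\<close> encoded as sets of pairs \<open>(s, t)\<close>.\<close>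

definition abs_continuous_curve :: "real \<Rightarrow> real \<Rightarrow> (real \<Rightarrow> 'a::metric_space) \<Rightarrow> bool" where
  "abs_continuous_curve a b \<gamma> \<longleftrightarrow>
    (\<forall>\<epsilon>>0. \<exists>\<delta>>0. \<forall>D. finite D
        \<and> (\<forall>(s, t)\<in>D. a \<le> s \<and> s \<le> t \<and> t \<le> b)
        \<and> pairwise (\<lambda>(s, t) (s', t'). {s<..<t} \<inter> {s'<..<t'} = {}) D
        \<and> (\<Sum>(s, t)\<in>D. t - s) < \<delta>
      \<longrightarrow> (\<Sum>(s, t)\<in>D. dist (\<gamma> s) (\<gamma> t)) < \<epsilon>)"

text \<open>An absolutely continuous curve is differentiable almost everywhere, so the arbitrary values of
  \<open>vector_derivative\<close> at the remaining points do not affect the integral.\<close>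

definition action ::
  "('n \<Rightarrow> real) \<Rightarrow> real \<Rightarrow> real \<Rightarrow> real \<Rightarrow>
    (real \<Rightarrow> ('e::euclidean_space, 'n::{finite,linorder}) vec) \<Rightarrow> ennreal" where
  "action m \<kappa> a b \<gamma> =
    1 / 2 * (\<integral>\<^sup>+s\<in>{a..b}.
       ennreal (mass_norm_sq m (vector_derivative \<gamma> (at s within {a..b}))) \<partial>lebesgue)
    + (\<integral>\<^sup>+s\<in>{a..b}. potential m \<kappa> (\<gamma> s) \<partial>lebesgue)"

definition curves :: "'a::metric_space \<Rightarrow> 'a \<Rightarrow> real \<Rightarrow> (real \<Rightarrow> 'a) set" where
  "curves x y T = {\<gamma>. abs_continuous_curve 0 T \<gamma> \<and> \<gamma> 0 = x \<and> \<gamma> T = y}"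

definition min_action ::
  "('n \<Rightarrow> real) \<Rightarrow> real \<Rightarrow> ('e::euclidean_space, 'n::{finite,linorder}) vec \<Rightarrow> ('e, 'n) vec \<Rightarrow> real
    \<Rightarrow> ennreal" where
  "min_action m \<kappa> x y T = (INF \<gamma>\<in>curves x y T. action m \<kappa> 0 T \<gamma>)"

definition action_potential ::
  "('n \<Rightarrow> real) \<Rightarrow> real \<Rightarrow> ('e::euclidean_space, 'n::{finite,linorder}) vec \<Rightarrow> ('e, 'n) vec \<Rightarrow> ennreal" where
  "action_potential m \<kappa> x y = (INF T\<in>{0<..}. min_action m \<kappa> x y T)"

definition dominated ::
  "('n \<Rightarrow> real) \<Rightarrow> real \<Rightarrow> (('e::euclidean_space, 'n::{finite,linorder}) vec \<Rightarrow> real) \<Rightarrow> bool" where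
  "dominated m \<kappa> u \<longleftrightarrow>
    (\<forall>x y. ereal (u x - u y) \<le> enn2ereal (action_potential m \<kappa> x y))"

definition lax_oleinik ::
  "('n \<Rightarrow> real) \<Rightarrow> real \<Rightarrow> real \<Rightarrow> (('e::euclidean_space, 'n::{finite,linorder}) vec \<Rightarrow> real)
    \<Rightarrow> ('e, 'n) vec \<Rightarrow> ereal" where
  "lax_oleinik m \<kappa> t u x =
    (if t = 0 then ereal (u x)
     else (INF y. ereal (u y) + enn2ereal (min_action m \<kappa> x y t)))"

definition C1_function :: "('a::real_normed_vector \<Rightarrow> real) \<Rightarrow> bool" where
  "C1_function \<psi> \<longleftrightarrow>
    (\<exists>D :: 'a \<Rightarrow> 'a \<Rightarrow>\<^sub>L real.
       (\<forall>x. (\<psi> has_derivative blinfun_apply (D x)) (at x)) \<and> continuous_on UNIV D)"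

definition viscosity_subsolution_at ::
  "('n \<Rightarrow> real) \<Rightarrow> real \<Rightarrow> (('e::euclidean_space, 'n::{finite,linorder}) vec \<Rightarrow> real)
    \<Rightarrow> ('e, 'n) vec \<Rightarrow> bool" where
  "viscosity_subsolution_at m \<kappa> u x0 \<longleftrightarrow>
    (\<forall>\<psi>. C1_function \<psi> \<and> (\<forall>x. u x - \<psi> x \<le> u x0 - \<psi> x0) \<longrightarrow>
       ennreal (dual_norm_sq m (frechet_derivative \<psi> (at x0))) \<le> 2 * potential m \<kappa> x0)"

definition viscosity_supersolution_at ::
  "('n \<Rightarrow> real) \<Rightarrow> real \<Rightarrow> (('e::euclidean_space, 'n::{finite,linorder}) vec \<Rightarrow> real)
    \<Rightarrow> ('e, 'n) vec \<Rightarrow> bool" where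
  "viscosity_supersolution_at m \<kappa> u x0 \<longleftrightarrow>
    (\<forall>\<psi>. C1_function \<psi> \<and> (\<forall>x. u x - \<psi> x \<ge> u x0 - \<psi> x0) \<longrightarrow>
       ennreal (dual_norm_sq m (frechet_derivative \<psi> (at x0))) \<ge> 2 * potential m \<kappa> x0)"

definition viscosity_subsolution_on ::
  "('n \<Rightarrow> real) \<Rightarrow> real \<Rightarrow> ('e::euclidean_space, 'n::{finite,linorder}) vec set
    \<Rightarrow> (('e, 'n) vec \<Rightarrow> real) \<Rightarrow> bool" where
  "viscosity_subsolution_on m \<kappa> V u \<longleftrightarrow> (\<forall>x0\<in>V. viscosity_subsolution_at m \<kappa> u x0)"

definition viscosity_supersolution_on ::
  "('n \<Rightarrow> real) \<Rightarrow> real \<Rightarrow> ('e::euclidean_space, 'n::{finite,linorder}) vec set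
    \<Rightarrow> (('e, 'n) vec \<Rightarrow> real) \<Rightarrow> bool" where
  "viscosity_supersolution_on m \<kappa> V u \<longleftrightarrow> (\<forall>x0\<in>V. viscosity_supersolution_at m \<kappa> u x0)"

definition viscosity_solution_on ::
  "('n \<Rightarrow> real) \<Rightarrow> real \<Rightarrow> ('e::euclidean_space, 'n::{finite,linorder}) vec set
    \<Rightarrow> (('e, 'n) vec \<Rightarrow> real) \<Rightarrow> bool" where
  "viscosity_solution_on m \<kappa> V u \<longleftrightarrow>
    continuous_on UNIV u \<and> viscosity_subsolution_on m \<kappa> V u \<and> viscosity_supersolution_on m \<kappa> V u"

end

(*
  For dominated u every explicit curve bounds increments of u by its action. Unit speed segments
  make u locally Lipschitz off the null set of collisions, so that Rademacher's theorem applies, and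
  affine curves give the subsolution inequality. Every configuration can be left along a curve
  s \<mapsto> x + s^(1/(1+\<kappa>)) e with small action, provided that e spreads the bodies along a line in an order
  compatible with x; configurations close to each other share such an e, hence u is continuous, and
  it grows at most linearly. The supersolution inequality compares the first-order expansion of a
  test function with the action of almost minimizers over a short time t; it needs only
  |\<gamma>(s) - \<gamma>(0)|^2 \<le> s \<integral>|\<gamma>'|^2, that is, almost everywhere differentiability and the fundamental
  theorem of calculus for absolutely continuous curves. The former is obtained without monotone
  functions: by Vitali's covering theorem and Henstock's lemma the integral of the upper derivate is
  at most the increment of the function, and symmetrically for the lower derivate.
*)
theory Submission
  imports Defs
begin

hide_const (open) Polynomial.content

subsection \<open>Absolutely continuous functions of one variable\<close>

text \<open>In dimension one the bodies cannot pass around each other, so close configurations with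
  different orders are joined only through collisions, and segments alone do not give continuity of
  \<open>u\<close>. The remedy is convexity: configurations whose projections to a line keep a fixed
  order with gaps at least \<open>r\<close> form a convex set with bounded potential, so two
  configurations with a common compatible order are compared by two short ejections into this set
  and a segment inside it.

  Linear growth matters because the Lax-Oleinik infimum ranges over all endpoints. It bounds the
  action of almost minimizers uniformly for times up to 1, and the displacement estimate then keeps
  them close to their starting point. Their excess action \<open>t\<^sup>2\<close> tends to 0 even
  after division by \<open>t\<close>.

  The integrands of the action are never shown to be measurable. Every comparison is an instance of
  monotonicity of the nonnegative integral, with constants and affine functions of the velocity from
  below and derivatives of explicit functions from above.\<close>

definition short_family :: "real \<Rightarrow> real \<Rightarrow> real \<Rightarrow> (real \<times> real) set \<Rightarrow> bool" where
  "short_family a b d D \<longleftrightarrow> finite D \<and> (\<forall>(s, t)\<in>D. a \<le> s \<and> s \<le> t \<and> t \<le> b) \<and>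
    pairwise (\<lambda>(s, t) (s', t'). {s<..<t} \<inter> {s'<..<t'} = {}) D \<and> (\<Sum>(s, t)\<in>D. t - s) < d"

lemma abs_continuous_curve_iff:
  "abs_continuous_curve a b f \<longleftrightarrow>
    (\<forall>e>0. \<exists>d>0. \<forall>D. short_family a b d D \<longrightarrow> (\<Sum>(s, t)\<in>D. dist (f s) (f t)) < e)"
  unfolding abs_continuous_curve_def short_family_def ..

lemma abs_continuous_curveE:
  assumes "abs_continuous_curve a b f" "e > 0"
  obtains d where "d > 0" "\<And>D. short_family a b d D \<Longrightarrow> (\<Sum>(s, t)\<in>D. dist (f s) (f t)) < e"
  using assms unfolding abs_continuous_curve_iff by blast

lemma abs_continuous_curve_division:
  fixes f :: "real \<Rightarrow> 'a::real_normed_vector"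
  assumes "abs_continuous_curve a b f" "e > 0"
  obtains d where "d > 0"
    "\<And>D. D division_of \<Union>D \<Longrightarrow> \<Union>D \<subseteq> {a..b} \<Longrightarrow> sum content D < d \<Longrightarrow>
      (\<Sum>K\<in>D. norm (f (Sup K) - f (Inf K))) < e"
proof -
  obtain d where "d > 0" and d: "\<And>D. short_family a b d D \<Longrightarrow> (\<Sum>(s, t)\<in>D. dist (f s) (f t)) < e"
    by (rule abs_continuous_curveE[OF assms]) blast
  show thesis
  proof (rule that[OF \<open>d > 0\<close>])
    fix D :: "real set set"
    assume D: "D division_of \<Union>D" and sub: "\<Union>D \<subseteq> {a..b}" and len: "sum content D < d"
    define g where "g K = (Inf K, Sup K)" for K :: "real set"
    have fin: "finite D" using D by auto
    have form: "K = {Inf K..Sup K} \<and> Inf K \<le> Sup K \<and> a \<le> Inf K \<and> Sup K \<le> b" if K: "K \<in> D" for K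
    proof -
      obtain u v where "K = cbox u v" "K \<noteq> {}" using division_ofD(3)[OF D K] division_ofD(4)[OF D K] by metis
      then have uv: "K = {u..v}" "u \<le> v" by auto
      moreover have "K \<subseteq> {a..b}" using sub K by blast
      ultimately show ?thesis by auto
    qed
    have inj: "inj_on g D"
      by (rule inj_onI) (metis form g_def prod.inject)
    have "(\<Sum>(s, t)\<in>g ` D. dist (f s) (f t)) < e"
    proof (rule d, unfold short_family_def, intro conjI)
      show "finite (g ` D)" using fin by simp
      show "\<forall>(s, t)\<in>g ` D. a \<le> s \<and> s \<le> t \<and> t \<le> b" using form by (auto simp: g_def)
      have "{Inf K<..<Sup K} \<inter> {Inf K'<..<Sup K'} = {}" if "K \<in> D" "K' \<in> D" "K \<noteq> K'" for K K'
        using division_ofD(5)[OF D that] form[OF that(1)] form[OF that(2)] interior_atLeastAtMost_real by metis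
      then show "pairwise (\<lambda>(s, t) (s', t'). {s<..<t} \<inter> {s'<..<t'} = {}) (g ` D)"
        unfolding pairwise_def g_def by fastforce
      have "content K = Sup K - Inf K" if "K \<in> D" for K
        using form[OF that] by (metis content_real)
      then have "(\<Sum>(s, t)\<in>g ` D. t - s) = sum content D"
        by (subst sum.reindex[OF inj]) (auto simp: g_def intro!: sum.cong)
      then show "(\<Sum>(s, t)\<in>g ` D. t - s) < d" using len by simp
    qed
    then show "(\<Sum>K\<in>D. norm (f (Sup K) - f (Inf K))) < e"
      by (subst (asm) sum.reindex[OF inj]) (simp add: g_def dist_norm norm_minus_commute)
  qed
qed

lemma abs_continuous_curve_subinterval:
  assumes "abs_continuous_curve a b f" "a \<le> a'" "b' \<le> b"
  shows "abs_continuous_curve a' b' f"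
  unfolding abs_continuous_curve_iff
proof (intro allI impI)
  fix e :: real assume "e > 0"
  then obtain d where "d > 0" and d: "\<And>D. short_family a b d D \<Longrightarrow> (\<Sum>(s, t)\<in>D. dist (f s) (f t)) < e"
    by (rule abs_continuous_curveE[OF assms(1)]) blast
  show "\<exists>d>0. \<forall>D. short_family a' b' d D \<longrightarrow> (\<Sum>(s, t)\<in>D. dist (f s) (f t)) < e"
    using assms(2,3) by (intro exI[of _ d] conjI \<open>d > 0\<close> allI impI d) (fastforce simp: short_family_def)
qed

lemma abs_continuous_curve_lipschitz_image:
  assumes "abs_continuous_curve a b f" and L: "\<And>x y. dist (h x) (h y) \<le> L * dist x y"
  shows "abs_continuous_curve a b (\<lambda>s. h (f s))"
  unfolding abs_continuous_curve_iff
proof (intro allI impI)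
  fix e :: real assume "e > 0"
  then have "e / (\<bar>L\<bar> + 1) > 0" by simp
  then obtain d where "d > 0" and d: "\<And>D. short_family a b d D \<Longrightarrow> (\<Sum>(s, t)\<in>D. dist (f s) (f t)) < e / (\<bar>L\<bar> + 1)"
    using abs_continuous_curveE[OF assms(1) \<open>e / (\<bar>L\<bar> + 1) > 0\<close>] by blast
  have "(\<Sum>(s, t)\<in>D. dist (h (f s)) (h (f t))) < e" if "short_family a b d D" for D
  proof -
    have "dist (h x) (h y) \<le> (\<bar>L\<bar> + 1) * dist x y" for x y
      by (rule order_trans[OF L mult_right_mono]) auto
    then have "(\<Sum>(s, t)\<in>D. dist (h (f s)) (h (f t))) \<le> (\<bar>L\<bar> + 1) * (\<Sum>(s, t)\<in>D. dist (f s) (f t))"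
      unfolding sum_distrib_left by (intro sum_mono) auto
    also have "\<dots> < e" using d[OF that] by (simp add: field_simps)
    finally show ?thesis .
  qed
  then show "\<exists>d>0. \<forall>D. short_family a b d D \<longrightarrow> (\<Sum>(s, t)\<in>D. dist (h (f s)) (h (f t))) < e"
    using \<open>d > 0\<close> by blast
qed

lemma abs_continuous_curve_inner:
  fixes f :: "real \<Rightarrow> 'a::real_inner"
  assumes "abs_continuous_curve a b f"
  shows "abs_continuous_curve a b (\<lambda>s. f s \<bullet> q)"
proof (rule abs_continuous_curve_lipschitz_image[OF assms, of _ "norm q"])
  show "dist (x \<bullet> q) (y \<bullet> q) \<le> norm q * dist x y" for x y
    using Cauchy_Schwarz_ineq2[of "x - y" q] by (simp add: dist_norm inner_diff_left mult.commute)
qed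

lemma abs_continuous_curve_imp_continuous_on:
  assumes "abs_continuous_curve a b f"
  shows "continuous_on {a..b} f"
  unfolding continuous_on_iff
proof (intro ballI allI impI)
  fix x e :: real assume x: "x \<in> {a..b}" and "e > 0"
  then obtain d where "d > 0" and d: "\<And>D. short_family a b d D \<Longrightarrow> (\<Sum>(s, t)\<in>D. dist (f s) (f t)) < e"
    using abs_continuous_curveE[OF assms \<open>e > 0\<close>] by blast
  have "dist (f y) (f x) < e" if "y \<in> {a..b}" "dist y x < d" for y
    using d[of "{(min x y, max x y)}"] x that
    by (cases "x \<le> y") (auto simp: short_family_def dist_real_def dist_commute)
  then show "\<exists>d>0. \<forall>x'\<in>{a..b}. dist x' x < d \<longrightarrow> dist (f x') (f x) < e"
    using \<open>d > 0\<close> by blast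
qed

text \<open>Turns a local property into a statement about an integral. If almost every point lies
  inside arbitrarily short intervals satisfying \<open>Q\<close>, Vitali's theorem selects disjoint
  ones that cover almost everything, and finitely many of them capture the length and the integral
  of \<open>k\<close> up to a small error. Taken inside the gauge of \<open>k\<close> they form a
  fine partial tagged division, so Henstock's lemma replaces the integrals over them by the values
  of \<open>k\<close> at the tags.\<close>

lemma vitali_henstock:
  fixes k :: "real \<Rightarrow> real"
  assumes "a < b" and k: "k absolutely_integrable_on {a..b}" and N: "negligible N" and "e > 0"
    and cov: "\<And>x d. x \<in> {a<..<b} - N \<Longrightarrow> 0 < d \<Longrightarrow>
      \<exists>s t. a \<le> s \<and> s < x \<and> x < t \<and> t \<le> b \<and> t - s < d \<and> Q s t x"
  obtains p where "p tagged_partial_division_of {a..b}"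
    "\<And>x K. (x, K) \<in> p \<Longrightarrow> \<exists>s t. K = {s..t} \<and> s < t \<and> Q s t x"
    "\<bar>(\<Sum>(x, K)\<in>p. k x * content K) - integral {a..b} k\<bar> < e"
    "b - a - e < (\<Sum>(x, K)\<in>p. content K)" "inj_on snd p"
proof -
  have kint: "k integrable_on cbox a b"
    using k set_lebesgue_integral_eq_integral(1) by auto
  \<comment> \<open>Henstock's lemma costs a factor \<open>2 * DIM(real)\<close>, so
    \<open>e/8\<close> becomes \<open>e/4\<close>; with \<open>e/2\<close> for the passage to
    finitely many intervals the total stays below \<open>e\<close>.\<close>
  then obtain \<gamma> where "gauge \<gamma>" and \<gamma>: "\<And>D. D tagged_division_of cbox a b \<Longrightarrow> \<gamma> fine D \<Longrightarrow>
      norm ((\<Sum>(x,K)\<in>D. content K *\<^sub>R k x) - integral (cbox a b) k) < e/8"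
    using \<open>e > 0\<close> integrable_integral[OF kint] unfolding has_integral by (metis zero_less_divide_iff zero_less_numeral)
  define S where "S = {a<..<b} - N"
  define W where "W = {(x, s, t). x \<in> S \<and> a \<le> s \<and> s < x \<and> x < t \<and> t \<le> b \<and> {s..t} \<subseteq> \<gamma> x \<and> Q s t x}"
  \<comment> \<open>The covering theorem speaks of balls. An index keeps the tag and both endpoints,
    and the ball is the interval seen from its midpoint, which in general is not the tag.\<close>
  define ce where "ce = (\<lambda>(x::real, s::real, t::real). (s + t) / 2)"
  define ra where "ra = (\<lambda>(x::real, s::real, t::real). (t - s) / 2)"
  define I where "I = (\<lambda>(x::real, s::real, t::real). {s..t})"
  have I: "cball (ce i) (ra i) = I i" for i
    by (cases i) (auto simp: ce_def ra_def I_def cball_eq_atLeastAtMost field_simps)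
  have Wpos: "0 < ra i" if "i \<in> W" for i using that by (auto simp: W_def ra_def)
  have Wcov: "\<exists>i. i \<in> W \<and> x \<in> cball (ce i) (ra i) \<and> ra i < d" if x: "x \<in> S" and "0 < d" for x d
  proof -
    obtain r where "r > 0" and r: "ball x r \<subseteq> \<gamma> x" using \<open>gauge \<gamma>\<close> unfolding gauge_def
      by (meson openE)
    obtain s t where st: "a \<le> s" "s < x" "x < t" "t \<le> b" "t - s < min r d" "Q s t x"
      using cov[of x "min r d"] x \<open>r > 0\<close> \<open>0 < d\<close> unfolding S_def by auto
    have "{s..t} \<subseteq> ball x r" using st by (auto simp: dist_real_def)
    then have "(x, s, t) \<in> W" using st x r by (auto simp: W_def)
    moreover have "x \<in> I (x, s, t)" "ra (x, s, t) < d" using st by (auto simp: I_def ra_def)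
    ultimately show ?thesis unfolding I by blast
  qed
  obtain C where C: "countable C" "C \<subseteq> W" "pairwise (\<lambda>i j. disjnt (I i) (I j)) C"
      "negligible (S - (\<Union>i\<in>C. I i))"
    using Vitali_covering_theorem_cballs[of W ra S ce, OF Wpos Wcov] unfolding I by metis
  have nonneg: "\<not> negligible S"
  proof
    assume "negligible S"
    then have "negligible (S \<union> N)" using N by (rule negligible_Un)
    then have "negligible {a<..<b}" by (rule negligible_subset) (auto simp: S_def)
    then show False using negligible_interval(2)[of a b] \<open>a < b\<close> by auto
  qed
  then have "C \<noteq> {}" using C(4) by auto
  \<comment> \<open>\<open>from_nat_into\<close> enumerates the nonempty countable set
    \<open>C\<close>, with repetitions if \<open>C\<close> is finite, so the finite sets
    \<open>Cn n\<close> exhaust \<open>C\<close> in either case.\<close>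
  define Cn where "Cn n = from_nat_into C ` {..<n}" for n
  define A where "A n = (\<Union>i\<in>Cn n. I i)" for n :: nat
  define U where "U = (\<Union>i\<in>C. I i)"
  have CnC: "Cn n \<subseteq> C" for n unfolding Cn_def using from_nat_into[OF \<open>C \<noteq> {}\<close>] by auto
  have rC: "range (from_nat_into C) = C" by (rule range_from_nat_into[OF \<open>C \<noteq> {}\<close> C(1)])
  have "(\<Union>n. Cn n) = range (from_nat_into C)"
    unfolding Cn_def by auto
  then have "(\<Union>n. Cn n) = C" using rC by simp
  then have UA: "(\<Union>n. A n) = U" unfolding A_def U_def by blast
  have inc: "incseq A" unfolding incseq_def A_def Cn_def by force
  have Im: "I i \<in> sets lebesgue" for i by (cases i) (auto simp: I_def)
  have fCn: "finite (Cn n)" for n by (simp add: Cn_def)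
  have Am: "A n \<in> sets lebesgue" for n unfolding A_def using fCn Im by auto
  have Isub: "I i \<subseteq> {a..b}" if "i \<in> C" for i using C(2) that by (force simp: W_def I_def)
  have Usub: "U \<subseteq> {a..b}" using Isub by (auto simp: U_def)
  have Asub: "A n \<subseteq> {a..b}" for n using Isub CnC[of n] unfolding A_def by auto
  have Um: "U \<in> sets lebesgue" using UA Am by (metis sets.countable_UN image_subset_iff UNIV_I subsetI)
  have abU: "negligible ({a..b} - U)"
  proof (rule negligible_subset)
    show "negligible ((S - U) \<union> N \<union> {a, b})" using C(4) N by (simp add: U_def negligible_Un negligible_finite)
    show "{a..b} - U \<subseteq> (S - U) \<union> N \<union> {a, b}" by (auto simp: S_def)
  qed
  have lim: "(\<lambda>n. integral (A n) h) \<longlonglongrightarrow> integral {a..b} h"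
    if h: "h absolutely_integrable_on {a..b}" for h :: "real \<Rightarrow> real"
  proof -
    have hU: "set_integrable lebesgue (\<Union>n. A n) h"
      unfolding UA by (rule set_integrable_subset[OF h Um Usub])
    have "(\<lambda>n. LINT x:A n|lebesgue. h x) \<longlonglongrightarrow> (LINT x:(\<Union>n. A n)|lebesgue. h x)"
      by (rule set_integral_cont_up[OF Am inc hU])
    moreover have "(LINT x:A n|lebesgue. h x) = integral (A n) h" for n
      by (rule set_lebesgue_integral_eq_integral(2)) (rule set_integrable_subset[OF h Am Asub])
    moreover have "(LINT x:(\<Union>n. A n)|lebesgue. h x) = integral {a..b} h"
    proof -
      have "(LINT x:(\<Union>n. A n)|lebesgue. h x) = integral U h"
        unfolding UA by (rule set_lebesgue_integral_eq_integral(2)) (use hU UA in simp)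
      also have "\<dots> = integral {a..b} h"
      proof (rule integral_spike_set)
        show "negligible {x \<in> {a..b} - U. h x \<noteq> 0}" by (rule negligible_subset[OF abU]) auto
        show "negligible {x \<in> U - {a..b}. h x \<noteq> 0}" using Usub by (auto simp: Diff_eq_empty_iff[THEN iffD2])
      qed
      finally show ?thesis .
    qed
    ultimately show ?thesis by simp
  qed
  have "\<forall>\<^sub>F n in sequentially. \<bar>integral (A n) k - integral {a..b} k\<bar> < e/2"
    using tendstoD[OF lim[OF k], of "e/2"] \<open>e > 0\<close> by (simp add: dist_real_def)
  moreover have "\<forall>\<^sub>F n in sequentially. \<bar>integral (A n) (\<lambda>x. 1::real) - integral {a..b} (\<lambda>x. 1)\<bar> < e"
    using tendstoD[OF lim[of "\<lambda>x. 1"], of e] \<open>e > 0\<close> by (simp add: dist_real_def absolutely_integrable_on_const)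
  ultimately have "\<forall>\<^sub>F n in sequentially. \<bar>integral (A n) k - integral {a..b} k\<bar> < e/2 \<and>
      \<bar>integral (A n) (\<lambda>x. 1::real) - integral {a..b} (\<lambda>x. 1)\<bar> < e"
    by (rule eventually_conj)
  then obtain n where n: "\<bar>integral (A n) k - integral {a..b} k\<bar> < e/2"
      "\<bar>integral (A n) (\<lambda>x. 1::real) - integral {a..b} (\<lambda>x. 1)\<bar> < e"
    using eventually_happens'[OF sequentially_bot] by blast
  define T where "T = (\<lambda>i::real \<times> real \<times> real. (fst i, I i))"
  define p where "p = T ` Cn n"
  have inW: "i \<in> W" if "i \<in> Cn n" for i using that CnC C(2) by blast
  have Ine: "I i \<noteq> {}" if "i \<in> Cn n" for i using inW[OF that] by (auto simp: W_def I_def)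
  have disj: "disjnt (I i) (I j)" if "i \<in> Cn n" "j \<in> Cn n" "i \<noteq> j" for i j
    using C(3) CnC that unfolding pairwise_def by blast
  have inj: "inj_on I (Cn n)"
    by (rule inj_onI) (metis disj Ine disjnt_self_iff_empty)
  then have injT: "inj_on T (Cn n)" unfolding T_def inj_on_def by auto
  have ptag: "p tagged_partial_division_of cbox a b"
  proof -
    have 1: "x \<in> K \<and> K \<subseteq> cbox a b \<and> (\<exists>a b. K = cbox a b)" if P: "(x, K) \<in> p" for x K
    proof -
      obtain s t where i: "(x, s, t) \<in> Cn n" "K = {s..t}" using P by (auto simp: p_def T_def I_def)
      show ?thesis using inW[OF i(1)] i(2) cbox_interval[of s t] by (force simp: W_def)
    qed
    have 2: "interior K \<inter> interior K' = {}"
      if P: "(x, K) \<in> p" "(x', K') \<in> p" "(x, K) \<noteq> (x', K')" for x K x' K'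
    proof -
      obtain s t where i: "(x, s, t) \<in> Cn n" "K = {s..t}" using P(1) by (auto simp: p_def T_def I_def)
      obtain s' t' where j: "(x', s', t') \<in> Cn n" "K' = {s'..t'}" using P(2) by (auto simp: p_def T_def I_def)
      have "disjnt K K'" using disj[OF i(1) j(1)] i(2) j(2) P(3) by (auto simp: I_def)
      then show ?thesis using interior_subset unfolding disjnt_def by fast
    qed
    have 3: "finite p" by (simp add: p_def fCn)
    show ?thesis unfolding tagged_partial_division_of_def
      by (intro conjI 3 allI impI) (use 1 2 in blast)+
  qed
  have fine: "\<gamma> fine p"
  proof (rule fineI)
    fix x K assume "(x, K) \<in> p"
    then obtain s t where i: "(x, s, t) \<in> Cn n" "K = {s..t}" by (auto simp: p_def T_def I_def)
    then show "K \<subseteq> \<gamma> x" using inW[OF i(1)] by (auto simp: W_def)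
  qed
  have H: "(\<Sum>(x, K)\<in>p. norm (content K *\<^sub>R k x - integral K k)) \<le> 2 * real (DIM(real)) * (e/8)"
    by (rule Henstock_lemma_part2[OF kint _ \<open>gauge \<gamma>\<close> _ ptag fine]) (use \<gamma> \<open>e > 0\<close> in auto)
  have snd: "snd ` p = I ` Cn n" by (auto simp: p_def T_def image_image)
  have div: "I ` Cn n division_of A n"
    using partial_division_of_tagged_division[OF ptag] unfolding snd A_def by simp
  have sumI: "(\<Sum>(x, K)\<in>p. integral K h) = integral (A n) h"
    if h: "h absolutely_integrable_on {a..b}" for h :: "real \<Rightarrow> real"
  proof -
    have "(\<Sum>(x, K)\<in>p. integral K h) = (\<Sum>i\<in>Cn n. integral (I i) h)"
      unfolding p_def by (subst sum.reindex[OF injT]) (simp add: T_def)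
    also have "\<dots> = (\<Sum>K\<in>I ` Cn n. integral K h)"
      by (subst sum.reindex[OF inj]) simp
    also have "\<dots> = integral (A n) h"
      by (rule integral_combine_division_topdown[symmetric, OF _ div])
        (rule set_lebesgue_integral_eq_integral(1)[OF set_integrable_subset[OF h Am Asub]])
    finally show ?thesis .
  qed
  show thesis
  proof (rule that)
    show "p tagged_partial_division_of {a..b}" using ptag by simp
    fix x K assume "(x, K) \<in> p"
    then obtain s t where i: "(x, s, t) \<in> Cn n" "K = {s..t}" by (auto simp: p_def T_def I_def)
    then show "\<exists>s t. K = {s..t} \<and> s < t \<and> Q s t x"
      using inW[OF i(1)] by (intro exI[of _ s] exI[of _ t]) (auto simp: W_def)
  next
    have "\<bar>(\<Sum>(x, K)\<in>p. k x * content K) - integral (A n) k\<bar> = \<bar>\<Sum>(x, K)\<in>p. content K *\<^sub>R k x - integral K k\<bar>"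
      unfolding sumI[OF k, symmetric] by (simp add: sum_subtractf[symmetric] case_prod_unfold mult.commute)
    also have "\<dots> \<le> (\<Sum>(x, K)\<in>p. norm (content K *\<^sub>R k x - integral K k))"
      by (rule order_trans[OF sum_abs]) (simp add: case_prod_unfold)
    also have "\<dots> \<le> e/4" using H by simp
    finally show "\<bar>(\<Sum>(x, K)\<in>p. k x * content K) - integral {a..b} k\<bar> < e" using n(1) \<open>e > 0\<close> by linarith
  next
    have "integral (A n) (\<lambda>x. 1::real) = (\<Sum>(x, K)\<in>p. integral K (\<lambda>x. 1))"
      by (rule sumI[symmetric]) (simp add: absolutely_integrable_on_const)
    also have "\<dots> = (\<Sum>(x, K)\<in>p. content K)"
    proof (rule sum.cong[OF refl], clarify)
      fix x K assume "(x, K) \<in> p"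
      then obtain u v where "K = cbox u v" using tagged_partial_division_ofD(4)[OF ptag] by blast
      then show "integral K (\<lambda>x. 1::real) = content K" by simp
    qed
    finally show "b - a - e < (\<Sum>(x, K)\<in>p. content K)" using n(2) \<open>a < b\<close> by simp
  next
    show "inj_on snd p" using inj by (auto simp: inj_on_def p_def T_def)
  qed
qed

text \<open>Left endpoints serve as tags, which reduces the sum to the telescoping of tagged
  divisions.\<close>

lemma division_telescope:
  fixes f :: "real \<Rightarrow> real"
  assumes "a \<le> b" "q division_of {a..b}"
  shows "(\<Sum>K\<in>q. f (Sup K) - f (Inf K)) = f b - f a"
proof -
  define p where "p = (\<lambda>K. (Inf K, K)) ` q"
  have form: "K = {Inf K..Sup K} \<and> Inf K \<in> K" if K: "K \<in> q" for K
  proof -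
    obtain u v where "K = cbox u v" "K \<noteq> {}"
      using division_ofD(3)[OF assms(2) K] division_ofD(4)[OF assms(2) K] by metis
    then show ?thesis by auto
  qed
  have "p tagged_division_of {a..b}"
  proof (rule tagged_division_ofI)
    show "finite p" using assms(2) by (auto simp: p_def)
    show "\<Union>{K. \<exists>x. (x, K) \<in> p} = {a..b}"
      using division_ofD(6)[OF assms(2)] by (auto simp: p_def image_iff Bex_def)
    fix x K assume "(x, K) \<in> p"
    then have K: "K \<in> q" "x = Inf K" by (auto simp: p_def)
    show "x \<in> K" using form[OF K(1)] K by simp
    show "K \<subseteq> {a..b}" using division_ofD(2)[OF assms(2) K(1)] .
    show "\<exists>a b. K = cbox a b" using division_ofD(4)[OF assms(2) K(1)] .
    fix x' K' assume "(x', K') \<in> p" "(x, K) \<noteq> (x', K')"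
    then show "interior K \<inter> interior K' = {}"
      using division_ofD(5)[OF assms(2) K(1)] K by (auto simp: p_def)
  qed
  then have "(\<Sum>(x, K)\<in>p. f (Sup K) - f (Inf K)) = f b - f a"
    by (rule additive_tagged_division_1[OF assms(1)])
  then show ?thesis
    unfolding p_def by (subst (asm) sum.reindex) (auto simp: inj_on_def)
qed

section \<open>Derivates and almost everywhere differentiability\<close>

definition straddle_quotients :: "(real \<Rightarrow> real) \<Rightarrow> real \<Rightarrow> real \<Rightarrow> real \<Rightarrow> nat \<Rightarrow> ereal set" where
  "straddle_quotients f a b x n =
    {ereal ((f t - f s) / (t - s)) | s t. a \<le> s \<and> s < x \<and> x < t \<and> t \<le> b \<and> t - s < 1 / real (Suc n)}"

text \<open>The upper limit of difference quotients over intervals that shrink to \<open>x\<close>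
  and contain it in their interior. The lower derivate is expressed as minus the upper derivate of
  the negated function.\<close>

definition upper_derivate :: "(real \<Rightarrow> real) \<Rightarrow> real \<Rightarrow> real \<Rightarrow> real \<Rightarrow> ereal" where
  "upper_derivate f a b x = (INF n. Sup (straddle_quotients f a b x n))"

text \<open>For fixed \<open>s\<close> and \<open>t\<close> the condition \<open>s < x < t\<close>
  is open in \<open>x\<close>, so a strict superlevel set of the supremum is a union of open
  intervals for arbitrary \<open>f\<close>. This is why the quotients straddle \<open>x\<close>
  instead of starting there.\<close>

lemma borel_measurable_upper_derivate [measurable]:
  "upper_derivate f a b \<in> borel_measurable borel"
proof -
  have "(\<lambda>x. Sup (straddle_quotients f a b x n)) \<in> borel_measurable borel" for n
  proof (rule borel_measurableI_greater)
    fix y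
    have "{x \<in> space borel. y < Sup (straddle_quotients f a b x n)} =
        (\<Union>(s, t)\<in>{(s, t). a \<le> s \<and> t \<le> b \<and> t - s < 1 / real (Suc n) \<and> y < ereal ((f t - f s) / (t - s))}. {s<..<t})"
      unfolding less_Sup_iff straddle_quotients_def by (auto; blast)
    then show "{x \<in> space borel. y < Sup (straddle_quotients f a b x n)} \<in> sets borel"
      by (auto intro!: borel_open)
  qed
  then show ?thesis unfolding upper_derivate_def by (intro borel_measurable_INF) auto
qed

lemma less_upper_derivateD:
  assumes "ereal c < upper_derivate f a b x" "0 < d"
  shows "\<exists>s t. a \<le> s \<and> s < x \<and> x < t \<and> t \<le> b \<and> t - s < d \<and> c * (t - s) < f t - f s"
proof -
  obtain n where n: "inverse (real (Suc n)) < d" using reals_Archimedean[OF assms(2)] by blast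
  have "ereal c < Sup (straddle_quotients f a b x n)"
    using assms(1) unfolding upper_derivate_def by (meson INF_lower UNIV_I less_le_trans)
  then obtain s t where "a \<le> s" "s < x" "x < t" "t \<le> b" "t - s < 1 / real (Suc n)"
      "c < (f t - f s) / (t - s)"
    unfolding less_Sup_iff straddle_quotients_def by auto
  moreover from this have "t - s < d" using n by (simp add: inverse_eq_divide)
  ultimately show ?thesis
    by (intro exI[of _ s] exI[of _ t]) (auto simp: field_simps)
qed

lemma upper_derivate_lessD:
  assumes "upper_derivate f a b x < ereal c"
  obtains d where "0 < d" "\<And>s t. a \<le> s \<Longrightarrow> s < x \<Longrightarrow> x < t \<Longrightarrow> t \<le> b \<Longrightarrow> t - s < d \<Longrightarrow> f t - f s < c * (t - s)"
proof -
  obtain n where n: "Sup (straddle_quotients f a b x n) < ereal c"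
    using assms unfolding upper_derivate_def INF_less_iff by blast
  show thesis
  proof (rule that)
    show "0 < 1 / real (Suc n)" by simp
    fix s t assume "a \<le> s" "s < x" "x < t" "t \<le> b" "t - s < 1 / real (Suc n)"
    then have "ereal ((f t - f s) / (t - s)) \<le> Sup (straddle_quotients f a b x n)"
      by (intro Sup_upper) (auto simp: straddle_quotients_def)
    then have "ereal ((f t - f s) / (t - s)) < ereal c" using n by (rule le_less_trans)
    then show "f t - f s < c * (t - s)" using \<open>s < x\<close> \<open>x < t\<close> by (simp add: field_simps)
  qed
qed

text \<open>A single short interval around \<open>x\<close> would have to satisfy two contradictory
  bounds. At an endpoint of the interval nothing straddles \<open>x\<close>, both suprema are taken
  over the empty set, and the inequality fails; hence the strict hypotheses.\<close>

lemma upper_derivate_minus: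
  assumes "a < x" "x < b"
  shows "- upper_derivate (\<lambda>x. - f x) a b x \<le> upper_derivate f a b x"
proof (rule ccontr)
  assume "\<not> ?thesis"
  then obtain c where c: "upper_derivate f a b x < ereal c"
      "ereal c < - upper_derivate (\<lambda>x. - f x) a b x"
    using ereal_dense2 by (metis not_le)
  then have "upper_derivate (\<lambda>x. - f x) a b x < ereal (- c)"
    by (metis ereal_less_uminus_reorder uminus_ereal.simps(1))
  then obtain d where "0 < d" and d: "\<And>s t. a \<le> s \<Longrightarrow> s < x \<Longrightarrow> x < t \<Longrightarrow> t \<le> b \<Longrightarrow> t - s < d \<Longrightarrow>
      - f t - - f s < - c * (t - s)"
    using upper_derivate_lessD by metis
  obtain d' where "0 < d'" and d': "\<And>s t. a \<le> s \<Longrightarrow> s < x \<Longrightarrow> x < t \<Longrightarrow> t \<le> b \<Longrightarrow> t - s < d' \<Longrightarrow>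
      f t - f s < c * (t - s)"
    using upper_derivate_lessD[OF c(1)] by metis
  define h where "h = min (min (d/3) (d'/3)) (min (x - a) (b - x))"
  have "0 < h" using assms \<open>0 < d\<close> \<open>0 < d'\<close> by (auto simp: h_def)
  have "h \<le> d/3" "h \<le> d'/3" "h \<le> x - a" "h \<le> b - x" unfolding h_def by linarith+
  then show False using d[of "x - h" "x + h"] d'[of "x - h" "x + h"] \<open>0 < h\<close> by auto
qed

text \<open>The derivates control only intervals with \<open>x\<close> strictly inside. Letting one
  endpoint tend to \<open>x\<close> carries the estimate over to intervals that start or end at
  \<open>x\<close>, and this is where continuity of \<open>f\<close> enters. The limit loses
  strictness, hence the factor \<open>e/2\<close>.\<close>

lemma has_derivative_upper_derivate:
  assumes f: "continuous_on {a..b} f" and x: "a < x" "x < b"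
    and up: "upper_derivate f a b x = ereal L"
    and lo: "upper_derivate (\<lambda>x. - f x) a b x = ereal (- L)"
  shows "(f has_real_derivative L) (at x)"
  unfolding DERIV_def LIM_def
proof (intro allI impI)
  fix e :: real assume "e > 0"
  obtain d1 where "0 < d1" and d1: "\<And>s t. a \<le> s \<Longrightarrow> s < x \<Longrightarrow> x < t \<Longrightarrow> t \<le> b \<Longrightarrow> t - s < d1 \<Longrightarrow>
      f t - f s < (L + e/2) * (t - s)"
    by (rule upper_derivate_lessD[of f a b x "L + e/2"]) (use up \<open>e > 0\<close> in auto)
  obtain d2 where "0 < d2" and d2: "\<And>s t. a \<le> s \<Longrightarrow> s < x \<Longrightarrow> x < t \<Longrightarrow> t \<le> b \<Longrightarrow> t - s < d2 \<Longrightarrow>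
      - f t - - f s < (- L + e/2) * (t - s)"
    by (rule upper_derivate_lessD[of "\<lambda>x. - f x" a b x "- L + e/2"]) (use lo \<open>e > 0\<close> in auto)
  define d where "d = min (min d1 d2) (min (x - a) (b - x))"
  have d: "0 < d" "d \<le> d1" "d \<le> d2" "d \<le> x - a" "d \<le> b - x"
    using x \<open>0 < d1\<close> \<open>0 < d2\<close> by (auto simp: d_def)
  have strict: "\<bar>f t - f s - L * (t - s)\<bar> \<le> e/2 * (t - s)"
    if "a \<le> s" "s < x" "x < t" "t \<le> b" "t - s < d" for s t
  proof -
    have "f t - f s < (L + e/2) * (t - s)" "- f t - - f s < (- L + e/2) * (t - s)"
      using d1[of s t] d2[of s t] that d by auto
    then show ?thesis by (intro abs_leI) (simp_all add: field_simps)
  qed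
  have cont: "isCont f x"
    using f x by (intro continuous_on_interior[of "{a..b}"]) auto
  have right: "\<bar>f t - f x - L * (t - x)\<bar> \<le> e/2 * (t - x)" if t: "x < t" "t - x < d" for t
  proof (rule tendsto_le[of "at_left x"])
    show "((\<lambda>s. \<bar>f t - f s - L * (t - s)\<bar>) \<longlongrightarrow> \<bar>f t - f x - L * (t - x)\<bar>) (at_left x)"
      using cont by (intro tendsto_intros) (auto simp: isCont_def filterlim_at_split)
    show "((\<lambda>s. e/2 * (t - s)) \<longlongrightarrow> e/2 * (t - x)) (at_left x)" by (intro tendsto_intros)
    have "\<forall>\<^sub>F s in at_left x. s \<in> {max a (t - d)<..<x}"
      by (rule eventually_at_left_real) (use x t in auto)
    then show "\<forall>\<^sub>F s in at_left x. \<bar>f t - f s - L * (t - s)\<bar> \<le> e/2 * (t - s)"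
      by eventually_elim (rule strict, use x t d in auto)
  qed simp
  have left: "\<bar>f x - f s - L * (x - s)\<bar> \<le> e/2 * (x - s)" if s: "s < x" "x - s < d" for s
  proof (rule tendsto_le[of "at_right x"])
    show "((\<lambda>t. \<bar>f t - f s - L * (t - s)\<bar>) \<longlongrightarrow> \<bar>f x - f s - L * (x - s)\<bar>) (at_right x)"
      using cont by (intro tendsto_intros) (auto simp: isCont_def filterlim_at_split)
    show "((\<lambda>t. e/2 * (t - s)) \<longlongrightarrow> e/2 * (x - s)) (at_right x)" by (intro tendsto_intros)
    have "\<forall>\<^sub>F t in at_right x. t \<in> {x<..<min b (s + d)}"
      by (rule eventually_at_right_real) (use x s in auto)
    then show "\<forall>\<^sub>F t in at_right x. \<bar>f t - f s - L * (t - s)\<bar> \<le> e/2 * (t - s)"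
      by eventually_elim (rule strict, use x s d in auto)
  qed simp
  have "dist ((f (x + h) - f x) / h) L < e" if h: "h \<noteq> 0" "dist h 0 < d" for h
  proof -
    have "\<bar>f (x + h) - f x - L * h\<bar> \<le> e/2 * \<bar>h\<bar>"
    proof (cases "h > 0")
      case True
      then show ?thesis using right[of "x + h"] h by simp
    next
      case False
      then show ?thesis using left[of "x + h"] h by (simp add: abs_minus_commute algebra_simps)
    qed
    then have "\<bar>(f (x + h) - f x) / h - L\<bar> \<le> e/2"
      using h(1) by (simp add: divide_diff_eq_iff abs_divide pos_divide_le_eq)
    then show ?thesis using \<open>e > 0\<close> by (simp add: dist_real_def)
  qed
  then show "\<exists>s>0. \<forall>h. h \<noteq> 0 \<and> dist h 0 < s \<longrightarrow> dist ((f (x + h) - f x) / h) L < e"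
    using d(1) by blast
qed

text \<open>By \<open>vitali_henstock\<close> the variation bound 1 also bounds the integrals of all
  truncations \<open>k n\<close> of the absolute value of the derivate. Hence the derivate is
  infinite only on a null set, by Chebyshev's inequality, and integrable, by monotone
  convergence.\<close>

lemma integrable_upper_derivate:
  assumes "a < b"
    and V: "\<And>D. D division_of \<Union>D \<Longrightarrow> \<Union>D \<subseteq> {a..b} \<Longrightarrow> (\<Sum>K\<in>D. norm (f (Sup K) - f (Inf K))) \<le> 1"
  obtains h N where "h absolutely_integrable_on {a..b}" "negligible N"
    "\<And>x. x \<in> {a<..<b} - N \<Longrightarrow> upper_derivate f a b x = ereal (h x)"
proof -
  let ?H = "upper_derivate f a b"
  define k where "k n x = real_of_ereal (min (ereal (real n)) \<bar>?H x\<bar>)" for n x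
  have k_meas: "k n \<in> borel_measurable borel" for n unfolding k_def by measurable
  have k_ereal: "ereal (k n x) = min (ereal (real n)) \<bar>?H x\<bar>" for n x
    unfolding k_def by (cases "?H x") (auto simp: min_def)
  have k0: "0 \<le> k n x" and kn: "k n x \<le> real n" for n x
  proof -
    have "0 \<le> ereal (k n x)" "ereal (k n x) \<le> ereal (real n)" unfolding k_ereal by auto
    then show "0 \<le> k n x" "k n x \<le> real n" by auto
  qed
  have k_int: "k n absolutely_integrable_on {a..b}" for n
  proof (rule measurable_bounded_by_integrable_imp_absolutely_integrable)
    show "k n \<in> borel_measurable (lebesgue_on {a..b})"
      using k_meas[of n] by (simp add: measurable_completion measurable_restrict_space1)
    show "(\<lambda>x. real n) integrable_on {a..b}" by (rule integrable_const_ivl)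
  qed (use k0 kn in auto)
  have k_le: "integral {a..b} (k n) \<le> 1" for n
  proof (rule field_le_epsilon)
    fix e0 :: real assume "e0 > 0"
    \<comment> \<open>One \<open>e\<close> pays for the error of the Riemann sum and
      \<open>e * (b - a)\<close> for lowering \<open>k n\<close> by \<open>e\<close>, which provides
      the strict inequality needed to select an interval.\<close>
    define e where "e = e0 / (1 + (b - a))"
    have "e > 0" "e * (1 + (b - a)) = e0" using \<open>e0 > 0\<close> \<open>a < b\<close> by (auto simp: e_def)
    have ke: "(\<lambda>x. k n x - e) absolutely_integrable_on {a..b}"
      using set_integral_diff(1)[OF k_int[of n] absolutely_integrable_on_const[of "{a..b}" e]] by simp
    have cov: "\<exists>s t. a \<le> s \<and> s < x \<and> x < t \<and> t \<le> b \<and> t - s < d \<and> (k n x - e) * (t - s) \<le> norm (f t - f s)"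
      if x: "x \<in> {a<..<b} - {}" and "0 < d" for x d
    proof -
      have "ereal (k n x - e) < \<bar>?H x\<bar>"
      proof -
        have "ereal (k n x - e) < ereal (k n x)" using \<open>e > 0\<close> by simp
        also have "\<dots> \<le> \<bar>?H x\<bar>" unfolding k_ereal by simp
        finally show ?thesis .
      qed
      \<comment> \<open>If the derivate is large, some interval at each scale has a large quotient.
        If it is very negative, all sufficiently short intervals have very negative quotients, and a
        symmetric one is taken.\<close>
      then consider "ereal (k n x - e) < ?H x" | "?H x < ereal (- (k n x - e))"
        by (cases "?H x") (fastforce simp: abs_if split: if_splits)+
      then show ?thesis
      proof cases
        case 1
        then obtain s t where "a \<le> s" "s < x" "x < t" "t \<le> b" "t - s < d" "(k n x - e) * (t - s) < f t - f s"
          using less_upper_derivateD[OF 1 \<open>0 < d\<close>] by blast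
        then show ?thesis by (intro exI[of _ s] exI[of _ t]) auto
      next
        case 2
        then obtain d' where "0 < d'" and d': "\<And>s t. a \<le> s \<Longrightarrow> s < x \<Longrightarrow> x < t \<Longrightarrow> t \<le> b \<Longrightarrow> t - s < d' \<Longrightarrow>
            f t - f s < - (k n x - e) * (t - s)"
          by (rule upper_derivate_lessD) blast
        define r where "r = min (min (d/3) (d'/3)) (min (x - a) (b - x))"
        have "0 < r" using x \<open>0 < d\<close> \<open>0 < d'\<close> by (auto simp: r_def)
        have "r \<le> d/3" "r \<le> d'/3" "r \<le> x - a" "r \<le> b - x" unfolding r_def by linarith+
        moreover from this have "f (x + r) - f (x - r) < - ((k n x - e) * (x + r - (x - r)))"
          using d'[of "x - r" "x + r"] \<open>0 < r\<close> \<open>0 < d'\<close> by (simp add: algebra_simps)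
        then have "(k n x - e) * (x + r - (x - r)) \<le> norm (f (x + r) - f (x - r))"
          unfolding real_norm_def by linarith
        ultimately show ?thesis using \<open>0 < r\<close> \<open>0 < d\<close>
          by (intro exI[of _ "x - r"] exI[of _ "x + r"]) auto
      qed
    qed
    obtain p where p: "p tagged_partial_division_of {a..b}"
      "\<And>x K. (x, K) \<in> p \<Longrightarrow> \<exists>s t. K = {s..t} \<and> s < t \<and> (k n x - e) * (t - s) \<le> norm (f t - f s)"
      "\<bar>(\<Sum>(x, K)\<in>p. (k n x - e) * content K) - integral {a..b} (\<lambda>x. k n x - e)\<bar> < e" "inj_on snd p"
      by (rule vitali_henstock[OF \<open>a < b\<close> ke negligible_empty \<open>e > 0\<close> cov]) blast+
    have "(\<Sum>(x, K)\<in>p. (k n x - e) * content K) \<le> (\<Sum>(x, K)\<in>p. norm (f (Sup K) - f (Inf K)))"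
    proof (rule sum_mono, clarify)
      fix x K assume "(x, K) \<in> p"
      then obtain s t where "K = {s..t}" "s < t" "(k n x - e) * (t - s) \<le> norm (f t - f s)"
        using p(2) by blast
      then show "(k n x - e) * content K \<le> norm (f (Sup K) - f (Inf K))" by simp
    qed
    also have "\<dots> = (\<Sum>K\<in>snd ` p. norm (f (Sup K) - f (Inf K)))"
      by (subst sum.reindex[OF p(4)]) (simp add: case_prod_unfold)
    also have "\<dots> \<le> 1"
      using V[OF partial_division_of_tagged_division[OF p(1)]] tagged_partial_division_ofD(3)[OF p(1)] by fastforce
    finally have "integral {a..b} (\<lambda>x. k n x - e) \<le> 1 + e" using p(3) by linarith
    moreover have "integral {a..b} (\<lambda>x. k n x - e) = integral {a..b} (k n) - e * (b - a)"
      using set_lebesgue_integral_eq_integral(1)[OF k_int[of n]] \<open>a < b\<close>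
      by (subst Henstock_Kurzweil_Integration.integral_diff) auto
    ultimately show "integral {a..b} (k n) \<le> 1 + e0" using \<open>e * (1 + (b - a)) = e0\<close> by (simp add: algebra_simps)
  qed
  define N where "N = {x \<in> {a..b}. \<bar>?H x\<bar> = \<infinity>}"
  have Nm: "N \<in> sets lebesgue"
  proof -
    have "{x \<in> space borel. \<bar>?H x\<bar> = \<infinity>} \<in> sets borel" by measurable
    then have "{a..b} \<inter> {x. \<bar>?H x\<bar> = \<infinity>} \<in> sets borel" by auto
    then show ?thesis by (auto simp: N_def Int_def intro: sets_completionI_sets)
  qed
  have Nl: "N \<in> lmeasurable"
    by (rule bounded_set_imp_lmeasurable[OF _ Nm]) (auto simp: N_def intro: bounded_subset[OF bounded_closed_interval])
  \<comment> \<open>Chebyshev's inequality: \<open>k n\<close> equals \<open>n\<close> on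
    \<open>N\<close>, while its integral is at most 1.\<close>
  have Nle: "measure lebesgue N \<le> 1 / real n" if "n > 0" for n
  proof -
    have "real n * measure lebesgue N = integral {a..b} (\<lambda>x. real n * indicator N x)"
    proof -
      have "integral {a..b} (indicator N :: real \<Rightarrow> real) = integral UNIV (indicator N)"
      proof -
        have "integral {a..b} (indicator N :: real \<Rightarrow> real) = integral UNIV (\<lambda>x. if x \<in> {a..b} then indicator N x else 0)"
          by (rule integral_restrict_UNIV[symmetric])
        also have "(\<lambda>x. if x \<in> {a..b} then indicator N x else 0) = (indicator N :: real \<Rightarrow> real)"
          by (auto simp: fun_eq_iff N_def indicator_def)
        finally show ?thesis .
      qed
      also have "\<dots> = measure lebesgue N"
        using lmeasure_integral_UNIV[OF Nl] by (simp add: indicator_def of_bool_def)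
      finally show ?thesis by simp
    qed
    also have "\<dots> \<le> integral {a..b} (k n)"
    proof (rule integral_le)
      show "(\<lambda>x. real n * indicator N x) integrable_on {a..b}"
      proof (rule set_lebesgue_integral_eq_integral(1))
        show "(\<lambda>x. real n * indicator N x) absolutely_integrable_on {a..b}"
          by (rule measurable_bounded_by_integrable_imp_absolutely_integrable[where g = "\<lambda>x. real n"])
            (use Nm in \<open>auto simp: indicator_def intro!: borel_measurable_times borel_measurable_indicator measurable_restrict_space1\<close>)
      qed
      show "k n integrable_on {a..b}" by (rule set_lebesgue_integral_eq_integral(1)[OF k_int])
      show "real n * indicator N x \<le> k n x" if "x \<in> {a..b}" for x
      proof (cases "x \<in> N")
        case True
        then have "ereal (k n x) = ereal (real n)" unfolding k_ereal by (simp add: N_def)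
        then show ?thesis using True by simp
      qed (use k0 in simp)
    qed
    also have "\<dots> \<le> 1" by (rule k_le)
    finally show ?thesis using that by (simp add: field_simps)
  qed
  have "measure lebesgue N \<le> 0"
  proof (rule field_le_epsilon)
    fix e :: real assume "e > 0"
    then obtain n where "inverse (real (Suc n)) < e" using reals_Archimedean by blast
    then show "measure lebesgue N \<le> 0 + e" using Nle[of "Suc n"] by (simp add: inverse_eq_divide)
  qed
  then have "negligible N"
    using Nl by (simp add: negligible_iff_measure measure_le_0_iff)
  define h where "h x = real_of_ereal (?H x)" for x
  have Hh: "?H x = ereal (h x)" if "x \<in> {a..b} - N" for x
    using that unfolding h_def N_def by (cases "?H x") auto
  have "(\<lambda>x. if x \<in> N then 0 else \<bar>h x\<bar>) integrable_on {a..b} \<and>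
      (\<lambda>n. integral {a..b} (\<lambda>x. if x \<in> N then 0 else k n x)) \<longlonglongrightarrow>
        integral {a..b} (\<lambda>x. if x \<in> N then 0 else \<bar>h x\<bar>)"
  proof (rule monotone_convergence_increasing)
    have spike: "(\<lambda>x. if x \<in> N then 0 else k n x) integrable_on {a..b}"
        "integral {a..b} (\<lambda>x. if x \<in> N then 0 else k n x) = integral {a..b} (k n)" for n
      by (rule integrable_spike[OF set_lebesgue_integral_eq_integral(1)[OF k_int[of n]] \<open>negligible N\<close>])
        (auto intro: integral_spike[OF \<open>negligible N\<close>])
    show "(\<lambda>x. if x \<in> N then 0 else k n x) integrable_on {a..b}" for n by (rule spike)
    show "(if x \<in> N then 0 else k n x) \<le> (if x \<in> N then 0 else k (Suc n) x)" if "x \<in> {a..b}" for n x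
    proof -
      have "ereal (k n x) \<le> ereal (k (Suc n) x)" unfolding k_ereal by (intro min.mono) auto
      then show ?thesis by simp
    qed
    show "(\<lambda>n. if x \<in> N then 0 else k n x) \<longlonglongrightarrow> (if x \<in> N then 0 else \<bar>h x\<bar>)" if "x \<in> {a..b}" for x
    proof (cases "x \<in> N")
      case False
      obtain m where m: "\<bar>h x\<bar> \<le> real m" using real_arch_simple by blast
      have "k n x = \<bar>h x\<bar>" if "n \<ge> m" for n
        using that m Hh[of x] False \<open>x \<in> {a..b}\<close> unfolding k_def by (simp add: min_def)
      then have "\<forall>\<^sub>F n in sequentially. \<bar>h x\<bar> = k n x" unfolding eventually_sequentially by metis
      then show ?thesis using False by (auto intro: Lim_transform_eventually[OF tendsto_const])
    qed simp
    have "0 \<le> integral {a..b} (k n)" for n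
      using k0 by (intro integral_nonneg set_lebesgue_integral_eq_integral(1)[OF k_int]) auto
    then show "bounded (range (\<lambda>n. integral {a..b} (\<lambda>x. if x \<in> N then 0 else k n x)))"
      unfolding spike(2) using k_le by (auto simp: bounded_iff intro!: exI[of _ 1])
  qed
  then have "(\<lambda>x. \<bar>h x\<bar>) integrable_on {a..b}"
    by (auto intro: integrable_spike[OF _ \<open>negligible N\<close>])
  moreover have "h \<in> borel_measurable (lebesgue_on {a..b})"
    unfolding h_def by (simp add: measurable_completion measurable_restrict_space1)
  ultimately have "h absolutely_integrable_on {a..b}"
    by (intro measurable_bounded_by_integrable_imp_absolutely_integrable[where g = "\<lambda>x. \<bar>h x\<bar>"]) auto
  then show thesis using that[OF _ \<open>negligible N\<close>] Hh by auto
qed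

text \<open>Intervals whose increment is at least \<open>(h x - e) * (t - s)\<close> cover all but a
  length less than \<open>d\<close>. They are completed to a division of the whole interval;
  absolute continuity makes the increments over the added intervals negligible, and the increments
  over the whole division telescope.\<close>

lemma integral_upper_derivate_le:
  assumes "a < b" and f: "abs_continuous_curve a b f"
    and h: "h absolutely_integrable_on {a..b}" and N: "negligible N"
    and H: "\<And>x. x \<in> {a<..<b} - N \<Longrightarrow> upper_derivate f a b x = ereal (h x)"
  shows "integral {a..b} h \<le> f b - f a"
proof (rule field_le_epsilon)
  fix e0 :: real assume "e0 > 0"
  \<comment> \<open>Two \<open>e\<close> are spent on the Riemann sum and on the uncovered
    intervals, and \<open>e * (b - a)\<close> on replacing \<open>h\<close> by
    \<open>h - e\<close>.\<close>
  define e where "e = e0 / (2 + (b - a))"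
  have "e > 0" and e0: "e * (2 + (b - a)) = e0" using \<open>e0 > 0\<close> \<open>a < b\<close> by (auto simp: e_def)
  obtain d where "d > 0" and d: "\<And>D. D division_of \<Union>D \<Longrightarrow> \<Union>D \<subseteq> {a..b} \<Longrightarrow> sum content D < d \<Longrightarrow>
      (\<Sum>K\<in>D. norm (f (Sup K) - f (Inf K))) < e"
    using abs_continuous_curve_division[OF f \<open>e > 0\<close>] by blast
  have he: "(\<lambda>x. h x - e) absolutely_integrable_on {a..b}"
    using set_integral_diff(1)[OF h absolutely_integrable_on_const[of "{a..b}" e]] by simp
  have cov: "\<exists>s t. a \<le> s \<and> s < x \<and> x < t \<and> t \<le> b \<and> t - s < d \<and> (h x - e) * (t - s) \<le> f t - f s"
    if x: "x \<in> {a<..<b} - N" and "0 < d" for x d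
  proof -
    have "ereal (h x - e) < upper_derivate f a b x" using H[OF x] \<open>e > 0\<close> by simp
    then show ?thesis using less_upper_derivateD[OF _ \<open>0 < d\<close>] by (meson less_imp_le)
  qed
  \<comment> \<open>The tolerance \<open>min e d\<close> bounds the error of the Riemann sum by
    \<open>e\<close> and the uncovered length by \<open>d\<close>.\<close>
  obtain p where p: "p tagged_partial_division_of {a..b}"
      "\<And>x K. (x, K) \<in> p \<Longrightarrow> \<exists>s t. K = {s..t} \<and> s < t \<and> (h x - e) * (t - s) \<le> f t - f s"
      "\<bar>(\<Sum>(x, K)\<in>p. (h x - e) * content K) - integral {a..b} (\<lambda>x. h x - e)\<bar> < min e d"
      "b - a - min e d < (\<Sum>(x, K)\<in>p. content K)" "inj_on snd p"
    by (rule vitali_henstock[OF \<open>a < b\<close> he N _ cov, of "min e d"]) (use \<open>e > 0\<close> \<open>d > 0\<close> in \<open>simp\<close>, blast+)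
  have sub: "\<Union>(snd ` p) \<subseteq> {a..b}" using tagged_partial_division_ofD(3)[OF p(1)] by fastforce
  obtain q where q: "snd ` p \<subseteq> q" "q division_of {a..b}"
    using partial_division_extend_interval[OF partial_division_of_tagged_division[OF p(1)], of a b] sub by auto
  have fin: "finite q" using q(2) by auto
  define r where "r = q - snd ` p"
  have rdiv: "r division_of \<Union>r" unfolding r_def using division_of_subset[of q "q - snd ` p"] q(2) division_ofD(6)[OF q(2)] by auto
  have rsub: "\<Union>r \<subseteq> {a..b}" using division_ofD(6)[OF q(2)] by (auto simp: r_def)
  have "sum content q = b - a" using additive_content_division[of q a b] q(2) \<open>a < b\<close> by simp
  moreover have "sum content q = sum content r + sum content (snd ` p)"
    unfolding r_def by (rule sum.subset_diff[OF q(1) fin])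
  moreover have "sum content (snd ` p) = (\<Sum>(x, K)\<in>p. content K)"
    by (subst sum.reindex[OF p(5)]) (simp add: case_prod_unfold)
  ultimately have "sum content r < d" using p(4) by linarith
  then have small: "(\<Sum>K\<in>r. norm (f (Sup K) - f (Inf K))) < e" by (rule d[OF rdiv rsub])
  have "f b - f a = (\<Sum>K\<in>q. f (Sup K) - f (Inf K))"
    using division_telescope[OF _ q(2), of f] \<open>a < b\<close> by simp
  also have "\<dots> = (\<Sum>K\<in>r. f (Sup K) - f (Inf K)) + (\<Sum>K\<in>snd ` p. f (Sup K) - f (Inf K))"
    unfolding r_def by (rule sum.subset_diff[OF q(1) fin])
  also have "(\<Sum>K\<in>snd ` p. f (Sup K) - f (Inf K)) = (\<Sum>(x, K)\<in>p. f (Sup K) - f (Inf K))"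
    by (subst sum.reindex[OF p(5)]) (simp add: case_prod_unfold)
  finally have eq: "f b - f a = (\<Sum>K\<in>r. f (Sup K) - f (Inf K)) + (\<Sum>(x, K)\<in>p. f (Sup K) - f (Inf K))" .
  have "\<bar>\<Sum>K\<in>r. f (Sup K) - f (Inf K)\<bar> < e"
    by (rule le_less_trans[OF sum_abs]) (use small in simp)
  moreover have "(\<Sum>(x, K)\<in>p. (h x - e) * content K) \<le> (\<Sum>(x, K)\<in>p. f (Sup K) - f (Inf K))"
  proof (rule sum_mono, clarify)
    fix x K assume "(x, K) \<in> p"
    then obtain s t where "K = {s..t}" "s < t" "(h x - e) * (t - s) \<le> f t - f s" using p(2) by blast
    then show "(h x - e) * content K \<le> f (Sup K) - f (Inf K)" by simp
  qed
  ultimately have "integral {a..b} (\<lambda>x. h x - e) \<le> f b - f a + 2 * e" using p(3) eq by linarith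
  moreover have "integral {a..b} (\<lambda>x. h x - e) = integral {a..b} h - e * (b - a)"
    using set_lebesgue_integral_eq_integral(1)[OF h] \<open>a < b\<close>
    by (subst Henstock_Kurzweil_Integration.integral_diff) auto
  ultimately show "integral {a..b} h \<le> f b - f a + e0" using e0 by (simp add: algebra_simps)
qed

lemma negligible_if_AE:
  assumes "AE x in lebesgue. \<not> P x"
  shows "negligible {x. P x}"
proof -
  obtain N where "N \<in> null_sets lebesgue" "{x. P x} \<subseteq> N"
    using assms unfolding eventually_ae_filter by auto
  then show ?thesis by (meson negligible_iff_null_sets negligible_subset)
qed

text \<open>Adding the inequalities for \<open>f\<close> and for its negative shows that the upper
  minus the lower derivate has integral at most 0. This difference is nonnegative, so it vanishes
  almost everywhere, and there the common finite value is the derivative.\<close>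

lemma abs_continuous_imp_differentiable_AE:
  fixes f :: "real \<Rightarrow> real"
  assumes f: "abs_continuous_curve a b f"
  shows "negligible {x \<in> {a<..<b}. \<not> f differentiable (at x)}"
proof -
  obtain d where "d > 0" and d: "\<And>D. D division_of \<Union>D \<Longrightarrow> \<Union>D \<subseteq> {a..b} \<Longrightarrow> sum content D < d \<Longrightarrow>
      (\<Sum>K\<in>D. norm (f (Sup K) - f (Inf K))) < 1"
    using abs_continuous_curve_division[OF f zero_less_one] by blast
  have mf: "abs_continuous_curve a b (\<lambda>x. - f x)"
    by (rule abs_continuous_curve_lipschitz_image[OF f, of _ 1]) (simp add: dist_real_def)
  \<comment> \<open>On intervals shorter than \<open>d\<close> the variation is at most 1.
    Negligibility is a local property, so such intervals suffice.\<close>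
  have local: "negligible {x \<in> {a'<..<b'}. \<not> f differentiable (at x)}"
    if ab: "a \<le> a'" "a' < b'" "b' \<le> b" "b' - a' < d" for a' b'
  proof -
    have V: "(\<Sum>K\<in>D. norm (f (Sup K) - f (Inf K))) \<le> 1"
      if D: "D division_of \<Union>D" "\<Union>D \<subseteq> {a'..b'}" for D
    proof -
      have "sum content D \<le> content (cbox a' b')" using subadditive_content_division[OF D(1), of a' b'] D(2) by simp
      then have "sum content D < d" using ab by simp
      moreover have "\<Union>D \<subseteq> {a..b}" using D(2) ab by auto
      ultimately show ?thesis using d[OF D(1)] by simp
    qed
    then have V': "(\<Sum>K\<in>D. norm (- f (Sup K) - - f (Inf K))) \<le> 1"
      if D: "D division_of \<Union>D" "\<Union>D \<subseteq> {a'..b'}" for D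
      using V[OF D] by (simp add: abs_minus_commute)
    let ?H = "upper_derivate f a' b'" and ?G = "upper_derivate (\<lambda>x. - f x) a' b'"
    obtain h N where h: "h absolutely_integrable_on {a'..b'}" and N: "negligible N"
        and H: "\<And>x. x \<in> {a'<..<b'} - N \<Longrightarrow> ?H x = ereal (h x)"
      using integrable_upper_derivate[of a' b' f] ab V by blast
    obtain g M where g: "g absolutely_integrable_on {a'..b'}" and M: "negligible M"
        and G: "\<And>x. x \<in> {a'<..<b'} - M \<Longrightarrow> ?G x = ereal (g x)"
      using integrable_upper_derivate[of a' b' "\<lambda>x. - f x"] ab V' by blast
    have "integral {a'..b'} h \<le> f b' - f a'"
      by (rule integral_upper_derivate_le[OF _ _ h N H])
        (use ab in \<open>auto intro: abs_continuous_curve_subinterval[OF f]\<close>)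
    moreover have "integral {a'..b'} g \<le> - f b' - - f a'"
      by (rule integral_upper_derivate_le[OF _ _ g M G])
        (use ab in \<open>auto intro: abs_continuous_curve_subinterval[OF mf]\<close>)
    moreover have hg: "(\<lambda>x. h x + g x) absolutely_integrable_on {a'..b'}"
      by (rule set_integral_add(1)[OF h g])
    moreover have "integral {a'..b'} (\<lambda>x. h x + g x) = integral {a'..b'} h + integral {a'..b'} g"
      using set_lebesgue_integral_eq_integral(1)[OF h] set_lebesgue_integral_eq_integral(1)[OF g]
      by (rule Henstock_Kurzweil_Integration.integral_add)
    ultimately have le0: "(LINT x:{a'..b'}|lebesgue. h x + g x) \<le> 0"
      using set_lebesgue_integral_eq_integral(2)[OF hg] by simp
    define Z where "Z = N \<union> M \<union> {a', b'}"
    have Z: "negligible Z" using N M by (auto simp: Z_def negligible_Un negligible_finite)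
    have nn: "0 \<le> h x + g x" if "x \<in> {a'..b'} - Z" for x
    proof -
      have x: "a' < x" "x < b'" "x \<in> {a'<..<b'} - N" "x \<in> {a'<..<b'} - M"
        using that by (auto simp: Z_def)
      have "ereal (- g x) \<le> ereal (h x)"
        using upper_derivate_minus[OF x(1,2), of f] H[OF x(3)] G[OF x(4)] by simp
      then show ?thesis by simp
    qed
    have AEZ: "AE x in lebesgue. x \<notin> Z"
      using Z by (simp add: negligible_iff_null_sets AE_not_in)
    have nnAE: "AE x in lebesgue. 0 \<le> indicator {a'..b'} x *\<^sub>R (h x + g x)"
      using AEZ by eventually_elim (use nn in \<open>auto simp: indicator_def\<close>)
    have int: "integrable lebesgue (\<lambda>x. indicator {a'..b'} x *\<^sub>R (h x + g x))"
      using hg unfolding set_integrable_def .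
    have "(LINT x|lebesgue. indicator {a'..b'} x *\<^sub>R (h x + g x)) = 0"
      using le0 integral_nonneg_AE[OF nnAE] unfolding set_lebesgue_integral_def by linarith
    then have "AE x in lebesgue. indicator {a'..b'} x *\<^sub>R (h x + g x) = 0"
      using integral_nonneg_eq_0_iff_AE[OF int nnAE] by simp
    then have "AE x in lebesgue. \<not> (x \<in> {a'<..<b'} \<and> \<not> f differentiable (at x))"
      using AEZ
    proof eventually_elim
      case (elim x)
      have "f differentiable (at x)" if x: "x \<in> {a'<..<b'}"
      proof -
        have xx: "x \<in> {a'<..<b'} - N" "x \<in> {a'<..<b'} - M" using x elim(2) by (auto simp: Z_def)
        have "g x = - h x" using elim(1) x by (simp add: indicator_def split: if_splits)
        then have "(f has_real_derivative h x) (at x)"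
          using x H[OF xx(1)] G[OF xx(2)] ab
          by (intro has_derivative_upper_derivate[of a' b'])
            (auto intro: continuous_on_subset[OF abs_continuous_curve_imp_continuous_on[OF f]])
        then show ?thesis by (auto simp: real_differentiable_def)
      qed
      then show ?case by blast
    qed
    then show ?thesis by (rule negligible_if_AE)
  qed
  show ?thesis
    unfolding locally_negligible_alt[of "{x \<in> {a<..<b}. \<not> f differentiable (at x)}"]
  proof
    let ?S = "{x \<in> {a<..<b}. \<not> f differentiable (at x)}"
    fix x assume x: "x \<in> ?S"
    define a' b' where "a' = max a (x - d/3)" and "b' = min b (x + d/3)"
    have ab: "a \<le> a'" "a' < x" "x < b'" "b' \<le> b" "b' - a' < d"
      using x \<open>d > 0\<close> by (auto simp: a'_def b'_def)
    show "\<exists>U. openin (top_of_set ?S) U \<and> x \<in> U \<and> negligible U"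
    proof (intro exI conjI)
      show "openin (top_of_set ?S) (?S \<inter> {a'<..<b'})" by (simp add: openin_open_Int)
      show "x \<in> ?S \<inter> {a'<..<b'}" using x ab by auto
      show "negligible (?S \<inter> {a'<..<b'})"
        by (rule negligible_subset[OF local[of a' b']]) (use ab in auto)
    qed
  qed
qed

lemma abs_continuous_curve_differentiable_AE:
  fixes \<gamma> :: "real \<Rightarrow> 'a::euclidean_space"
  assumes "abs_continuous_curve a b \<gamma>"
  shows "negligible {x \<in> {a<..<b}. \<not> \<gamma> differentiable (at x)}"
proof -
  have "{x \<in> {a<..<b}. \<not> \<gamma> differentiable (at x)} =
      (\<Union>i\<in>Basis. {x \<in> {a<..<b}. \<not> (\<lambda>x. \<gamma> x \<bullet> i) differentiable (at x)})"
    using differentiable_componentwise_within[of \<gamma> _ UNIV] by auto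
  also have "negligible \<dots>"
  proof (rule negligible_Union)
    fix T assume "T \<in> (\<lambda>i. {x \<in> {a<..<b}. \<not> (\<lambda>x. \<gamma> x \<bullet> i) differentiable (at x)}) ` Basis"
    then show "negligible T"
      using abs_continuous_imp_differentiable_AE[OF abs_continuous_curve_inner[OF assms]] by auto
  qed simp
  finally show ?thesis .
qed

text \<open>Verified directly from the gauge definition. At a good tag the derivative controls the
  increment over a short interval. The intervals with bad tags are forced into an open set of
  measure less than \<open>d\<close>, so absolute continuity bounds the sum of their
  increments.\<close>

lemma abs_continuous_has_integral:
  fixes f :: "real \<Rightarrow> real"
  assumes "a \<le> b" and f: "abs_continuous_curve a b f" and N: "negligible N"
    and f': "\<And>x. x \<in> {a<..<b} - N \<Longrightarrow> (f has_real_derivative f' x) (at x)"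
  shows "(f' has_integral f b - f a) {a..b}"
proof -
  define Z where "Z = N \<union> {a, b}"
  have Z: "negligible Z" using N by (auto simp: Z_def negligible_Un negligible_finite)
  \<comment> \<open>With value 0 on \<open>Z\<close> the bad tags contribute nothing to the Riemann
    sum; the change is undone at the end because \<open>Z\<close> is negligible.\<close>
  define g where "g x = (if x \<in> Z then 0 else f' x)" for x
  have "(g has_integral f b - f a) (cbox a b)"
    unfolding has_integral
  proof (intro allI impI)
    fix e :: real assume "e > 0"
    \<comment> \<open>Good tags contribute at most \<open>c * (b - a)\<close>, hence at most
      \<open>e/4\<close>, and bad tags less than \<open>e/2\<close>.\<close>
    define c where "c = e / (4 * (1 + (b - a)))"
    have "c > 0" "c * (b - a) \<le> e/4"
      using \<open>e > 0\<close> \<open>a \<le> b\<close> by (auto simp: c_def field_simps)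
    obtain d where "d > 0" and d: "\<And>D. D division_of \<Union>D \<Longrightarrow> \<Union>D \<subseteq> {a..b} \<Longrightarrow> sum content D < d \<Longrightarrow>
        (\<Sum>K\<in>D. norm (f (Sup K) - f (Inf K))) < e/2"
      using abs_continuous_curve_division[OF f half_gt_zero[OF \<open>e > 0\<close>]] by blast
    have "Z \<in> lmeasurable" "measure lebesgue Z = 0" using Z by (auto simp: negligible_iff_measure)
    then obtain U where U: "open U" "Z \<subseteq> U" "U \<in> lmeasurable" "measure lebesgue U < d"
    proof -
      obtain U where U: "open U" "Z \<subseteq> U" "U - Z \<in> lmeasurable" "emeasure lebesgue (U - Z) < ennreal d"
        using sets_lebesgue_outer_open[OF fmeasurableD[OF \<open>Z \<in> lmeasurable\<close>] \<open>d > 0\<close>] .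
      have UZ: "U = (U - Z) \<union> Z" using U(2) by auto
      have "U \<in> lmeasurable" by (subst UZ) (intro fmeasurable.Un U(3) \<open>Z \<in> lmeasurable\<close>)
      moreover have "measure lebesgue U \<le> measure lebesgue (U - Z) + measure lebesgue Z"
        by (subst UZ) (intro measure_Un_le fmeasurableD U(3) \<open>Z \<in> lmeasurable\<close>)
      moreover have "measure lebesgue (U - Z) < d"
        using U(3,4) \<open>d > 0\<close> by (simp add: emeasure_eq_measure2 ennreal_less_iff)
      ultimately show thesis using that[OF U(1,2)] \<open>measure lebesgue Z = 0\<close> by simp
    qed
    have "\<exists>r>0. \<forall>y. \<bar>y - x\<bar> < r \<longrightarrow> \<bar>f y - f x - f' x * (y - x)\<bar> \<le> c * \<bar>y - x\<bar>" if x: "x \<in> {a..b} - Z" for x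
    proof -
      have "(f has_real_derivative f' x) (at x)" using f' x by (auto simp: Z_def)
      then have "(f has_derivative (\<lambda>h. f' x * h)) (at x)" by (simp add: has_field_derivative_def)
      then show ?thesis using \<open>c > 0\<close> unfolding has_derivative_at_alt real_norm_def by blast
    qed
    then obtain r where r: "\<And>x. x \<in> {a..b} - Z \<Longrightarrow> r x > 0"
      "\<And>x y. x \<in> {a..b} - Z \<Longrightarrow> \<bar>y - x\<bar> < r x \<Longrightarrow> \<bar>f y - f x - f' x * (y - x)\<bar> \<le> c * \<bar>y - x\<bar>"
      by metis
    define \<gamma> where "\<gamma> x = (if x \<in> Z then U else ball x (if x \<in> {a..b} then r x else 1))" for x
    have "gauge \<gamma>" unfolding gauge_def \<gamma>_def using U r(1) by auto
    moreover have "norm ((\<Sum>(x, K)\<in>p. content K *\<^sub>R g x) - (f b - f a)) < e"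
      if p: "p tagged_division_of cbox a b" and fine: "\<gamma> fine p" for p
    proof -
      have fin: "finite p" using p by auto
      define q where "q = {(x, K) \<in> p. x \<in> Z}"
      have qp: "q \<subseteq> p" by (auto simp: q_def)
      have tele: "(\<Sum>(x, K)\<in>p. f (Sup K) - f (Inf K)) = f b - f a"
        using additive_tagged_division_1[OF \<open>a \<le> b\<close>, of p f] p by simp
      have form: "\<exists>s t. K = {s..t} \<and> s \<le> x \<and> x \<le> t \<and> a \<le> s \<and> t \<le> b \<and> K \<subseteq> \<gamma> x" if xK: "(x, K) \<in> p" for x K
      proof -
        obtain s t where st: "K = cbox s t" using tagged_division_ofD(4)[OF p xK] by blast
        then have "x \<in> {s..t}" "{s..t} \<subseteq> {a..b}" "{s..t} \<subseteq> \<gamma> x"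
          using tagged_division_ofD(2,3)[OF p xK] fine xK unfolding fine_def by auto
        then show ?thesis using st by (intro exI[of _ s] exI[of _ t]) auto
      qed
      have qpart: "q tagged_partial_division_of cbox a b"
        using tagged_partial_division_subset[OF tagged_division_of_def[THEN iffD1, OF p, THEN conjunct1] qp] .
      have qdiv: "snd ` q division_of \<Union>(snd ` q)" by (rule partial_division_of_tagged_division[OF qpart])
      have "\<Union>(snd ` q) \<subseteq> U" using form unfolding q_def \<gamma>_def by fastforce
      moreover have "sum content (snd ` q) = measure lebesgue (\<Union>(snd ` q))"
      proof -
        have "sum content (snd ` q) = sum (measure lebesgue) (snd ` q)"
        proof (rule sum.cong[OF refl])
          fix K assume "K \<in> snd ` q"
          then obtain u v where "K = cbox u v" using division_ofD(4)[OF qdiv] by blast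
          then show "content K = measure lebesgue K" by (simp del: box_real)
        qed
        then show ?thesis using content_division[OF qdiv] by simp
      qed
      moreover have "\<Union>(snd ` q) \<in> lmeasurable" using lmeasurable_division[OF qdiv] .
      ultimately have "sum content (snd ` q) < d"
        using measure_mono_fmeasurable[of "\<Union>(snd ` q)" U lebesgue] U by auto
      moreover have "\<Union>(snd ` q) \<subseteq> {a..b}" using tagged_partial_division_ofD(3)[OF qpart] by fastforce
      ultimately have "(\<Sum>K\<in>snd ` q. norm (f (Sup K) - f (Inf K))) < e/2" using d[OF qdiv] by simp
      \<comment> \<open>The same interval can carry two different tags only if it is degenerate, and
        then its increment is 0, so passing from tagged intervals to intervals changes no
        sum.\<close>
      moreover have "(\<Sum>K\<in>snd ` q. norm (f (Sup K) - f (Inf K))) = (\<Sum>(x, K)\<in>q. norm (f (Sup K) - f (Inf K)))"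
      proof (subst sum.reindex_nontrivial)
        show "finite q" using fin qp by (rule finite_subset[rotated])
        fix i j assume ij: "i \<in> q" "j \<in> q" "i \<noteq> j" "snd i = snd j"
        obtain x K y where xy: "i = (x, K)" "j = (y, K)" using ij(4) by (cases i, cases j) auto
        obtain s t where K: "K = {s..t}" "s \<le> t" using form[of x K] ij(1) qp xy by fastforce
        have "interior K \<inter> interior K = {}"
          using tagged_division_ofD(5)[OF p, of x K y K] ij qp xy by blast
        then have "{s<..<t} = {}" using K by simp
        then have "s = t" using K by (metis greaterThanLessThan_empty_iff order_antisym)
        then show "norm (f (Sup (snd i)) - f (Inf (snd i))) = 0" using K xy by simp
      qed (simp add: case_prod_unfold)
      ultimately have q1: "(\<Sum>(x, K)\<in>q. norm (f (Sup K) - f (Inf K))) < e/2" by simp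
      have eq0: "content K *\<^sub>R g x - (f (Sup K) - f (Inf K)) = - (f (Sup K) - f (Inf K))" if "(x, K) \<in> q" for x K
        using that by (simp add: q_def g_def)
      have est: "norm (content K *\<^sub>R g x - (f (Sup K) - f (Inf K))) \<le> c * content K" if xK: "(x, K) \<in> p - q" for x K
      proof -
        have xZ: "x \<notin> Z" using xK by (auto simp: q_def)
        obtain s t where st: "K = {s..t}" "s \<le> x" "x \<le> t" "a \<le> s" "t \<le> b" "K \<subseteq> \<gamma> x" using form[of x K] xK by blast
        then have x: "x \<in> {a..b} - Z" using xZ by auto
        have "s \<in> ball x (r x)" "t \<in> ball x (r x)" using st x unfolding \<gamma>_def by (auto simp: subset_eq)
        then have "\<bar>f s - f x - f' x * (s - x)\<bar> \<le> c * \<bar>s - x\<bar>" "\<bar>f t - f x - f' x * (t - x)\<bar> \<le> c * \<bar>t - x\<bar>"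
          using r(2)[OF x] by (auto simp: dist_real_def abs_minus_commute)
        then have "\<bar>f s - f x - f' x * (s - x)\<bar> + \<bar>f t - f x - f' x * (t - x)\<bar> \<le> c * (t - s)"
          using st by (simp add: algebra_simps)
        \<comment> \<open>The tag lies between \<open>s\<close> and \<open>t\<close>, so the two
          one-sided errors are bounded by \<open>c * (x - s)\<close> and \<open>c * (t - x)\<close>,
          which add up to \<open>c * (t - s)\<close>.\<close>
        moreover have "(t - s) * f' x - (f t - f s) = (f s - f x - f' x * (s - x)) - (f t - f x - f' x * (t - x))"
          by (simp add: algebra_simps)
        ultimately have "\<bar>(t - s) * f' x - (f t - f s)\<bar> \<le> c * (t - s)" by linarith
        then show ?thesis using st x by (simp add: g_def)
      qed
      have "(\<Sum>(x, K)\<in>p. content K *\<^sub>R g x) - (f b - f a) = (\<Sum>(x, K)\<in>p. content K *\<^sub>R g x - (f (Sup K) - f (Inf K)))"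
        unfolding tele[symmetric] by (simp add: sum_subtractf case_prod_unfold)
      also have "norm \<dots> \<le> (\<Sum>(x, K)\<in>p. norm (content K *\<^sub>R g x - (f (Sup K) - f (Inf K))))"
        by (rule order_trans[OF norm_sum]) (simp add: case_prod_unfold)
      also have "\<dots> = (\<Sum>(x, K)\<in>p - q. norm (content K *\<^sub>R g x - (f (Sup K) - f (Inf K)))) +
          (\<Sum>(x, K)\<in>q. norm (content K *\<^sub>R g x - (f (Sup K) - f (Inf K))))"
        by (rule sum.subset_diff[OF qp fin])
      also have "(\<Sum>(x, K)\<in>q. norm (content K *\<^sub>R g x - (f (Sup K) - f (Inf K)))) = (\<Sum>(x, K)\<in>q. norm (f (Sup K) - f (Inf K)))"
      proof (rule sum.cong[OF refl], clarify)
        fix x K assume "(x, K) \<in> q"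
        then show "norm (content K *\<^sub>R g x - (f (Sup K) - f (Inf K))) = norm (f (Sup K) - f (Inf K))"
          using eq0 norm_minus_cancel by metis
      qed
      also have "(\<Sum>(x, K)\<in>p - q. norm (content K *\<^sub>R g x - (f (Sup K) - f (Inf K)))) \<le> (\<Sum>(x, K)\<in>p - q. c * content K)"
        by (rule sum_mono) (use est in auto)
      also have "\<dots> \<le> (\<Sum>(x, K)\<in>p. c * content K)"
        using \<open>c > 0\<close> fin by (intro sum_mono2) auto
      also have "\<dots> = c * (b - a)"
        using additive_content_tagged_division[OF p] \<open>a \<le> b\<close> by (simp add: case_prod_unfold sum_distrib_left[symmetric])
      finally show ?thesis using q1 \<open>c * (b - a) \<le> e/4\<close> \<open>e > 0\<close> by linarith
    qed
    ultimately show "\<exists>\<gamma>. gauge \<gamma> \<and> (\<forall>p. p tagged_division_of cbox a b \<and> \<gamma> fine p \<longrightarrow>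
        norm ((\<Sum>(x, K)\<in>p. content K *\<^sub>R g x) - (f b - f a)) < e)"
      by (intro exI[of _ \<gamma>]) simp
  qed
  then show ?thesis
    by (intro has_integral_spike[OF Z, of _ f' g]) (auto simp: g_def)
qed

text \<open>A Henstock-Kurzweil integral may converge conditionally. If the right-hand side is
  infinite there is nothing to show; otherwise the positive part of \<open>g\<close>, which is
  measurable, has finite integral, and it dominates \<open>g\<close>. Measurability is thus drawn
  from \<open>g\<close> and not from \<open>h\<close>.\<close>

lemma has_integral_le_nn_integral:
  fixes g :: "'a::euclidean_space \<Rightarrow> real"
  assumes g: "(g has_integral I) S"
    and le: "AE x in lebesgue. x \<in> S \<longrightarrow> ennreal (g x) \<le> h x"
  shows "ennreal I \<le> (\<integral>\<^sup>+x\<in>S. h x \<partial>lebesgue)"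
proof (cases "(\<integral>\<^sup>+x\<in>S. h x \<partial>lebesgue) = \<infinity>")
  case False
  define p where "p x = max 0 (indicator S x *\<^sub>R g x)" for x
  have meas: "p \<in> borel_measurable lebesgue"
    unfolding p_def by (intro borel_measurable_max has_integral_implies_lebesgue_measurable[OF g]) simp
  have "(\<integral>\<^sup>+x. ennreal (p x) \<partial>lebesgue) \<le> (\<integral>\<^sup>+x\<in>S. h x \<partial>lebesgue)"
    by (rule nn_integral_mono_AE) (use le in eventually_elim, auto simp: p_def indicator_def max_def)
  then have fin: "(\<integral>\<^sup>+x. ennreal (p x) \<partial>lebesgue) < \<infinity>" and
    le': "(\<integral>\<^sup>+x. ennreal (p x) \<partial>lebesgue) \<le> (\<integral>\<^sup>+x\<in>S. h x \<partial>lebesgue)"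
    using False by (auto simp: less_top[symmetric] top_unique)
  have int: "integrable lebesgue p"
    by (rule integrableI_nonneg[OF meas _ fin]) (simp add: p_def)
  have "((\<lambda>x. if x \<in> S then g x else 0) has_integral I) UNIV"
    using g by (simp add: has_integral_restrict_UNIV)
  then have "I \<le> integral\<^sup>L lebesgue p"
    by (rule has_integral_le[OF _ has_integral_integral_lebesgue[OF int]]) (auto simp: p_def indicator_def)
  then have "ennreal I \<le> ennreal (integral\<^sup>L lebesgue p)" by (rule ennreal_leI)
  also have "\<dots> = (\<integral>\<^sup>+x. ennreal (p x) \<partial>lebesgue)"
    by (rule nn_integral_eq_integral[symmetric, OF int]) (simp add: p_def)
  finally show ?thesis using le' by simp
qed simp

section \<open>Displacement and kinetic energy\<close>

lemma AE_if_negligible: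
  assumes "negligible {x. P x}"
  shows "AE x in lebesgue. \<not> P x"
  using assms unfolding negligible_iff_null_sets by (auto dest: AE_not_in)

text \<open>The Cauchy-Schwarz inequality for the velocity in the mass norm, in linearized form: the
  square of the velocity is bounded below by its tangent at the mean velocity \<open>z / s\<close>.
  This affine bound is integrated exactly by the fundamental theorem, so the quadratic integrand is
  only ever compared.\<close>

lemma mass_norm_sq_displacement_le:
  fixes \<gamma> :: "real \<Rightarrow> 'e::euclidean_space ^ 'n::finite"
  assumes m: "\<And>i. m i > 0" and \<gamma>: "abs_continuous_curve 0 T \<gamma>" and s: "0 \<le> s" "s \<le> T"
  shows "ennreal (mass_norm_sq m (\<gamma> s - \<gamma> 0)) \<le> ennreal s *
    (\<integral>\<^sup>+\<tau>\<in>{0..T}. ennreal (mass_norm_sq m (vector_derivative \<gamma> (at \<tau> within {0..T}))) \<partial>lebesgue)"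
proof (cases "s = 0")
  case True
  then show ?thesis by (simp add: mass_norm_sq_def)
next
  case False
  then have "s > 0" using s by simp
  define z where "z = \<gamma> s - \<gamma> 0"
  define P where "P = mass_norm_sq m z"
  \<comment> \<open>The weights make the plain inner product with \<open>q\<close> the mass inner
    product with \<open>z\<close>.\<close>
  define q where "q = (\<chi> i. m i *\<^sub>R z $ i)"
  have zq: "z \<bullet> q = P"
    by (simp add: P_def q_def inner_vec_def mass_norm_sq_def power2_norm_eq_inner)
  \<comment> \<open>This is the expansion of the nonnegative mass norm of
    \<open>v - (1 / s) *\<^sub>R z\<close>.\<close>
  have young: "2 / s * (v \<bullet> q - P / (2 * s)) \<le> mass_norm_sq m v" for v
  proof -
    have "2 / s * ((v $ i) \<bullet> (q $ i) - m i * (norm (z $ i))\<^sup>2 / (2 * s)) \<le> m i * (norm (v $ i))\<^sup>2" for i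
    proof -
      have "0 \<le> m i * (norm (v $ i - (1 / s) *\<^sub>R z $ i))\<^sup>2" using less_imp_le[OF m[of i]] by simp
      also have "(norm (v $ i - (1 / s) *\<^sub>R z $ i))\<^sup>2 = (norm (v $ i))\<^sup>2 - 2 / s * (v $ i \<bullet> z $ i) + (norm (z $ i))\<^sup>2 / s\<^sup>2"
        unfolding power2_norm_eq_inner by (simp add: inner_diff_left inner_diff_right inner_commute power2_eq_square field_simps)
      finally show ?thesis using \<open>s > 0\<close> by (simp add: q_def field_simps power2_eq_square)
    qed
    then have "(\<Sum>i\<in>UNIV. 2 / s * ((v $ i) \<bullet> (q $ i) - m i * (norm (z $ i))\<^sup>2 / (2 * s))) \<le> mass_norm_sq m v"
      unfolding mass_norm_sq_def by (intro sum_mono) auto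
    then show ?thesis
      by (simp add: P_def mass_norm_sq_def inner_vec_def sum_distrib_left[symmetric] sum_subtractf sum_divide_distrib[symmetric])
  qed
  define N where "N = {x \<in> {0<..<T}. \<not> \<gamma> differentiable (at x)}"
  have N: "negligible N" unfolding N_def by (rule abs_continuous_curve_differentiable_AE[OF \<gamma>])
  define v where "v \<tau> = vector_derivative \<gamma> (at \<tau> within {0..T})" for \<tau>
  have der: "(\<gamma> has_vector_derivative v \<tau>) (at \<tau>)" if "\<tau> \<in> {0<..<T} - N" for \<tau>
  proof -
    have "at \<tau> within {0..T} = at \<tau>" using that by (intro at_within_interior) auto
    moreover have "\<gamma> differentiable (at \<tau>)" using that by (simp add: N_def)
    ultimately show ?thesis unfolding v_def by (simp add: vector_derivative_works)
  qed
  have "((\<lambda>\<tau>. v \<tau> \<bullet> q) has_integral \<gamma> s \<bullet> q - \<gamma> 0 \<bullet> q) {0..s}"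
  proof (rule abs_continuous_has_integral[OF s(1) _ N])
    show "abs_continuous_curve 0 s (\<lambda>\<tau>. \<gamma> \<tau> \<bullet> q)"
      by (rule abs_continuous_curve_subinterval[OF abs_continuous_curve_inner[OF \<gamma>]]) (use s in auto)
    show "((\<lambda>\<tau>. \<gamma> \<tau> \<bullet> q) has_real_derivative v \<tau> \<bullet> q) (at \<tau>)" if "\<tau> \<in> {0<..<s} - N" for \<tau>
      unfolding has_real_derivative_iff_has_vector_derivative
      using der[of \<tau>] that s by (intro bounded_linear.has_vector_derivative[OF bounded_linear_inner_left]) auto
  qed
  then have "((\<lambda>\<tau>. v \<tau> \<bullet> q - P / (2 * s)) has_integral P - s * (P / (2 * s))) {0..s}"
    using has_integral_const_real[of "P / (2 * s)" 0 s] s zq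
    by (intro has_integral_diff) (auto simp: z_def inner_diff_left)
  then have "((\<lambda>\<tau>. 2 / s * (v \<tau> \<bullet> q - P / (2 * s))) has_integral 2 / s * (P - s * (P / (2 * s)))) {0..s}"
    by (rule has_integral_mult_right)
  moreover have "2 / s * (P - s * (P / (2 * s))) = P / s" using \<open>s > 0\<close> by (simp add: field_simps)
  ultimately have "((\<lambda>\<tau>. 2 / s * (v \<tau> \<bullet> q - P / (2 * s))) has_integral P / s) {0..s}"
    by (simp only:)
  then have "ennreal (P / s) \<le> (\<integral>\<^sup>+\<tau>\<in>{0..s}. ennreal (mass_norm_sq m (v \<tau>)) \<partial>lebesgue)"
    by (rule has_integral_le_nn_integral) (intro AE_I2 impI ennreal_leI young)
  also have "\<dots> \<le> (\<integral>\<^sup>+\<tau>\<in>{0..T}. ennreal (mass_norm_sq m (v \<tau>)) \<partial>lebesgue)"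
    by (rule nn_integral_mono) (use s in \<open>auto simp: indicator_def\<close>)
  finally have "ennreal s * ennreal (P / s) \<le> ennreal s * (\<integral>\<^sup>+\<tau>\<in>{0..T}. ennreal (mass_norm_sq m (v \<tau>)) \<partial>lebesgue)"
    by (rule mult_left_mono) simp
  moreover have "ennreal s * ennreal (P / s) = ennreal P"
    using \<open>s > 0\<close> by (simp add: ennreal_mult'[symmetric])
  ultimately show ?thesis by (simp add: P_def z_def v_def)
qed

subsection \<open>Rademacher's theorem\<close>

text \<open>An arbitrary supremum of continuous functions has open strict superlevel sets, and by
  monotonicity in the radius the upper limit is a countable infimum of such suprema.\<close>

lemma borel_measurable_Limsup_at_0:
  fixes q :: "real \<Rightarrow> 'a::topological_space \<Rightarrow> real"
  assumes q: "\<And>h. h \<noteq> 0 \<Longrightarrow> continuous_on UNIV (q h)"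
  shows "(\<lambda>x. Limsup (at 0) (\<lambda>h. ereal (q h x))) \<in> borel_measurable borel"
proof -
  define A where "A n = {h::real. h \<noteq> 0 \<and> \<bar>h\<bar> < 1 / real (Suc n)}" for n
  have eq: "Limsup (at 0) (\<lambda>h. ereal (q h x)) = (INF n. SUP h\<in>A n. ereal (q h x))" for x
  proof (rule antisym)
    have "eventually (\<lambda>h. h \<in> A n) (at 0)" for n
      unfolding eventually_at by (intro exI[of _ "1 / real (Suc n)"]) (auto simp: A_def)
    then show "Limsup (at 0) (\<lambda>h. ereal (q h x)) \<le> (INF n. SUP h\<in>A n. ereal (q h x))"
      unfolding Limsup_def by (intro INF_greatest INF_lower2[of "\<lambda>h. h \<in> A _"]) auto
    show "(INF n. SUP h\<in>A n. ereal (q h x)) \<le> Limsup (at 0) (\<lambda>h. ereal (q h x))"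
      unfolding Limsup_def
    proof (rule INF_greatest)
      fix P :: "real \<Rightarrow> bool" assume "P \<in> {P. eventually P (at 0)}"
      then obtain d where "d > 0" and d: "\<And>h. h \<noteq> 0 \<Longrightarrow> \<bar>h\<bar> < d \<Longrightarrow> P h"
        unfolding eventually_at by (auto simp: dist_real_def)
      obtain n where n: "inverse (real (Suc n)) < d" using reals_Archimedean[OF \<open>d > 0\<close>] by blast
      have "A n \<subseteq> {h. P h}" using d n by (auto simp: A_def inverse_eq_divide)
      then show "(INF n. SUP h\<in>A n. ereal (q h x)) \<le> (SUP h\<in>{h. P h}. ereal (q h x))"
        by (intro INF_lower2[of n] SUP_subset_mono) auto
    qed
  qed
  have "(\<lambda>x. SUP h\<in>A n. ereal (q h x)) \<in> borel_measurable borel" for n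
  proof (rule borel_measurableI_greater)
    fix y
    have "{x \<in> space borel. y < (SUP h\<in>A n. ereal (q h x))} = (\<Union>h\<in>A n. {x. y < ereal (q h x)})"
      by (auto simp: less_SUP_iff)
    moreover have "open {x. y < ereal (q h x)}" if "h \<in> A n" for h
      using q[of h] that by (intro open_Collect_less continuous_intros) (auto simp: A_def)
    ultimately show "{x \<in> space borel. y < (SUP h\<in>A n. ereal (q h x))} \<in> sets borel"
      by (auto intro!: borel_open)
  qed
  then show ?thesis unfolding eq by (intro borel_measurable_INF) auto
qed

lemma lipschitz_imp_abs_continuous_curve:
  assumes "\<And>x y. dist (f x) (f y) \<le> L * dist x y"
  shows "abs_continuous_curve a b f"
proof -
  have "abs_continuous_curve a b (\<lambda>s::real. s)"
    unfolding abs_continuous_curve_iff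
  proof (intro allI impI)
    fix e :: real assume "e > 0"
    have "(\<Sum>(s, t)\<in>D. dist s t) = (\<Sum>(s, t)\<in>D. t - s)" if "\<forall>(s, t)\<in>D. a \<le> s \<and> s \<le> t \<and> t \<le> b" for D
      using that by (intro sum.cong) (auto simp: dist_real_def)
    then show "\<exists>d>0. \<forall>D. short_family a b d D \<longrightarrow> (\<Sum>(s, t)\<in>D. dist s t) < e"
      using \<open>e > 0\<close> by (intro exI[of _ e]) (auto simp: short_family_def)
  qed
  from abs_continuous_curve_lipschitz_image[OF this assms] show ?thesis .
qed

section \<open>Directional derivatives of Lipschitz functions\<close>

definition has_dir_derivative :: "('a::real_normed_vector \<Rightarrow> real) \<Rightarrow> 'a \<Rightarrow> 'a \<Rightarrow> real \<Rightarrow> bool" where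
  "has_dir_derivative u x v d \<longleftrightarrow> ((\<lambda>h. (u (x + h *\<^sub>R v) - u x) / h) \<longlongrightarrow> d) (at 0)"

text \<open>Restricted to a line in direction \<open>v\<close> the function is Lipschitz, hence
  differentiable almost everywhere, so the Borel set \<open>N\<close> of bad points meets each such
  line in a null set, and Fubini's theorem makes \<open>N\<close> null. \<open>D\<close> is the
  upper limit of the quotients, so it is measurable and bounded everywhere, also where no derivative
  exists.\<close>

lemma AE_directional_derivative:
  fixes u :: "'a::euclidean_space \<Rightarrow> real"
  assumes u: "L-lipschitz_on UNIV u"
  obtains D where "D \<in> borel_measurable borel" "\<And>x. \<bar>D x\<bar> \<le> L * norm v"
    "AE x in lborel. has_dir_derivative u x v (D x)"
proof -
  let ?q = "\<lambda>h x. (u (x + h *\<^sub>R v) - u x) / h"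
  have lip: "\<bar>u x - u y\<bar> \<le> L * norm (x - y)" for x y
    using lipschitz_onD[OF u, of x y] by (simp add: dist_real_def dist_norm)
  have bound: "\<bar>?q h x\<bar> \<le> L * norm v" if "h \<noteq> 0" for h x
    using lip[of "x + h *\<^sub>R v" x] that by (simp add: abs_divide field_simps)
  have cont: "continuous_on UNIV u" using u by (rule lipschitz_on_continuous_on)
  have contq: "continuous_on UNIV (?q h)" if "h \<noteq> 0" for h
    using that by (intro continuous_intros continuous_on_compose2[OF cont]) auto
  have contq': "continuous_on UNIV (\<lambda>x. - ?q h x)" if "h \<noteq> 0" for h
    by (rule continuous_on_minus[OF contq[OF that]])
  define S where "S x = Limsup (at 0) (\<lambda>h. ereal (?q h x))" for x
  define I where "I x = Liminf (at 0) (\<lambda>h. ereal (?q h x))" for x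
  have S [measurable]: "S \<in> borel_measurable borel"
    unfolding S_def by (rule borel_measurable_Limsup_at_0[OF contq])
  have I_eq: "I = (\<lambda>x. - Limsup (at 0) (\<lambda>h. ereal (- ?q h x)))"
    unfolding I_def using ereal_Limsup_uminus[of "at (0::real)"] by (simp flip: uminus_ereal.simps(1))
  have I [measurable]: "I \<in> borel_measurable borel"
    unfolding I_eq by (rule borel_measurable_uminus_ereal[OF borel_measurable_Limsup_at_0[OF contq']])
  have ev: "\<forall>\<^sub>F h in at 0. h \<noteq> (0::real)" by (simp add: eventually_at_filter)
  have S_le: "S x \<le> ereal (L * norm v)" for x
    unfolding S_def by (rule Limsup_bounded, use ev in eventually_elim) (use abs_le_D1[OF bound] in simp)
  have I_ge: "ereal (- (L * norm v)) \<le> I x" for x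
    unfolding I_def by (rule Liminf_bounded, use ev in eventually_elim) (use abs_le_D2[OF bound] in \<open>simp add: minus_le_iff\<close>)
  have IS: "I x \<le> S x" for x unfolding I_def S_def by (rule Liminf_le_Limsup) simp
  define D where "D x = real_of_ereal (S x)" for x
  have Sfin: "S x = ereal (D x)" and Db: "\<bar>D x\<bar> \<le> L * norm v" for x
  proof -
    have "ereal (- (L * norm v)) \<le> S x" using I_ge IS order_trans by blast
    then show 1: "S x = ereal (D x)" using S_le[of x] unfolding D_def by (cases "S x") auto
    then show "\<bar>D x\<bar> \<le> L * norm v" using S_le[of x] \<open>ereal (- (L * norm v)) \<le> S x\<close> by (simp add: abs_le_iff)
  qed
  have good: "has_dir_derivative u x v (D x)" if "I x = S x" for x
  proof -
    have "((\<lambda>h. ereal (?q h x)) \<longlongrightarrow> ereal (D x)) (at 0)"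
      by (subst tendsto_iff_Liminf_eq_Limsup) (use that Sfin[of x] in \<open>auto simp: S_def I_def\<close>)
    then show ?thesis unfolding has_dir_derivative_def by simp
  qed
  define N where "N = {x. I x \<noteq> S x}"
  have N [measurable]: "N \<in> sets borel"
  proof -
    have "{x \<in> space borel. I x \<noteq> S x} \<in> sets borel" by measurable
    then show ?thesis by (simp add: N_def)
  qed
  have line: "AE t in lborel. t \<in> {0..1} \<longrightarrow> x + t *\<^sub>R v \<notin> N" for x
  proof -
    define f where "f t = u (x + t *\<^sub>R v)" for t
    have "abs_continuous_curve 0 1 f"
    proof (rule lipschitz_imp_abs_continuous_curve)
      show "dist (f s) (f t) \<le> (L * norm v) * dist s t" for s t
        using lip[of "x + s *\<^sub>R v" "x + t *\<^sub>R v"]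
        by (simp add: f_def dist_real_def scaleR_left_diff_distrib[symmetric] mult.commute mult.left_commute)
    qed
    then have "AE t in lebesgue. \<not> (t \<in> {0<..<1} \<and> \<not> f differentiable (at t))"
      by (intro AE_if_negligible) (use abs_continuous_imp_differentiable_AE[of 0 1 f] in simp)
    moreover have "AE t in lebesgue. t \<notin> {0, 1::real}"
      by (rule AE_not_in) (simp add: negligible_iff_null_sets[symmetric] negligible_finite)
    ultimately have "AE t in lebesgue. t \<in> {0..1} \<longrightarrow> x + t *\<^sub>R v \<notin> N"
    proof eventually_elim
      case (elim t)
      show ?case
      proof
        assume "t \<in> {0..1}"
        then have "f differentiable (at t)" using elim by auto
        then obtain d where "(f has_real_derivative d) (at t)" by (auto simp: real_differentiable_def)
        then have "((\<lambda>h. (f (t + h) - f t) / h) \<longlongrightarrow> d) (at 0)" by (simp add: DERIV_def)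
        then have "((\<lambda>h. ereal (?q h (x + t *\<^sub>R v))) \<longlongrightarrow> ereal d) (at 0)"
          by (simp add: f_def scaleR_add_left add.assoc)
        then have "I (x + t *\<^sub>R v) = S (x + t *\<^sub>R v)"
          unfolding I_def S_def by (subst (asm) tendsto_iff_Liminf_eq_Limsup) auto
        then show "x + t *\<^sub>R v \<notin> N" by (simp add: N_def)
      qed
    qed
    then show ?thesis by (simp add: AE_completion_iff)
  qed
  \<comment> \<open>Fubini's theorem without coordinates adapted to \<open>v\<close>: the double
    integral over \<open>x\<close> and over \<open>t\<close> in \<open>{0..1}\<close> vanishes when
    \<open>t\<close> is integrated first, and equals the measure of \<open>N\<close> by translation
    invariance when \<open>x\<close> is.\<close>
  let ?F = "\<lambda>x. \<integral>\<^sup>+t. indicator N (x + t *\<^sub>R v) * indicator {0..1} t \<partial>lborel"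
  have "(\<integral>\<^sup>+x. ?F x \<partial>lborel) = (\<integral>\<^sup>+x. 0 \<partial>(lborel :: 'a measure))"
  proof (rule nn_integral_cong)
    fix x :: 'a
    have "?F x = (\<integral>\<^sup>+t. 0 \<partial>(lborel :: real measure))"
      by (rule nn_integral_cong_AE) (use line[of x] in eventually_elim, auto simp: indicator_def)
    then show "?F x = 0" by simp
  qed
  moreover have "(\<integral>\<^sup>+x. ?F x \<partial>lborel) =
      (\<integral>\<^sup>+t. (\<integral>\<^sup>+x. indicator N (x + t *\<^sub>R v) * indicator {0..1} t \<partial>lborel) \<partial>lborel)"
    by (rule lborel_pair.Fubini'[symmetric]) measurable
  moreover have "(\<integral>\<^sup>+x. indicator N (x + t *\<^sub>R v) * indicator {0..1} t \<partial>lborel) = emeasure lborel N * indicator {0..1} t" for t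
  proof -
    have "(\<integral>\<^sup>+x. indicator N (x + t *\<^sub>R v) \<partial>lborel) = (\<integral>\<^sup>+x. indicator N x \<partial>distr lborel borel ((+) (t *\<^sub>R v)))"
      by (subst nn_integral_distr) (auto simp: add.commute)
    also have "\<dots> = emeasure lborel N" by (simp add: lborel_distr_plus)
    finally show ?thesis by (subst nn_integral_multc) auto
  qed
  ultimately have "emeasure lborel N = 0"
    by (simp add: nn_integral_cmult)
  then have "AE x in lborel. x \<notin> N" by (intro AE_not_in) (auto simp: null_sets_def)
  then have "AE x in lborel. has_dir_derivative u x v (D x)"
    by eventually_elim (auto simp: N_def intro: good)
  moreover have "D \<in> borel_measurable borel" unfolding D_def by measurable
  ultimately show thesis using that Db by blast
qed

text \<open>The density \<open>1 + c * g\<close> is nonnegative for this choice of \<open>c\<close>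
  and gives every box its Lebesgue measure. Boxes determine Lebesgue measure, and densities are
  unique almost everywhere, so \<open>1 + c * g\<close> is 1.\<close>

lemma AE_eq_0_if_box_integrals_eq_0:
  fixes g :: "'a::euclidean_space \<Rightarrow> real"
  assumes g [measurable]: "g \<in> borel_measurable borel" and B: "\<And>x. \<bar>g x\<bar> \<le> B"
    and zero: "\<And>l r. (\<integral>x. indicator (box l r) x * g x \<partial>lborel) = 0"
  shows "AE x in lborel. g x = 0"
proof -
  define c where "c = 1 / (\<bar>B\<bar> + 1)"
  have "c > 0" by (simp add: c_def)
  have cg: "\<bar>c * g x\<bar> \<le> 1" for x
    using B[of x] by (simp add: c_def abs_mult field_simps)
  have cg1: "0 \<le> 1 + c * g x" for x using cg[of x] by linarith
  define \<rho> where "\<rho> x = ennreal (1 + c * g x)" for x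
  have [measurable]: "\<rho> \<in> borel_measurable borel" unfolding \<rho>_def by measurable
  have "lborel = density lborel \<rho>"
  proof (rule lborel_eqI)
    fix l u :: 'a assume lu: "\<And>b. b \<in> Basis \<Longrightarrow> l \<bullet> b \<le> u \<bullet> b"
    have fin: "emeasure lborel (box l u) < \<infinity>" using lu by (simp add: emeasure_lborel_box)
    have int1: "integrable lborel (\<lambda>x. indicator (box l u) x :: real)" using fin by simp
    have int2: "integrable lborel (\<lambda>x. indicator (box l u) x * g x)"
      by (rule integrableI_bounded_set_indicator[where B=B, of "box l u" lborel g, simplified]) (use fin B in auto)
    have "emeasure (density lborel \<rho>) (box l u) = (\<integral>\<^sup>+x. \<rho> x * indicator (box l u) x \<partial>lborel)"
      by (rule emeasure_density) auto
    also have "\<dots> = (\<integral>\<^sup>+x. ennreal (indicator (box l u) x + c * (indicator (box l u) x * g x)) \<partial>lborel)"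
      by (rule nn_integral_cong) (auto simp: \<rho>_def indicator_def)
    also have "\<dots> = ennreal (\<integral>x. indicator (box l u) x + c * (indicator (box l u) x * g x) \<partial>lborel)"
    proof (rule nn_integral_eq_integral)
      show "AE x in lborel. 0 \<le> indicator (box l u) x + c * (indicator (box l u) x * g x)"
        by (rule AE_I2) (use cg1 in \<open>auto simp: indicator_def\<close>)
    qed (use int1 int2 in auto)
    also have "(\<integral>x. indicator (box l u) x + c * (indicator (box l u) x * g x) \<partial>lborel) = measure lborel (box l u)"
      using int1 int2 zero by simp
    also have "\<dots> = (\<Prod>b\<in>Basis. (u - l) \<bullet> b)" using lu by (simp add: measure_lborel_box)
    finally show "emeasure (density lborel \<rho>) (box l u) = (\<Prod>b\<in>Basis. (u - l) \<bullet> b)" .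
  qed simp
  then have "density lborel (\<lambda>_. 1) = density lborel \<rho>" by (simp add: density_1)
  moreover have "sigma_finite_measure (density (lborel :: 'a measure) (\<lambda>_. 1))"
    unfolding density_1 by (rule sigma_finite_lborel)
  ultimately have "AE x in lborel. (1 :: ennreal) = \<rho> x"
    using sigma_finite_density_unique[of "\<lambda>_::'a. 1" lborel \<rho>] by simp
  then show ?thesis
  proof eventually_elim
    case (elim x)
    then have "1 + c * g x = 1" unfolding \<rho>_def by (metis ennreal_eq_1)
    then show ?case using \<open>c > 0\<close> by simp
  qed
qed

lemma box_translate_tendsto:
  fixes x :: "'a::euclidean_space"
  assumes "x \<notin> frontier S" "X \<longlonglongrightarrow> 0"
  shows "(\<lambda>n. indicator S (x - X n) :: real) \<longlonglongrightarrow> indicator S x"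
proof -
  have lim: "(\<lambda>n. x - X n) \<longlonglongrightarrow> x" using tendsto_diff[OF tendsto_const assms(2)] by simp
  consider "x \<in> interior S" | "x \<in> interior (- S)"
    using assms(1) by (auto simp: frontier_def interior_complement)
  then have "\<forall>\<^sub>F n in sequentially. (indicator S x :: real) = indicator S (x - X n)"
  proof cases
    case 1
    from topological_tendstoD[OF lim open_interior 1] show ?thesis
      by eventually_elim (use 1 interior_subset[of S] in \<open>auto simp: indicator_def\<close>)
  next
    case 2
    from topological_tendstoD[OF lim open_interior 2] show ?thesis
      by eventually_elim (use 2 interior_subset[of "- S"] in \<open>auto simp: indicator_def\<close>)
  qed
  then show ?thesis by (rule Lim_transform_eventually[OF tendsto_const])
qed

text \<open>Over a box the difference quotient along \<open>v + w\<close> and the sum of those along \<open>v\<close> and \<open>w\<close>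
  differ by the integral of a bounded function over the symmetric difference of the box and its
  translate, so no integration by parts against test functions is needed.\<close>

lemma AE_directional_derivative_add:
  fixes u :: "'a::euclidean_space \<Rightarrow> real"
  assumes u: "L-lipschitz_on UNIV u"
  shows "AE x in lborel. \<forall>d e. has_dir_derivative u x v d \<longrightarrow> has_dir_derivative u x w e \<longrightarrow>
    has_dir_derivative u x (v + w) (d + e)"
proof -
  have lip: "\<bar>u x - u y\<bar> \<le> L * norm (x - y)" for x y
    using lipschitz_onD[OF u, of x y] by (simp add: dist_real_def dist_norm)
  have "L \<ge> 0" using lipschitz_on_nonneg[OF u] .
  have [measurable]: "u \<in> borel_measurable borel"
    using lipschitz_on_continuous_on[OF u] by (rule borel_measurable_continuous_onI)
  obtain Dv where [measurable]: "Dv \<in> borel_measurable borel" and bv: "\<And>x. \<bar>Dv x\<bar> \<le> L * norm v"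
    and Dv: "AE x in lborel. has_dir_derivative u x v (Dv x)"
    using AE_directional_derivative[OF u] by metis
  obtain Dw where [measurable]: "Dw \<in> borel_measurable borel" and bw: "\<And>x. \<bar>Dw x\<bar> \<le> L * norm w"
    and Dw: "AE x in lborel. has_dir_derivative u x w (Dw x)"
    using AE_directional_derivative[OF u] by metis
  obtain Ds where [measurable]: "Ds \<in> borel_measurable borel" and bs: "\<And>x. \<bar>Ds x\<bar> \<le> L * norm (v + w)"
    and Ds: "AE x in lborel. has_dir_derivative u x (v + w) (Ds x)"
    using AE_directional_derivative[OF u] by metis
  define g where "g x = Ds x - (Dv x + Dw x)" for x
  have [measurable]: "g \<in> borel_measurable borel" unfolding g_def by measurable
  define X where "X n = 1 / real (Suc n)" for n
  have Xlim: "X \<longlonglongrightarrow> 0" unfolding X_def using LIMSEQ_Suc[OF lim_1_over_n[where 'a=real]] by simp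
  have X0: "X n > 0" "X n \<le> 1" for n by (auto simp: X_def)
  define Q where "Q z n x = (u (x + X n *\<^sub>R z) - u x) / X n" for z n x
  have [measurable]: "Q z n \<in> borel_measurable borel" for z n unfolding Q_def by measurable
  have Qb: "\<bar>Q z n x\<bar> \<le> L * norm z" for z n x
    using lip[of "x + X n *\<^sub>R z" x] X0(1)[of n] by (simp add: Q_def abs_divide field_simps)
  have Qlim: "(\<lambda>n. Q z n x) \<longlonglongrightarrow> d" if "has_dir_derivative u x z d" for z x d
    using filterlim_compose[OF that[unfolded has_dir_derivative_def], of X sequentially] Xlim X0(1)
    by (simp add: Q_def filterlim_at eventually_sequentially) (metis less_irrefl)
  have "(\<integral>x. indicator (box l r) x * g x \<partial>lborel) = 0" for l r
  proof -
    define S where "S = box l r"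
    let ?I = "\<lambda>f. \<integral>x. indicator S x * f x \<partial>lborel"
    have [measurable]: "S \<in> sets borel" by (simp add: S_def)
    have Sfin: "emeasure lborel S < \<infinity>" by (simp add: S_def emeasure_lborel_box_eq)
    have bi: "integrable lborel (\<lambda>x. indicator S x * f x)"
      if [measurable]: "f \<in> borel_measurable borel" and "\<And>x. \<bar>f x\<bar> \<le> B" for f :: "'a \<Rightarrow> real" and B
      by (rule integrableI_bounded_set_indicator[where B=B, of S lborel f, simplified]) (use Sfin that in auto)
    have conv: "(\<lambda>n. ?I (Q z n)) \<longlonglongrightarrow> ?I D"
      if [measurable]: "D \<in> borel_measurable borel" and D: "AE x in lborel. has_dir_derivative u x z (D x)" for z D
    proof (rule integral_dominated_convergence[where w = "\<lambda>x. indicator S x * (L * norm z)"])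
      show "integrable lborel (\<lambda>x. indicator S x * (L * norm z))" by (rule bi) auto
      show "AE x in lborel. (\<lambda>n. indicator S x * Q z n x) \<longlonglongrightarrow> indicator S x * D x"
        using D by eventually_elim (intro tendsto_intros Qlim)
      show "AE x in lborel. norm (indicator S x * Q z n x) \<le> indicator S x * (L * norm z)" for n
        using Qb by (auto simp: indicator_def)
    qed auto
    \<comment> \<open>The increment along \<open>v + w\<close> is an increment along
      \<open>v\<close> followed by one along \<open>w\<close> that starts at the shifted point;
      translation invariance moves this shift from the quotient to the indicator.\<close>
    have split: "?I (Q (v + w) n) - ?I (Q v n) - ?I (Q w n)
        = (\<integral>x. (indicator S (x - X n *\<^sub>R v) - indicator S x) * Q w n x \<partial>lborel)" for n
    proof -
      have "(\<integral>x. indicator S x * Q w n (x + X n *\<^sub>R v) \<partial>lborel) = (\<integral>x. indicator S (x - X n *\<^sub>R v) * Q w n x \<partial>distr lborel borel ((+) (X n *\<^sub>R v)))"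
        by (subst integral_distr) (auto simp: add.commute)
      then have shift: "(\<integral>x. indicator S x * Q w n (x + X n *\<^sub>R v) \<partial>lborel) = (\<integral>x. indicator S (x - X n *\<^sub>R v) * Q w n x \<partial>lborel)"
        by (simp add: lborel_distr_plus)
      have i1: "integrable lborel (\<lambda>x. indicator S x * Q w n (x + X n *\<^sub>R v))"
        by (rule bi) (simp, rule Qb)
      have "integrable (distr lborel borel ((+) (X n *\<^sub>R v))) (\<lambda>x. indicator S (x - X n *\<^sub>R v) * Q w n x)"
        by (subst integrable_distr_eq) (use i1 in \<open>auto simp: add.commute\<close>)
      then have i2: "integrable lborel (\<lambda>x. indicator S (x - X n *\<^sub>R v) * Q w n x)" by (simp add: lborel_distr_plus)
      have "Q (v + w) n x = Q v n x + Q w n (x + X n *\<^sub>R v)" for x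
        using X0(1)[of n] by (simp add: Q_def scaleR_add_right add.assoc[symmetric] add_divide_distrib[symmetric])
      then have "?I (Q (v + w) n) = (\<integral>x. indicator S x * Q v n x + indicator S x * Q w n (x + X n *\<^sub>R v) \<partial>lborel)"
        by (simp add: distrib_left)
      also have "\<dots> = ?I (Q v n) + (\<integral>x. indicator S (x - X n *\<^sub>R v) * Q w n x \<partial>lborel)"
        unfolding shift[symmetric] by (rule Bochner_Integration.integral_add[OF _ i1]) (rule bi[OF _ Qb], simp)
      finally show ?thesis
        using Bochner_Integration.integral_diff[OF i2 bi[of "Q w n", OF _ Qb]]
        by (simp add: left_diff_distrib)
    qed
    have "bounded S" unfolding S_def by (rule bounded_box)
    then obtain R where R: "\<And>x. x \<in> S \<Longrightarrow> norm x \<le> R" unfolding bounded_iff by blast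
    \<comment> \<open>All steps \<open>X n\<close> are at most 1, so this ball contains the box and
      all its translates and carries an integrable dominating function.\<close>
    define C where "C = cball (0::'a) (R + norm v)"
    have [measurable]: "C \<in> sets borel" by (simp add: C_def)
    have "(\<lambda>n. \<integral>x. (indicator S (x - X n *\<^sub>R v) - indicator S x) * Q w n x \<partial>lborel) \<longlonglongrightarrow> (\<integral>x. 0 \<partial>(lborel :: 'a measure))"
    proof (rule integral_dominated_convergence[where w = "\<lambda>x. indicator C x * (L * norm w)"])
      have "emeasure lborel C < \<infinity>" unfolding C_def by (rule emeasure_lborel_cball_finite)
      then show "integrable lborel (\<lambda>x. indicator C x * (L * norm w))" by simp
      show "AE x in lborel. norm ((indicator S (x - X n *\<^sub>R v) - indicator S x) * Q w n x) \<le> indicator C x * (L * norm w)" for n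
      proof (rule AE_I2)
        fix x
        have "x \<in> C" if "x \<in> S \<or> x - X n *\<^sub>R v \<in> S"
        proof -
          have "X n * norm v \<le> 1 * norm v" using X0(2)[of n] by (intro mult_right_mono) auto
          then have "norm (X n *\<^sub>R v) \<le> norm v" using X0(1)[of n] by simp
          moreover have "norm x \<le> norm (x - X n *\<^sub>R v) + norm (X n *\<^sub>R v)" using norm_triangle_ineq[of "x - X n *\<^sub>R v" "X n *\<^sub>R v"] by simp
          ultimately have "norm x \<le> R + norm v" using that R[of x] R[of "x - X n *\<^sub>R v"] norm_ge_zero[of v] by linarith
          then show ?thesis by (simp add: C_def)
        qed
        then show "norm ((indicator S (x - X n *\<^sub>R v) - indicator S x) * Q w n x) \<le> indicator C x * (L * norm w)"
          using Qb[of w n x] \<open>L \<ge> 0\<close> by (auto simp: indicator_def)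
      qed
      have "AE x in lebesgue. \<not> x \<in> frontier S"
        by (rule AE_if_negligible) (simp add: S_def negligible_convex_frontier convex_box)
      then have "AE x in lborel. x \<notin> frontier S" by (simp add: AE_completion_iff)
      then show "AE x in lborel. (\<lambda>n. (indicator S (x - X n *\<^sub>R v) - indicator S x) * Q w n x) \<longlonglongrightarrow> 0"
      proof eventually_elim
        case (elim x)
        have "(\<lambda>n. X n *\<^sub>R v) \<longlonglongrightarrow> 0" using tendsto_scaleR[OF Xlim tendsto_const[of v]] by simp
        then have "(\<lambda>n. indicator S (x - X n *\<^sub>R v) - indicator S x :: real) \<longlonglongrightarrow> 0"
          using box_translate_tendsto[OF elim] by (simp add: LIM_zero)
        then show ?case
          by (rule lim_null_mult_right_bounded[where B = "L * norm w"]) (use Qb in auto)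
      qed
    qed auto
    then have "(\<lambda>n. ?I (Q (v + w) n) - ?I (Q v n) - ?I (Q w n)) \<longlonglongrightarrow> 0"
      unfolding split by simp
    moreover have "(\<lambda>n. ?I (Q (v + w) n) - ?I (Q v n) - ?I (Q w n))
        \<longlonglongrightarrow> ?I Ds - ?I Dv - ?I Dw"
      by (intro tendsto_diff conv Ds Dv Dw) auto
    ultimately have "?I Ds - ?I Dv - ?I Dw = 0"
      by (rule LIMSEQ_unique[rotated])
    moreover have "?I g =
        ?I Ds - (?I Dv + ?I Dw)"
    proof -
      have i: "integrable lborel (\<lambda>x. indicator S x * Ds x)" "integrable lborel (\<lambda>x. indicator S x * Dv x)" "integrable lborel (\<lambda>x. indicator S x * Dw x)"
        using bi[OF _ bs] bi[OF _ bv] bi[OF _ bw] by auto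
      have "indicator S x * g x = indicator S x * Ds x - (indicator S x * Dv x + indicator S x * Dw x)" for x
        by (simp add: g_def algebra_simps)
      then show ?thesis using i by simp
    qed
    ultimately show ?thesis by (simp add: S_def)
  qed
  moreover have "\<bar>g x\<bar> \<le> L * norm (v + w) + (L * norm v + L * norm w)" for x
    using bs[of x] bv[of x] bw[of x] unfolding g_def by linarith
  ultimately have "AE x in lborel. g x = 0" by (intro AE_eq_0_if_box_integrals_eq_0) auto
  then show ?thesis using Ds Dv Dw
  proof eventually_elim
    case (elim x)
    have uniq: "d = d'" if "has_dir_derivative u x z d" "has_dir_derivative u x z d'" for z d d'
      using that unfolding has_dir_derivative_def by (rule tendsto_unique[OF at_neq_bot])
    show ?case using elim uniq by (metis g_def eq_iff_diff_eq_0)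
  qed
qed

lemma has_dir_derivative_scaleR:
  assumes "has_dir_derivative u x v d"
  shows "has_dir_derivative u x (c *\<^sub>R v) (c * d)"
proof (cases "c = 0")
  case True
  then show ?thesis by (simp add: has_dir_derivative_def)
next
  case False
  have "filterlim (\<lambda>h. h * c) (at 0) (at 0)"
    unfolding filterlim_at using False
    by (auto simp: eventually_at_filter intro!: tendsto_mult_left_zero)
  then have "((\<lambda>h. (u (x + (h * c) *\<^sub>R v) - u x) / (h * c)) \<longlongrightarrow> d) (at 0)"
    by (rule filterlim_compose[OF assms[unfolded has_dir_derivative_def]])
  then have "((\<lambda>h. c * ((u (x + (h * c) *\<^sub>R v) - u x) / (h * c))) \<longlongrightarrow> c * d) (at 0)"
    by (rule tendsto_mult_left)
  then show ?thesis using False by (simp add: has_dir_derivative_def)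
qed

lemma AE_directional_derivative_linear:
  fixes u :: "'a::euclidean_space \<Rightarrow> real"
  assumes u: "L-lipschitz_on UNIV u"
    and D: "\<And>b. b \<in> Basis \<Longrightarrow> AE x in lborel. has_dir_derivative u x b (D b x)"
  shows "AE x in lborel. has_dir_derivative u x v (\<Sum>b\<in>Basis. (v \<bullet> b) * D b x)"
proof -
  have "AE x in lborel. has_dir_derivative u x (\<Sum>b\<in>A. (v \<bullet> b) *\<^sub>R b) (\<Sum>b\<in>A. (v \<bullet> b) * D b x)"
    if "finite A" "A \<subseteq> Basis" for A
    using that
  proof (induction A rule: finite_induct)
    case empty
    then show ?case by (simp add: has_dir_derivative_def)
  next
    case (insert b A)
    have "AE x in lborel. has_dir_derivative u x b (D b x)" using D insert by simp
    moreover have "AE x in lborel. has_dir_derivative u x (\<Sum>b\<in>A. (v \<bullet> b) *\<^sub>R b) (\<Sum>b\<in>A. (v \<bullet> b) * D b x)"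
      using insert by simp
    moreover note AE_directional_derivative_add[OF u, of "(v \<bullet> b) *\<^sub>R b" "\<Sum>b\<in>A. (v \<bullet> b) *\<^sub>R b"]
    ultimately show ?case
    proof eventually_elim
      case (elim x)
      then show ?case using has_dir_derivative_scaleR[OF elim(1), of "v \<bullet> b"] insert(1,2) by simp
    qed
  qed
  from this[OF finite_Basis order_refl] show ?thesis by (simp add: euclidean_representation)
qed

text \<open>By compactness finitely many directions of \<open>W\<close> come within \<eta> of every
  unit vector. The directional limits are uniform over this finite set, and the Lipschitz bound
  transfers the estimate to all other directions.\<close>

lemma has_derivative_if_dense_directional:
  fixes u :: "'a::euclidean_space \<Rightarrow> real"
  assumes u: "L-lipschitz_on UNIV u"
    and dense: "\<And>S. open S \<Longrightarrow> S \<noteq> {} \<Longrightarrow> \<exists>w\<in>W. w \<in> S"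
    and A: "bounded_linear A" and dir: "\<And>w. w \<in> W \<Longrightarrow> has_dir_derivative u x w (A w)"
  shows "(u has_derivative A) (at x)"
  unfolding has_derivative_at_alt
proof (intro conjI A allI impI)
  fix e :: real assume "e > 0"
  have lip: "\<bar>u x - u y\<bar> \<le> L * norm (x - y)" for x y
    using lipschitz_onD[OF u, of x y] by (simp add: dist_real_def dist_norm)
  have "L \<ge> 0" using lipschitz_on_nonneg[OF u] .
  obtain K where "K > 0" and K: "\<And>v. norm (A v) \<le> norm v * K" using bounded_linear.pos_bounded[OF A] by blast
  \<comment> \<open>The denominator collects three errors: \<open>L\<close> for moving the argument
    of \<open>u\<close> to a nearby direction, 1 for the difference quotient, and \<open>K\<close>
    for moving the argument of \<open>A\<close>.\<close>
  define \<eta> where "\<eta> = e / (L + 1 + K)"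
  have "\<eta> > 0" and \<eta>: "(L + 1 + K) * \<eta> = e" using \<open>e > 0\<close> \<open>L \<ge> 0\<close> \<open>K > 0\<close> by (auto simp: \<eta>_def)
  have "sphere (0::'a) 1 \<subseteq> (\<Union>w\<in>W. ball w \<eta>)"
  proof
    fix y :: 'a
    obtain w where "w \<in> W" "w \<in> ball y \<eta>" using dense[of "ball y \<eta>"] \<open>\<eta> > 0\<close> by auto
    then show "y \<in> (\<Union>w\<in>W. ball w \<eta>)" by (auto simp: dist_commute)
  qed
  then obtain F where F: "F \<subseteq> W" "finite F" "sphere (0::'a) 1 \<subseteq> (\<Union>w\<in>F. ball w \<eta>)"
    using compactE_image[OF compact_sphere, of W "\<lambda>w. ball w \<eta>" 0 1] by auto
  have "\<exists>d>0. \<forall>h. h \<noteq> 0 \<longrightarrow> \<bar>h\<bar> < d \<longrightarrow> \<bar>(u (x + h *\<^sub>R w) - u x) / h - A w\<bar> < \<eta>" if "w \<in> W" for w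
    using LIM_D[OF dir[OF that, unfolded has_dir_derivative_def] \<open>\<eta> > 0\<close>] by auto
  then obtain \<delta> where \<delta>: "\<And>w. w \<in> W \<Longrightarrow> \<delta> w > 0"
    "\<And>w h. w \<in> W \<Longrightarrow> h \<noteq> 0 \<Longrightarrow> \<bar>h\<bar> < \<delta> w \<Longrightarrow> \<bar>(u (x + h *\<^sub>R w) - u x) / h - A w\<bar> < \<eta>"
    by metis
  define d where "d = Min (insert 1 (\<delta> ` F))"
  have "d > 0" unfolding d_def using F(1,2) \<delta>(1) by (subst Min_gr_iff) auto
  have d\<delta>: "d \<le> \<delta> w" if "w \<in> F" for w unfolding d_def using F(2) that by (intro Min_le) auto
  have "norm (u y - u x - A (y - x)) \<le> e * norm (y - x)" if y: "norm (y - x) < d" for y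
  proof (cases "y = x")
    case True
    then show ?thesis using linear_0[OF bounded_linear.linear[OF A]] by simp
  next
    case False
    define t where "t = norm (y - x)"
    have "t > 0" using False by (simp add: t_def)
    define z where "z = (1 / t) *\<^sub>R (y - x)"
    have "norm z = 1" using \<open>t > 0\<close> by (simp add: z_def t_def[symmetric])
    then obtain w where w: "w \<in> F" "z \<in> ball w \<eta>" using F(3) by auto
    have yz: "y = x + t *\<^sub>R z" using \<open>t > 0\<close> by (simp add: z_def)
    have zw: "norm (z - w) < \<eta>" using w(2) by (simp add: dist_norm norm_minus_commute)
    have "\<bar>u y - u (x + t *\<^sub>R w)\<bar> \<le> L * norm (t *\<^sub>R (z - w))"
      using lip[of y "x + t *\<^sub>R w"] by (simp add: yz scaleR_diff_right)
    also have "\<dots> \<le> L * (t * \<eta>)" using zw \<open>t > 0\<close> \<open>L \<ge> 0\<close> by (intro mult_left_mono) auto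
    finally have 1: "\<bar>u y - u (x + t *\<^sub>R w)\<bar> \<le> L * (t * \<eta>)" .
    have "\<bar>(u (x + t *\<^sub>R w) - u x) / t - A w\<bar> < \<eta>"
      using \<delta>(2)[of w t] w(1) F(1) d\<delta>[OF w(1)] \<open>t > 0\<close> y by (auto simp: t_def)
    moreover have "(u (x + t *\<^sub>R w) - u x) / t - A w = (u (x + t *\<^sub>R w) - u x - t * A w) / t"
      using \<open>t > 0\<close> by (simp add: field_simps)
    ultimately have 2: "\<bar>u (x + t *\<^sub>R w) - u x - t * A w\<bar> \<le> \<eta> * t"
      using \<open>t > 0\<close> by (simp add: abs_divide field_simps)
    have "\<bar>t * A w - A (y - x)\<bar> = t * \<bar>A (w - z)\<bar>"
    proof -
      have "A (y - x) = t * A z" "A (w - z) = A w - A z"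
        using linear_cmul[OF bounded_linear.linear[OF A], of t z] linear_diff[OF bounded_linear.linear[OF A]]
        by (simp_all add: yz)
      then have "t * A w - A (y - x) = t * A (w - z)" by (simp add: right_diff_distrib)
      then show ?thesis using \<open>t > 0\<close> by (simp add: abs_mult)
    qed
    also have "\<dots> \<le> t * (\<eta> * K)"
    proof (rule mult_left_mono)
      have "\<bar>A (w - z)\<bar> \<le> norm (w - z) * K" using K[of "w - z"] by simp
      also have "\<dots> \<le> \<eta> * K" using zw \<open>K > 0\<close> by (intro mult_right_mono) (auto simp: norm_minus_commute)
      finally show "\<bar>A (w - z)\<bar> \<le> \<eta> * K" .
    qed (use \<open>t > 0\<close> in simp)
    finally have 3: "\<bar>t * A w - A (y - x)\<bar> \<le> t * (\<eta> * K)" .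
    have "\<bar>u y - u x - A (y - x)\<bar> \<le> L * (t * \<eta>) + \<eta> * t + t * (\<eta> * K)" using 1 2 3 by linarith
    also have "\<dots> = ((L + 1 + K) * \<eta>) * t" by (simp add: algebra_simps)
    finally show ?thesis by (simp add: \<eta> t_def)
  qed
  then show "\<exists>d>0. \<forall>y. norm (y - x) < d \<longrightarrow> norm (u y - u x - A (y - x)) \<le> e * norm (y - x)"
    using \<open>d > 0\<close> by blast
qed

text \<open>Linearity in the direction holds almost everywhere for each fixed vector; the
  exceptional null set depends on the vector. A countable dense set of directions keeps their union
  null, and the Lipschitz property makes density sufficient.\<close>

theorem rademacher:
  fixes u :: "'a::euclidean_space \<Rightarrow> real"
  assumes u: "L-lipschitz_on UNIV u"
  shows "AE x in lborel. u differentiable (at x)"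
proof -
  have "\<exists>D. AE x in lborel. has_dir_derivative u x b (D x)" for b
    using AE_directional_derivative[OF u] by metis
  then obtain D where D: "\<And>b. AE x in lborel. has_dir_derivative u x b (D b x)" by metis
  obtain W :: "'a set" where W: "countable W" "\<And>S. open S \<Longrightarrow> S \<noteq> {} \<Longrightarrow> \<exists>w\<in>W. w \<in> S"
    using countable_dense_exists[where 'a='a] by metis
  have "AE x in lborel. \<forall>w\<in>W. has_dir_derivative u x w (\<Sum>b\<in>Basis. (w \<bullet> b) * D b x)"
    using AE_directional_derivative_linear[OF u D] by (subst AE_ball_countable[OF W(1)]) auto
  then show ?thesis
  proof eventually_elim
    case (elim x)
    have "bounded_linear (\<lambda>w. \<Sum>b\<in>Basis. (w \<bullet> b) * D b x)"
      by (intro bounded_linear_sum bounded_linear_mult_left[THEN bounded_linear_compose] bounded_linear_inner_left)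
    then have "(u has_derivative (\<lambda>w. \<Sum>b\<in>Basis. (w \<bullet> b) * D b x)) (at x)"
      using elim W(2) by (intro has_derivative_if_dense_directional[OF u, of W]) auto
    then show ?case by (rule differentiableI)
  qed
qed

text \<open>McShane's formula extends the restriction of \<open>u\<close> to a small ball.\<close>

theorem rademacher_local:
  fixes u :: "'a::euclidean_space \<Rightarrow> real"
  assumes "open G" and loc: "\<And>x. x \<in> G \<Longrightarrow> \<exists>r>0. \<exists>L. L-lipschitz_on (ball x r) u"
  shows "negligible {x \<in> G. \<not> u differentiable (at x)}"
  unfolding locally_negligible_alt[of "{x \<in> G. \<not> u differentiable (at x)}"]
proof
  let ?S = "{x \<in> G. \<not> u differentiable (at x)}"
  fix x assume "x \<in> ?S"
  then obtain r L where "r > 0" and u: "L-lipschitz_on (ball x r) u" using loc by blast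
  have "L \<ge> 0" using lipschitz_on_nonneg[OF u] .
  define U where "U y = (INF z\<in>ball x r. u z + L * dist y z)" for y
  have ne: "ball x r \<noteq> {}" using \<open>r > 0\<close> by simp
  have bdd: "bdd_below ((\<lambda>z. u z + L * dist y z) ` ball x r)" for y
  proof (rule bdd_belowI2)
    fix z assume z: "z \<in> ball x r"
    have "u x - u z \<le> L * dist x z"
      using lipschitz_onD[OF u, of x z] z \<open>r > 0\<close> by (simp add: dist_real_def)
    also have "\<dots> \<le> L * (dist y x + dist y z)"
      using \<open>L \<ge> 0\<close> dist_triangle3[of x z y] by (intro mult_left_mono) (auto simp: dist_commute)
    finally show "u x - L * dist y x \<le> u z + L * dist y z" by (simp add: algebra_simps)
  qed
  have Ule: "U y \<le> U y' + L * dist y y'" for y y'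
  proof -
    have "U y - L * dist y y' \<le> U y'"
      unfolding U_def[of y']
    proof (rule cINF_greatest[OF ne])
      fix z assume z: "z \<in> ball x r"
      have "U y \<le> u z + L * dist y z" unfolding U_def by (rule cINF_lower[OF bdd z])
      also have "\<dots> \<le> u z + L * (dist y y' + dist y' z)"
        using \<open>L \<ge> 0\<close> dist_triangle[of y z y'] by (intro add_left_mono mult_left_mono) auto
      finally show "U y - L * dist y y' \<le> u z + L * dist y' z" by (simp add: algebra_simps)
    qed
    then show ?thesis by simp
  qed
  have "L-lipschitz_on UNIV U"
  proof (rule lipschitz_onI)
    show "dist (U y) (U y') \<le> L * dist y y'" for y y'
      using Ule[of y y'] Ule[of y' y] by (simp add: dist_real_def abs_le_iff dist_commute)
  qed fact
  then have "AE y in lborel. U differentiable (at y)" by (rule rademacher)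
  then have "AE y in lebesgue. \<not> \<not> U differentiable (at y)" by (simp add: AE_completion_iff)
  then have neg: "negligible {y. \<not> U differentiable (at y)}" by (rule negligible_if_AE)
  have Uu: "U y = u y" if y: "y \<in> ball x r" for y
  proof (rule antisym)
    show "U y \<le> u y" unfolding U_def using cINF_lower[OF bdd y, of y] by simp
    show "u y \<le> U y" unfolding U_def
    proof (rule cINF_greatest[OF ne])
      fix z assume "z \<in> ball x r"
      then show "u y \<le> u z + L * dist y z" using lipschitz_onD[OF u y, of z] by (simp add: dist_real_def)
    qed
  qed
  show "\<exists>V. openin (top_of_set ?S) V \<and> x \<in> V \<and> negligible V"
  proof (intro exI conjI)
    show "openin (top_of_set ?S) (?S \<inter> ball x r)" by (simp add: openin_open_Int)
    show "x \<in> ?S \<inter> ball x r" using \<open>x \<in> ?S\<close> \<open>r > 0\<close> by simp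
    show "negligible (?S \<inter> ball x r)"
    proof (rule negligible_subset[OF neg], clarify)
      fix y assume y: "y \<in> ball x r" "\<not> u differentiable (at y)" "U differentiable (at y)"
      then obtain U' where "(U has_derivative U') (at y)" by (auto simp: differentiable_def)
      then have "(u has_derivative U') (at y)"
        by (rule has_derivative_transform_within_open[OF _ open_ball y(1)]) (simp add: Uu)
      then show False using y(2) by (auto simp: differentiable_def)
    qed
  qed
qed

subsection \<open>Mass norm and potential\<close>

lemma mass_norm_sq_le:
  fixes v :: "'e::euclidean_space ^ 'n::finite"
  assumes "\<And>i. m i > 0"
  shows "mass_norm_sq m v \<le> (\<Sum>i\<in>UNIV. m i) * (norm v)\<^sup>2"
  unfolding mass_norm_sq_def sum_distrib_right
  by (intro sum_mono mult_left_mono power_mono Finite_Cartesian_Product.norm_nth_le)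
    (use less_imp_le[OF assms] in auto)

lemma mass_norm_sq_ge:
  assumes m: "\<And>i. m i > 0"
  obtains c where "c > 0" "\<And>v :: 'e::euclidean_space ^ 'n::finite. c * (norm v)\<^sup>2 \<le> mass_norm_sq m v"
proof
  show "Min (range m) > 0" using m by (subst Min_gr_iff) auto
  fix v :: "'e ^ 'n"
  have "Min (range m) * (norm v)\<^sup>2 = (\<Sum>i\<in>UNIV. Min (range m) * (norm (v $ i))\<^sup>2)"
    by (simp add: norm_vec_def L2_set_def sum_nonneg sum_distrib_left)
  also have "\<dots> \<le> mass_norm_sq m v"
    unfolding mass_norm_sq_def by (intro sum_mono mult_right_mono) auto
  finally show "Min (range m) * (norm v)\<^sup>2 \<le> mass_norm_sq m v" .
qed

lemma mass_norm_sq_nonneg: "(\<And>i. m i > 0) \<Longrightarrow> 0 \<le> mass_norm_sq m v"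
  unfolding mass_norm_sq_def by (intro sum_nonneg mult_nonneg_nonneg) (auto intro: less_imp_le)

lemma mass_norm_sq_scaleR: "mass_norm_sq m (c *\<^sub>R v) = c\<^sup>2 * mass_norm_sq m v"
  by (simp add: mass_norm_sq_def sum_distrib_left power_mult_distrib mult_ac)

text \<open>Continuity is meant in the extended half line and includes collisions. It therefore
  yields upper bounds near configurations of finite potential as well as arbitrarily large lower
  bounds near collisions, where the supersolution inequality must be refuted.\<close>

lemma isCont_potential:
  fixes x0 :: "('e::euclidean_space, 'n::{finite,linorder}) vec"
  assumes m: "\<And>i. m i > 0" and "\<kappa> > 0"
  shows "isCont (potential m \<kappa>) x0"
  unfolding isCont_def potential_def case_prod_unfold
proof (rule tendsto_sum)
  fix ij :: "'n \<times> 'n" assume "ij \<in> {ij. fst ij < snd ij}"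
  define i j where "i = fst ij" and "j = snd ij"
  define M where "M = m i * m j"
  have "M > 0" using m by (simp add: M_def)
  let ?r = "\<lambda>x. norm (x $ i - x $ j)"
  have r: "(?r \<longlongrightarrow> ?r x0) (at x0)" by (intro tendsto_intros)
  have "((\<lambda>x. if x $ i = x $ j then \<infinity> else ennreal (M * ?r x powr (- 2 * \<kappa>))) \<longlongrightarrow>
      (if x0 $ i = x0 $ j then \<infinity> else ennreal (M * ?r x0 powr (- 2 * \<kappa>)))) (at x0)"
  proof (cases "x0 $ i = x0 $ j")
    case False
    then have "0 < ?r x0" by simp
    have "((\<lambda>x. ennreal (M * ?r x powr (- 2 * \<kappa>))) \<longlongrightarrow> ennreal (M * ?r x0 powr (- 2 * \<kappa>))) (at x0)"
      by (intro tendsto_ennrealI tendsto_mult tendsto_const tendsto_powr r) (use False in auto)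
    moreover have "\<forall>\<^sub>F x in at x0. ennreal (M * ?r x powr (- 2 * \<kappa>)) =
        (if x $ i = x $ j then \<infinity> else ennreal (M * ?r x powr (- 2 * \<kappa>)))"
      using order_tendstoD(1)[OF r \<open>0 < ?r x0\<close>] by eventually_elim auto
    ultimately show ?thesis using False by (auto intro: Lim_transform_eventually)
  next
    case True
    have "\<forall>\<^sub>F x in at x0. ennreal l < (if x $ i = x $ j then \<infinity> else ennreal (M * ?r x powr (- 2 * \<kappa>)))"
      if "l \<ge> 0" for l
    proof -
      \<comment> \<open>The distance at which the pair term equals \<open>l + 1\<close>; adding 1
        gives the strict inequality and keeps the base positive for \<open>l = 0\<close>.\<close>
      define \<delta> where "\<delta> = ((l + 1) / M) powr (- 1 / (2 * \<kappa>))"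
      have pos: "(l + 1) / M > 0" using \<open>M > 0\<close> that by simp
      then have "\<delta> > 0" unfolding \<delta>_def by (subst powr_gt_zero) linarith
      have \<delta>: "\<delta> powr (- 2 * \<kappa>) = (l + 1) / M"
        using pos \<open>\<kappa> > 0\<close> \<open>M > 0\<close> that unfolding \<delta>_def powr_powr by simp
      have "\<forall>\<^sub>F x in at x0. ?r x < \<delta>" using order_tendstoD(2)[OF r, of \<delta>] True \<open>\<delta> > 0\<close> by simp
      then show ?thesis
      proof eventually_elim
        case (elim x)
        show ?case
        proof (cases "x $ i = x $ j")
          case False
          then have "\<delta> powr (- 2 * \<kappa>) < ?r x powr (- 2 * \<kappa>)"
            using elim \<open>\<kappa> > 0\<close> by (intro powr_less_mono2_neg) auto
          then have "l + 1 < M * ?r x powr (- 2 * \<kappa>)"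
            unfolding \<delta> using \<open>M > 0\<close> by (simp add: field_simps)
          then show ?thesis using False that by (simp add: ennreal_less_iff)
        qed simp
      qed
    qed
    then show ?thesis using True by (simp add: tendsto_top_iff_ennreal)
  qed
  then show "((\<lambda>x. if x $ fst ij = x $ snd ij then \<infinity>
      else ennreal (m (fst ij) * m (snd ij) * norm (x $ fst ij - x $ snd ij) powr (- 2 * \<kappa>))) \<longlongrightarrow>
      (if x0 $ fst ij = x0 $ snd ij then \<infinity>
      else ennreal (m (fst ij) * m (snd ij) * norm (x0 $ fst ij - x0 $ snd ij) powr (- 2 * \<kappa>)))) (at x0)"
    by (simp only: i_def j_def M_def)
qed

lemma potential_less_nhds:
  fixes x0 :: "('e::euclidean_space, 'n::{finite,linorder}) vec"
  assumes "\<And>i. m i > 0" "\<kappa> > 0" "potential m \<kappa> x0 < C"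
  obtains r where "r > 0" "\<And>x. x \<in> ball x0 r \<Longrightarrow> potential m \<kappa> x < C"
proof -
  have "\<forall>\<^sub>F x in nhds x0. potential m \<kappa> x < C"
    using order_tendstoD(2)[OF isCont_potential[OF assms(1,2), unfolded isCont_def] assms(3)] assms(3)
    by (simp add: eventually_nhds_conv_at)
  then show thesis using that unfolding eventually_nhds_metric by (auto simp: dist_commute)
qed

lemma potential_greater_nhds:
  fixes x0 :: "('e::euclidean_space, 'n::{finite,linorder}) vec"
  assumes "\<And>i. m i > 0" "\<kappa> > 0" "C < potential m \<kappa> x0"
  obtains r where "r > 0" "\<And>x. x \<in> ball x0 r \<Longrightarrow> C < potential m \<kappa> x"
proof -
  have "\<forall>\<^sub>F x in nhds x0. C < potential m \<kappa> x"
    using order_tendstoD(1)[OF isCont_potential[OF assms(1,2), unfolded isCont_def] assms(3)] assms(3)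
    by (simp add: eventually_nhds_conv_at)
  then show thesis using that unfolding eventually_nhds_metric by (auto simp: dist_commute)
qed

lemma potential_le_separated:
  fixes x :: "('e::euclidean_space, 'n::{finite,linorder}) vec"
  assumes m: "\<And>i. m i > 0" and "\<kappa> > 0" "r > 0"
    and sep: "\<And>i j. i \<noteq> j \<Longrightarrow> r \<le> norm (x $ i - x $ j)"
  shows "potential m \<kappa> x \<le> ennreal ((\<Sum>(i, j) | i < j. m i * m j) * r powr (- 2 * \<kappa>))"
proof -
  have "potential m \<kappa> x \<le> (\<Sum>(i, j) | i < j. ennreal (m i * m j * r powr (- 2 * \<kappa>)))"
    unfolding potential_def
  proof (rule sum_mono, clarify)
    fix i j :: 'n assume "i < j"
    then have "r \<le> norm (x $ i - x $ j)" using sep by auto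
    then have "norm (x $ i - x $ j) powr (- 2 * \<kappa>) \<le> r powr (- 2 * \<kappa>)"
      using \<open>\<kappa> > 0\<close> \<open>r > 0\<close> by (intro powr_mono2') auto
    moreover have "x $ i \<noteq> x $ j" using \<open>r \<le> norm (x $ i - x $ j)\<close> \<open>r > 0\<close> by auto
    ultimately show "(if x $ i = x $ j then \<infinity> else ennreal (m i * m j * norm (x $ i - x $ j) powr (- 2 * \<kappa>)))
        \<le> ennreal (m i * m j * r powr (- 2 * \<kappa>))"
      using less_imp_le[OF m] by (auto intro!: ennreal_leI mult_left_mono)
  qed
  also have "\<dots> = ennreal (\<Sum>(i, j) | i < j. m i * m j * r powr (- 2 * \<kappa>))"
    unfolding case_prod_unfold by (rule sum_ennreal) (use less_imp_le[OF m] in auto)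
  finally show ?thesis by (simp add: sum_distrib_right case_prod_unfold)
qed

text \<open>Collisions of a given pair lie in a hyperplane: one coordinate of the difference of the
  two positions vanishes. There are finitely many pairs.\<close>

lemma negligible_collisions:
  "negligible {x :: ('e::euclidean_space, 'n::{finite,linorder}) vec. potential m \<kappa> x = \<infinity>}"
proof (rule negligible_subset)
  show "negligible (\<Union>(i, j)\<in>{(i, j). i < j}. {x :: ('e, 'n) vec. x $ i = x $ j})"
  proof (rule negligible_Union, clarsimp, clarsimp)
    fix i j :: 'n assume "i < j"
    obtain b :: 'e where b: "b \<in> Basis" using nonempty_Basis by blast
    have "(axis i b - axis j b) $ i \<noteq> 0" using \<open>i < j\<close> b by (auto simp: axis_def)
    then have "axis i b - axis j b \<noteq> 0" by (metis zero_index)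
    then have "negligible {x. (axis i b - axis j b) \<bullet> x = 0}" by (intro negligible_hyperplane) simp
    then show "negligible {x :: ('e, 'n) vec. x $ i = x $ j}"
      by (rule negligible_subset) (auto simp: inner_diff_left inner_axis')
  qed
  show "{x :: ('e, 'n) vec. potential m \<kappa> x = \<infinity>} \<subseteq> (\<Union>(i, j)\<in>{(i, j). i < j}. {x. x $ i = x $ j})"
  proof (clarify, rule ccontr)
    fix x :: "('e, 'n) vec" assume inf: "potential m \<kappa> x = \<infinity>" and "x \<notin> (\<Union>(i, j)\<in>{(i, j). i < j}. {x. x $ i = x $ j})"
    then have "x $ i \<noteq> x $ j" if "i < j" for i j using that by auto
    then have "potential m \<kappa> x < \<infinity>" unfolding potential_def by (auto simp: less_top[symmetric])
    then show False using inf by simp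
  qed
qed

subsection \<open>Action estimates along explicit curves\<close>

text \<open>Induction that removes the interval with the greatest left endpoint \<open>s0\<close>;
  the others end before \<open>s0\<close>. For this \<open>s < t\<close> is essential, since the
  open interior of a degenerate interval is empty and its disjointness carries no
  information.\<close>

lemma sum_increments_le:
  fixes G :: "real \<Rightarrow> real"
  assumes "finite D" "\<And>s t. (s, t) \<in> D \<Longrightarrow> a \<le> s \<and> s < t \<and> t \<le> b"
    and "pairwise (\<lambda>(s, t) (s', t'). {s<..<t} \<inter> {s'<..<t'} = {}) D"
    and "mono_on {a..b} G" "a \<le> b"
  shows "(\<Sum>(s, t)\<in>D. G t - G s) \<le> G b - G a"
  using assms
proof (induction "card D" arbitrary: D b)
  case 0
  then show ?case using mono_onD[of "{a..b}" G a b] by simp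
next
  case (Suc n)
  have ne: "fst ` D \<noteq> {}" "finite (fst ` D)" using Suc.hyps(2) Suc.prems(1) by auto
  obtain s0 t0 where st0: "(s0, t0) \<in> D" "s0 = Max (fst ` D)"
    using Max_in[OF ne(2,1)] by auto
  have b0: "a \<le> s0" "s0 < t0" "t0 \<le> b" using Suc.prems(2)[OF st0(1)] by auto
  let ?D = "D - {(s0, t0)}"
  have "(\<Sum>(s, t)\<in>?D. G t - G s) \<le> G s0 - G a"
  proof (rule Suc.hyps(1))
    show "n = card ?D" using Suc.hyps(2) st0(1) Suc.prems(1) by simp
    show "finite ?D" using Suc.prems(1) by simp
    show "pairwise (\<lambda>(s, t) (s', t'). {s<..<t} \<inter> {s'<..<t'} = {}) ?D"
      using Suc.prems(3) by (rule pairwise_subset) auto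
    show "mono_on {a..s0} G" using Suc.prems(4) by (rule mono_on_subset) (use b0 in auto)
    show "a \<le> s \<and> s < t \<and> t \<le> s0" if st: "(s, t) \<in> ?D" for s t
    proof -
      have "s \<le> s0" unfolding st0(2) using st ne(2) by (intro Max_ge) force+
      have disj: "{s<..<t} \<inter> {s0<..<t0} = {}"
        using Suc.prems(3) st st0(1) unfolding pairwise_def by fastforce
      have "t \<le> s0"
      proof (rule ccontr)
        assume "\<not> t \<le> s0"
        define p where "p = (s0 + min t t0) / 2"
        have "s < p" "p < t" "s0 < p" "p < t0"
          using \<open>s \<le> s0\<close> b0 \<open>\<not> t \<le> s0\<close> by (auto simp: p_def min_def)
        then have "p \<in> {s<..<t} \<inter> {s0<..<t0}" by simp
        then show False unfolding disj by simp
      qed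
      then show ?thesis using Suc.prems(2)[of s t] st by auto
    qed
  qed (use b0 in auto)
  moreover have "(\<Sum>(s, t)\<in>D. G t - G s) = (G t0 - G s0) + (\<Sum>(s, t)\<in>?D. G t - G s)"
    using sum.remove[OF Suc.prems(1) st0(1), of "\<lambda>(s, t). G t - G s"] by simp
  moreover have "G t0 \<le> G b" using mono_onD[OF Suc.prems(4), of t0 b] b0 by auto
  ultimately show ?case by simp
qed

lemma nonneg_derivative_imp_le:
  fixes G g :: "real \<Rightarrow> real"
  assumes "a \<le> b" "continuous_on {a..b} G"
    and "\<And>s. a < s \<Longrightarrow> s < b \<Longrightarrow> (G has_real_derivative g s) (at s)"
    and "\<And>s. a < s \<Longrightarrow> s < b \<Longrightarrow> 0 \<le> g s"
  shows "G a \<le> G b"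
  by (rule DERIV_nonneg_imp_increasing_open[OF assms(1) _ assms(2)]) (use assms(3,4) in blast)

text \<open>A curve of finite kinetic energy is absolutely continuous. Young's inequality bounds its
  speed by \<open>l / 2 * g s + 1 / (2 * l)\<close>, which is the derivative of an explicit
  function. Derivatives are required only inside the interval, so that the speed may blow up at a
  collision at the initial time.\<close>

lemma abs_continuous_curve_if_derivative_sq_le:
  fixes \<gamma> :: "real \<Rightarrow> 'a::real_normed_vector"
  assumes "0 \<le> T" and \<gamma>: "continuous_on {0..T} \<gamma>" and G: "continuous_on {0..T} G"
    and der: "\<And>s. 0 < s \<Longrightarrow> s < T \<Longrightarrow> (\<gamma> has_vector_derivative \<gamma>' s) (at s)"
      "\<And>s. 0 < s \<Longrightarrow> s < T \<Longrightarrow> (G has_real_derivative g s) (at s)"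
    and le: "\<And>s. 0 < s \<Longrightarrow> s < T \<Longrightarrow> (norm (\<gamma>' s))\<^sup>2 \<le> g s"
  shows "abs_continuous_curve 0 T \<gamma>"
  unfolding abs_continuous_curve_iff
proof (intro allI impI)
  fix e :: real assume "e > 0"
  have g0: "0 \<le> g s" if "0 < s" "s < T" for s using le[OF that] zero_le_power2[of "norm (\<gamma>' s)"] by linarith
  have mono: "mono_on {0..T} G"
  proof (rule mono_onI)
    fix r s assume rs: "r \<in> {0..T}" "s \<in> {0..T}" "r \<le> s"
    show "G r \<le> G s"
      by (rule nonneg_derivative_imp_le[OF rs(3), where g = g])
        (use rs der(2) g0 in \<open>auto intro!: continuous_on_subset[OF G]\<close>)
  qed
  define V where "V = G T - G 0"
  have "V \<ge> 0" using mono_onD[OF mono, of 0 T] \<open>0 \<le> T\<close> by (simp add: V_def)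
  \<comment> \<open>Chosen so that \<open>l / 2 * V\<close> is at most \<open>e/2\<close>; families
    shorter than \<open>l * e\<close> then contribute less than \<open>e/2\<close> through the
    second term.\<close>
  define l where "l = e / (V + 1)"
  have "l > 0" using \<open>e > 0\<close> \<open>V \<ge> 0\<close> by (simp add: l_def)
  have inc: "norm (\<gamma> t - \<gamma> s) \<le> (l / 2 * G t + t / (2 * l)) - (l / 2 * G s + s / (2 * l))"
    if st: "0 \<le> s" "s < t" "t \<le> T" for s t
  proof (rule differentiable_bound_general[OF st(2), where f' = \<gamma>' and \<phi>' = "\<lambda>r. l / 2 * g r + 1 / (2 * l)"])
    show "continuous_on {s..t} \<gamma>" "continuous_on {s..t} (\<lambda>t. l / 2 * G t + t / (2 * l))"
      using st \<open>l > 0\<close> by (auto intro!: continuous_intros continuous_on_subset[OF \<gamma>] continuous_on_subset[OF G])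
    fix r assume r: "s < r" "r < t"
    then have r': "0 < r" "r < T" using st by auto
    show "(\<gamma> has_vector_derivative \<gamma>' r) (at r)" by (rule der(1)[OF r'])
    have "((\<lambda>t. l / 2 * G t + t / (2 * l)) has_real_derivative l / 2 * g r + 1 / (2 * l)) (at r)"
      using \<open>l > 0\<close> by (auto intro!: derivative_eq_intros der(2)[OF r'])
    then show "((\<lambda>t. l / 2 * G t + t / (2 * l)) has_vector_derivative l / 2 * g r + 1 / (2 * l)) (at r)"
      by (simp add: has_real_derivative_iff_has_vector_derivative)
    have "0 \<le> (l * norm (\<gamma>' r) - 1)\<^sup>2" by simp
    then have "2 * l * norm (\<gamma>' r) \<le> l\<^sup>2 * (norm (\<gamma>' r))\<^sup>2 + 1" by (simp add: power2_eq_square algebra_simps)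
    also have "\<dots> \<le> l\<^sup>2 * g r + 1" using le[OF r'] by (simp add: mult_left_mono)
    finally show "norm (\<gamma>' r) \<le> l / 2 * g r + 1 / (2 * l)"
      using \<open>l > 0\<close> by (simp add: field_simps power2_eq_square)
  qed
  show "\<exists>d>0. \<forall>D. short_family 0 T d D \<longrightarrow> (\<Sum>(s, t)\<in>D. dist (\<gamma> s) (\<gamma> t)) < e"
  proof (intro exI[of _ "l * e"] conjI allI impI)
    fix D :: "(real \<times> real) set"
    assume "short_family 0 T (l * e) D"
    then have D: "finite D" "\<And>s t. (s, t) \<in> D \<Longrightarrow> 0 \<le> s \<and> s \<le> t \<and> t \<le> T"
      "pairwise (\<lambda>(s, t) (s', t'). {s<..<t} \<inter> {s'<..<t'} = {}) D" "(\<Sum>(s, t)\<in>D. t - s) < l * e"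
      by (auto simp: short_family_def)
    \<comment> \<open>Degenerate intervals contribute nothing to any of the sums, and
      \<open>sum_increments_le\<close> requires nondegenerate ones.\<close>
    define E where "E = {(s, t) \<in> D. s < t}"
    have E: "finite E" "E \<subseteq> D" "\<And>s t. (s, t) \<in> D - E \<Longrightarrow> s = t"
    proof -
      show "E \<subseteq> D" by (auto simp: E_def)
      then show "finite E" using D(1) by (rule finite_subset)
      show "s = t" if "(s, t) \<in> D - E" for s t using D(2)[of s t] that by (auto simp: E_def)
    qed
    have "(\<Sum>(s, t)\<in>D. dist (\<gamma> s) (\<gamma> t)) = (\<Sum>(s, t)\<in>E. dist (\<gamma> s) (\<gamma> t))"
      by (rule sum.mono_neutral_right[OF D(1) E(2)]) (use E(3) in force)
    also have "\<dots> \<le> (\<Sum>(s, t)\<in>E. l / 2 * (G t - G s) + 1 / (2 * l) * (t - s))"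
    proof (rule sum_mono, clarify)
      fix s t assume "(s, t) \<in> E"
      then have "0 \<le> s" "s < t" "t \<le> T" using D(2)[of s t] by (auto simp: E_def)
      then show "dist (\<gamma> s) (\<gamma> t) \<le> l / 2 * (G t - G s) + 1 / (2 * l) * (t - s)"
        using inc[of s t] by (simp add: dist_norm norm_minus_commute algebra_simps diff_divide_distrib)
    qed
    also have "\<dots> = l / 2 * (\<Sum>(s, t)\<in>E. G t - G s) + 1 / (2 * l) * (\<Sum>(s, t)\<in>E. t - s)"
      by (simp add: case_prod_unfold sum.distrib sum_distrib_left)
    also have "(\<Sum>(s, t)\<in>E. t - s) = (\<Sum>(s, t)\<in>D. t - s)"
      by (rule sum.mono_neutral_left[OF D(1) E(2)]) (use E(3) in force)
    also have "l / 2 * (\<Sum>(s, t)\<in>E. G t - G s) + 1 / (2 * l) * (\<Sum>(s, t)\<in>D. t - s) < l / 2 * V + 1 / (2 * l) * (l * e)"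
    proof (rule add_le_less_mono)
      have "(\<Sum>(s, t)\<in>E. G t - G s) \<le> V" unfolding V_def
        by (rule sum_increments_le[OF E(1) _ pairwise_subset[OF D(3) E(2)] mono \<open>0 \<le> T\<close>])
          (use D(2) in \<open>auto simp: E_def\<close>)
      then show "l / 2 * (\<Sum>(s, t)\<in>E. G t - G s) \<le> l / 2 * V" using \<open>l > 0\<close> by (intro mult_left_mono) auto
      show "1 / (2 * l) * (\<Sum>(s, t)\<in>D. t - s) < 1 / (2 * l) * (l * e)"
        using D(4) \<open>l > 0\<close> by (intro mult_strict_left_mono) auto
    qed
    also have "\<dots> \<le> e"
    proof -
      have "l * V \<le> e" using \<open>e > 0\<close> \<open>V \<ge> 0\<close> by (simp add: l_def field_simps)
      then show ?thesis using \<open>l > 0\<close> by simp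
    qed
    finally show "(\<Sum>(s, t)\<in>D. dist (\<gamma> s) (\<gamma> t)) < e" .
  qed (use \<open>l > 0\<close> \<open>e > 0\<close> in simp)
qed

text \<open>The bound \<open>g\<close> may be unbounded at an endpoint, like a negative power of
  \<open>s\<close> at 0; the fundamental theorem with interior derivatives covers this case. Setting
  \<open>h\<close> to 0 outside the open interval makes it nonnegative everywhere.\<close>

lemma nn_integral_le_increment:
  fixes G g :: "real \<Rightarrow> real"
  assumes "0 \<le> T" and G: "continuous_on {0..T} G"
    and der: "\<And>s. 0 < s \<Longrightarrow> s < T \<Longrightarrow> (G has_real_derivative g s) (at s)"
    and g0: "\<And>s. 0 < s \<Longrightarrow> s < T \<Longrightarrow> 0 \<le> g s"
    and le: "\<And>s. 0 < s \<Longrightarrow> s < T \<Longrightarrow> f s \<le> ennreal (g s)"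
  shows "(\<integral>\<^sup>+s\<in>{0..T}. f s \<partial>lebesgue) \<le> ennreal (G T - G 0)"
proof -
  define h where "h s = (if 0 < s \<and> s < T then g s else 0)" for s
  have "(h has_integral G T - G 0) {0..T}"
    using \<open>0 \<le> T\<close> G
    by (rule fundamental_theorem_of_calculus_interior)
      (use der in \<open>auto simp: h_def has_real_derivative_iff_has_vector_derivative\<close>)
  then have "(\<integral>\<^sup>+s. ennreal (h s) * indicator {0..T} s \<partial>lborel) = ennreal (G T - G 0)"
    by (rule nn_integral_has_integral_lebesgue'[rotated]) (auto simp: h_def g0)
  then have "(\<integral>\<^sup>+s\<in>{0..T}. ennreal (h s) \<partial>lebesgue) = ennreal (G T - G 0)"
    by (simp add: nn_integral_completion)
  moreover have "(\<integral>\<^sup>+s\<in>{0..T}. f s \<partial>lebesgue) \<le> (\<integral>\<^sup>+s\<in>{0..T}. ennreal (h s) \<partial>lebesgue)"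
  proof (rule nn_integral_mono_AE)
    have "AE s in lebesgue. s \<notin> {0, T}"
      by (rule AE_not_in) (simp add: negligible_iff_null_sets[symmetric] negligible_finite)
    then show "AE s in lebesgue. f s * indicator {0..T} s \<le> ennreal (h s) * indicator {0..T} s"
      by eventually_elim (use le in \<open>auto simp: h_def indicator_def\<close>)
  qed
  ultimately show ?thesis by simp
qed

lemma half_ennreal: "(1 / 2 :: ennreal) = ennreal (1 / 2)"
  using divide_ennreal[of 1 2] by simp

text \<open>The common interface for all explicit curves: \<open>G1\<close> and \<open>G2\<close>
  are antiderivatives of bounds for the kinetic and the potential part. Nothing is demanded of
  derivatives or of the potential at the two end times, where the curve may be at a
  collision.\<close>

lemma action_potential_le_curve:
  fixes \<gamma> :: "real \<Rightarrow> ('e::euclidean_space, 'n::{finite,linorder}) vec"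
  assumes m: "\<And>i. m i > 0" and "0 < T" and \<gamma>: "continuous_on {0..T} \<gamma>"
    and \<gamma>': "\<And>s. 0 < s \<Longrightarrow> s < T \<Longrightarrow> (\<gamma> has_vector_derivative \<gamma>' s) (at s)"
    and G1: "continuous_on {0..T} G1" "\<And>s. 0 < s \<Longrightarrow> s < T \<Longrightarrow> (G1 has_real_derivative g1 s) (at s)"
    and G2: "continuous_on {0..T} G2" "\<And>s. 0 < s \<Longrightarrow> s < T \<Longrightarrow> (G2 has_real_derivative g2 s) (at s)"
    and kin: "\<And>s. 0 < s \<Longrightarrow> s < T \<Longrightarrow> mass_norm_sq m (\<gamma>' s) / 2 \<le> g1 s"
    and pot: "\<And>s. 0 < s \<Longrightarrow> s < T \<Longrightarrow> potential m \<kappa> (\<gamma> s) \<le> ennreal (g2 s)"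
    and g2: "\<And>s. 0 < s \<Longrightarrow> s < T \<Longrightarrow> 0 \<le> g2 s"
  shows "action_potential m \<kappa> (\<gamma> 0) (\<gamma> T) \<le> ennreal ((G1 T - G1 0) + (G2 T - G2 0))"
proof -
  obtain c where "c > 0" and c: "\<And>v :: ('e, 'n) vec. c * (norm v)\<^sup>2 \<le> mass_norm_sq m v"
    using mass_norm_sq_ge[of m, OF m] by blast
  \<comment> \<open>The constant \<open>c\<close> compares the library norm with the mass norm, and
    the 2 undoes the half in the kinetic energy.\<close>
  have ac: "abs_continuous_curve 0 T \<gamma>"
  proof (rule abs_continuous_curve_if_derivative_sq_le[where G = "\<lambda>s. 2 / c * G1 s" and g = "\<lambda>s. 2 / c * g1 s" and \<gamma>' = \<gamma>'])
    fix s assume s: "0 < s" "s < T"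
    show "(norm (\<gamma>' s))\<^sup>2 \<le> 2 / c * g1 s"
      using c[of "\<gamma>' s"] kin[OF s] \<open>c > 0\<close> by (simp add: field_simps)
    show "((\<lambda>s. 2 / c * G1 s) has_real_derivative 2 / c * g1 s) (at s)"
      using G1(2)[OF s] by (rule DERIV_cmult)
  qed (use \<open>0 < T\<close> \<open>c > 0\<close> \<gamma> \<gamma>' G1(1) in \<open>auto intro!: continuous_intros\<close>)
  have g1: "0 \<le> g1 s" if "0 < s" "s < T" for s
    using kin[OF that] mass_norm_sq_nonneg[of m "\<gamma>' s"] m by simp
  have i1: "(\<integral>\<^sup>+s\<in>{0..T}. ennreal (mass_norm_sq m (vector_derivative \<gamma> (at s within {0..T}))) \<partial>lebesgue)
      \<le> ennreal (2 * G1 T - 2 * G1 0)"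
  proof (rule nn_integral_le_increment[where G = "\<lambda>s. 2 * G1 s" and g = "\<lambda>s. 2 * g1 s"])
    fix s assume s: "0 < s" "s < T"
    have "at s within {0..T} = at s" using s by (intro at_within_interior) auto
    then have "vector_derivative \<gamma> (at s within {0..T}) = \<gamma>' s"
      using vector_derivative_at[OF \<gamma>'[OF s]] by simp
    then show "ennreal (mass_norm_sq m (vector_derivative \<gamma> (at s within {0..T}))) \<le> ennreal (2 * g1 s)"
      using kin[OF s] by (auto intro!: ennreal_leI)
    show "((\<lambda>s. 2 * G1 s) has_real_derivative 2 * g1 s) (at s)" using G1(2)[OF s] by (rule DERIV_cmult)
    show "0 \<le> 2 * g1 s" using g1[OF s] by simp
  qed (use \<open>0 < T\<close> G1(1) in \<open>auto intro!: continuous_intros\<close>)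
  have i2: "(\<integral>\<^sup>+s\<in>{0..T}. potential m \<kappa> (\<gamma> s) \<partial>lebesgue) \<le> ennreal (G2 T - G2 0)"
    by (rule nn_integral_le_increment[OF _ G2 g2 pot]) (use \<open>0 < T\<close> in auto)
  have mono: "G1 0 \<le> G1 T" "G2 0 \<le> G2 T"
    using nonneg_derivative_imp_le[OF less_imp_le[OF \<open>0 < T\<close>] G1 g1]
      nonneg_derivative_imp_le[OF less_imp_le[OF \<open>0 < T\<close>] G2 g2] by auto
  have "action_potential m \<kappa> (\<gamma> 0) (\<gamma> T) \<le> min_action m \<kappa> (\<gamma> 0) (\<gamma> T) T"
    unfolding action_potential_def using \<open>0 < T\<close> by (intro INF_lower) auto
  also have "\<dots> \<le> action m \<kappa> 0 T \<gamma>"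
    unfolding min_action_def using ac by (intro INF_lower) (auto simp: curves_def)
  also have "\<dots> \<le> ennreal (1 / 2) * ennreal (2 * G1 T - 2 * G1 0) + ennreal (G2 T - G2 0)"
    unfolding action_def half_ennreal using i1 i2 by (intro add_mono mult_left_mono) auto
  also have "\<dots> = ennreal ((G1 T - G1 0) + (G2 T - G2 0))"
  proof -
    have "1 / 2 * (2 * G1 T - 2 * G1 0) = G1 T - G1 0" by simp
    then have "ennreal (1 / 2) * ennreal (2 * G1 T - 2 * G1 0) = ennreal (G1 T - G1 0)"
      using mono by (subst ennreal_mult[symmetric]) auto
    then show ?thesis using mono by (simp only: ennreal_plus diff_ge_0_iff_ge)
  qed
  finally show ?thesis .
qed

section \<open>Increments of dominated functions along curves\<close>

lemma dominatedD:
  assumes "dominated m \<kappa> u" "action_potential m \<kappa> x y \<le> ennreal B" "0 \<le> B"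
  shows "u x - u y \<le> B"
proof -
  have "ereal (u x - u y) \<le> enn2ereal (action_potential m \<kappa> x y)"
    using assms(1) by (simp add: dominated_def)
  also have "\<dots> \<le> enn2ereal (ennreal B)" using assms(2) by (simp add: less_eq_ennreal.rep_eq)
  finally show ?thesis using assms(3) by (simp add: enn2ereal_ennreal)
qed

text \<open>Domination bounds one sign of the increment. Running the curve backwards preserves the
  bounds and exchanges its ends, which bounds the other sign.\<close>

lemma dominated_curve_le:
  fixes \<gamma> :: "real \<Rightarrow> ('e::euclidean_space, 'n::{finite,linorder}) vec"
  assumes u: "dominated m \<kappa> u" and m: "\<And>i. m i > 0" and T: "0 < T" and \<gamma>: "continuous_on {0..T} \<gamma>"
    and \<gamma>': "\<And>s. 0 < s \<Longrightarrow> s < T \<Longrightarrow> (\<gamma> has_vector_derivative \<gamma>' s) (at s)"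
    and G1: "continuous_on {0..T} G1" "\<And>s. 0 < s \<Longrightarrow> s < T \<Longrightarrow> (G1 has_real_derivative g1 s) (at s)"
    and G2: "continuous_on {0..T} G2" "\<And>s. 0 < s \<Longrightarrow> s < T \<Longrightarrow> (G2 has_real_derivative g2 s) (at s)"
    and kin: "\<And>s. 0 < s \<Longrightarrow> s < T \<Longrightarrow> mass_norm_sq m (\<gamma>' s) / 2 \<le> g1 s"
    and pot: "\<And>s. 0 < s \<Longrightarrow> s < T \<Longrightarrow> potential m \<kappa> (\<gamma> s) \<le> ennreal (g2 s)"
    and g2: "\<And>s. 0 < s \<Longrightarrow> s < T \<Longrightarrow> 0 \<le> g2 s"
  shows "\<bar>u (\<gamma> 0) - u (\<gamma> T)\<bar> \<le> (G1 T - G1 0) + (G2 T - G2 0)"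
proof -
  have g1: "0 \<le> g1 s" if "0 < s" "s < T" for s
    using kin[OF that] mass_norm_sq_nonneg[of m "\<gamma>' s"] m by simp
  have "G1 0 \<le> G1 T" "G2 0 \<le> G2 T"
    using nonneg_derivative_imp_le[OF less_imp_le[OF T] G1 g1]
      nonneg_derivative_imp_le[OF less_imp_le[OF T] G2 g2] by auto
  then have B: "0 \<le> (G1 T - G1 0) + (G2 T - G2 0)" by simp
  have 1: "u (\<gamma> 0) - u (\<gamma> T) \<le> (G1 T - G1 0) + (G2 T - G2 0)"
    by (rule dominatedD[OF u action_potential_le_curve[OF m T \<gamma> \<gamma>' G1 G2 kin pot g2] B])
  have cont: "continuous_on {0..T} (\<lambda>s. F (T - s))" if "continuous_on {0..T} F" for F :: "real \<Rightarrow> 'x::topological_space"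
    by (rule continuous_on_compose2[OF that]) (auto intro!: continuous_intros)
  have "action_potential m \<kappa> (\<gamma> (T - 0)) (\<gamma> (T - T)) \<le> ennreal ((- G1 (T - T) - - G1 (T - 0)) + (- G2 (T - T) - - G2 (T - 0)))"
  proof (rule action_potential_le_curve[OF m T, where \<gamma>' = "\<lambda>s. - \<gamma>' (T - s)" and ?g1.0 = "\<lambda>s. g1 (T - s)" and ?g2.0 = "\<lambda>s. g2 (T - s)"])
    fix s assume s: "0 < s" "s < T"
    then have Ts: "0 < T - s" "T - s < T" by auto
    have d: "((\<lambda>s. T - s) has_real_derivative - 1) (at s)" by (auto intro!: derivative_eq_intros)
    show "((\<lambda>s. \<gamma> (T - s)) has_vector_derivative - \<gamma>' (T - s)) (at s)"
      using vector_diff_chain_at[OF d[unfolded has_real_derivative_iff_has_vector_derivative] \<gamma>'[OF Ts]]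
      by (simp add: o_def)
    show "((\<lambda>s. - G1 (T - s)) has_real_derivative g1 (T - s)) (at s)"
      using DERIV_minus[OF DERIV_chain2[OF G1(2)[OF Ts] d]] by simp
    show "((\<lambda>s. - G2 (T - s)) has_real_derivative g2 (T - s)) (at s)"
      using DERIV_minus[OF DERIV_chain2[OF G2(2)[OF Ts] d]] by simp
    show "mass_norm_sq m (- \<gamma>' (T - s)) / 2 \<le> g1 (T - s)"
      using kin[OF Ts] mass_norm_sq_scaleR[of m "- 1" "\<gamma>' (T - s)"] by simp
    show "potential m \<kappa> (\<gamma> (T - s)) \<le> ennreal (g2 (T - s))" "0 \<le> g2 (T - s)"
      using pot[OF Ts] g2[OF Ts] by auto
  qed (intro continuous_on_minus cont \<gamma> G1(1) G2(1))+
  then have "u (\<gamma> T) - u (\<gamma> 0) \<le> (G1 T - G1 0) + (G2 T - G2 0)"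
    using B by (intro dominatedD[OF u]) auto
  then show ?thesis using 1 by linarith
qed

text \<open>At unit speed in the library norm the squared mass norm of the velocity is at most the
  total mass, so the Lagrangian along a segment is at most half the total mass plus
  \<open>C\<close>, and time equals length.\<close>

lemma dominated_lipschitz_on_convex:
  fixes u :: "('e::euclidean_space, 'n::{finite,linorder}) vec \<Rightarrow> real"
  assumes u: "dominated m \<kappa> u" and m: "\<And>i. m i > 0" and S: "convex S" and "0 \<le> C"
    and pot: "\<And>x. x \<in> S \<Longrightarrow> potential m \<kappa> x \<le> ennreal C"
  shows "((\<Sum>i\<in>UNIV. m i) / 2 + C)-lipschitz_on S u"
proof (rule lipschitz_onI)
  let ?M = "\<Sum>i\<in>UNIV. m i"
  have M: "0 \<le> ?M" using less_imp_le[OF m] by (intro sum_nonneg) auto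
  then show "0 \<le> ?M / 2 + C" using \<open>0 \<le> C\<close> by simp
  fix a b assume ab: "a \<in> S" "b \<in> S"
  show "dist (u a) (u b) \<le> (?M / 2 + C) * dist a b"
  proof (cases "a = b")
    case False
    define T where "T = norm (b - a)"
    have "T > 0" using False by (simp add: T_def)
    define v where "v = (1 / T) *\<^sub>R (b - a)"
    have v1: "norm v = 1" using \<open>T > 0\<close> by (simp add: v_def T_def[symmetric])
    have end_: "a + T *\<^sub>R v = b" using \<open>T > 0\<close> by (simp add: v_def)
    have "\<bar>u (a + 0 *\<^sub>R v) - u (a + T *\<^sub>R v)\<bar> \<le> (?M / 2 * T - ?M / 2 * 0) + (C * T - C * 0)"
    proof (rule dominated_curve_le[OF u m \<open>T > 0\<close>, where \<gamma>' = "\<lambda>_. v" and ?g1.0 = "\<lambda>_. ?M / 2" and ?g2.0 = "\<lambda>_. C"])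
      fix s assume s: "0 < s" "s < T"
      show "((\<lambda>s. a + s *\<^sub>R v) has_vector_derivative v) (at s)"
        by (auto intro!: derivative_eq_intros)
      show "((\<lambda>s. ?M / 2 * s) has_real_derivative ?M / 2) (at s)"
        by (auto intro!: derivative_eq_intros)
      show "((\<lambda>s. C * s) has_real_derivative C) (at s)"
        by (auto intro!: derivative_eq_intros)
      show "mass_norm_sq m v / 2 \<le> ?M / 2"
        using mass_norm_sq_le[of m v] m v1 by simp
      have "a + s *\<^sub>R v = (1 - s / T) *\<^sub>R a + (s / T) *\<^sub>R b"
        using \<open>T > 0\<close> by (simp add: v_def algebra_simps)
      then have "a + s *\<^sub>R v \<in> S" using convexD_alt[OF S ab, of "s / T"] s by simp
      then show "potential m \<kappa> (a + s *\<^sub>R v) \<le> ennreal C" by (rule pot)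
    qed (use \<open>0 \<le> C\<close> in \<open>auto intro!: continuous_intros\<close>)
    then show ?thesis using end_
      by (simp add: dist_real_def dist_norm T_def norm_minus_commute algebra_simps)
  qed simp
qed

lemma dominated_differentiable_AE:
  fixes u :: "('e::euclidean_space, 'n::{finite,linorder}) vec \<Rightarrow> real"
  assumes u: "dominated m \<kappa> u" and m: "\<And>i. m i > 0" and \<kappa>: "0 < \<kappa>"
  shows "AE x in lebesgue. u differentiable (at x)"
proof -
  define G :: "('e, 'n) vec set" where "G = {x. potential m \<kappa> x < \<infinity>}"
  have loc: "\<exists>r>0. ball x r \<subseteq> G \<and> (\<exists>L. L-lipschitz_on (ball x r) u)" if x: "x \<in> G" for x
  proof -
    obtain C where C: "potential m \<kappa> x < ennreal C" "0 \<le> C"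
    proof -
      have "potential m \<kappa> x < top" using x by (simp add: G_def)
      then obtain c where c: "potential m \<kappa> x < c" "c < top" using dense by blast
      then show thesis using that[of "enn2real c"] by simp
    qed
    obtain r where r: "r > 0" "\<And>y. y \<in> ball x r \<Longrightarrow> potential m \<kappa> y < ennreal C"
      using potential_less_nhds[of m \<kappa> x "ennreal C", OF m \<kappa> C(1)] by blast
    then have "ball x r \<subseteq> G" unfolding G_def using less_trans[OF r(2) ennreal_less_top] by auto
    moreover have "((\<Sum>i\<in>UNIV. m i) / 2 + C)-lipschitz_on (ball x r) u"
      by (rule dominated_lipschitz_on_convex[OF u m convex_ball C(2)]) (use r(2) less_imp_le in blast)
    ultimately show ?thesis using r(1) by blast
  qed
  have "open G" unfolding open_contains_ball using loc by blast
  then have "negligible {x \<in> G. \<not> u differentiable (at x)}"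
    by (rule rademacher_local) (use loc in blast)
  then have "negligible ({x \<in> G. \<not> u differentiable (at x)} \<union> {x. potential m \<kappa> x = \<infinity>})"
    using negligible_collisions by (rule negligible_Un)
  then have "negligible {x. \<not> u differentiable (at x)}"
    by (rule negligible_subset) (auto simp: G_def less_top[symmetric])
  then show ?thesis using AE_if_negligible by fastforce
qed

text \<open>The vector \<open>v\<close> is the gradient of \<psi> for the mass metric, so
  \<open>p v\<close> and the squared mass norm of \<open>v\<close> both equal \<open>P\<close>.
  Along \<open>x0 - t *\<^sub>R v\<close> the function \<psi>, and at a maximum therefore
  \<open>u\<close>, drops by at least \<open>t * P\<close> to first order, while domination allows
  at most \<open>t * (P / 2 + U + e)\<close>.\<close>

lemma dominated_subsolution:
  fixes u :: "('e::euclidean_space, 'n::{finite,linorder}) vec \<Rightarrow> real"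
  assumes u: "dominated m \<kappa> u" and m: "\<And>i. m i > 0" and \<kappa>: "0 < \<kappa>"
  shows "viscosity_subsolution_at m \<kappa> u x0"
  unfolding viscosity_subsolution_at_def
proof (intro allI impI, elim conjE)
  fix \<psi> :: "('e, 'n) vec \<Rightarrow> real"
  assume C1: "C1_function \<psi>" and max: "\<forall>x. u x - \<psi> x \<le> u x0 - \<psi> x0"
  define p where "p = frechet_derivative \<psi> (at x0)"
  have p: "(\<psi> has_derivative p) (at x0)"
    using C1 unfolding C1_function_def p_def by (metis differentiableI frechet_derivative_works)
  define q where "q = covector_components p"
  have pq: "p v = (\<Sum>i\<in>UNIV. (q $ i) \<bullet> (v $ i))" for v
    unfolding q_def by (rule covector_components[OF has_derivative_linear[OF p]])
  define P where "P = dual_norm_sq m p"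
  define v where "v = (\<chi> i. inverse (m i) *\<^sub>R q $ i)"
  have pv: "p v = P"
    unfolding pq P_def dual_norm_sq_def q_def[symmetric] v_def by (simp add: power2_norm_eq_inner)
  have mv: "mass_norm_sq m v = P"
    unfolding P_def dual_norm_sq_def q_def[symmetric] v_def mass_norm_sq_def
  proof (rule sum.cong[OF refl])
    fix i
    show "m i * (norm ((\<chi> i. inverse (m i) *\<^sub>R q $ i) $ i))\<^sup>2 = inverse (m i) * (norm (q $ i))\<^sup>2"
      using m[of i] by (simp add: power_mult_distrib power2_eq_square field_simps)
  qed
  show "ennreal (dual_norm_sq m (frechet_derivative \<psi> (at x0))) \<le> 2 * potential m \<kappa> x0"
  proof (cases "potential m \<kappa> x0 = \<infinity>")
    case False
    then obtain U where U: "potential m \<kappa> x0 = ennreal U" "U \<ge> 0" by (cases "potential m \<kappa> x0") auto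
    have "P / 2 \<le> U"
    proof (rule field_le_epsilon)
      fix e :: real assume "e > 0"
      obtain r where r: "r > 0" "\<And>y. y \<in> ball x0 r \<Longrightarrow> potential m \<kappa> y < ennreal (U + e)"
        using potential_less_nhds[of m \<kappa> x0 "ennreal (U + e)", OF m \<kappa>] U \<open>e > 0\<close>
        by (auto simp: ennreal_less_iff)
      \<comment> \<open>Domination and the maximum give \<open>f 0 \<le> f t\<close> for small
        positive \<open>t\<close>, whereas \<open>P / 2 > U + e\<close> would make the derivative of
        \<open>f\<close> at 0 negative.\<close>
      define f where "f t = \<psi> (x0 - t *\<^sub>R v) + t * (P / 2 + (U + e))" for t
      have line: "((\<lambda>t. x0 - t *\<^sub>R v) has_derivative (\<lambda>t. - (t *\<^sub>R v))) (at 0)"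
        by (auto intro!: derivative_eq_intros)
      have "((\<lambda>t. \<psi> (x0 - t *\<^sub>R v)) has_derivative (\<lambda>t. p (- (t *\<^sub>R v)))) (at 0)"
        by (rule has_derivative_compose[OF line]) (use p in simp)
      moreover have "(\<lambda>t. p (- (t *\<^sub>R v))) = (*) (- P)"
        using linear_neg[OF has_derivative_linear[OF p]] linear_cmul[OF has_derivative_linear[OF p]] pv
        by (simp add: fun_eq_iff)
      ultimately have "((\<lambda>t. \<psi> (x0 - t *\<^sub>R v)) has_real_derivative - P) (at 0)"
        unfolding has_field_derivative_def by (simp only:)
      then have df: "(f has_real_derivative (- P + (P / 2 + (U + e)))) (at 0)"
        unfolding f_def by (auto intro!: derivative_eq_intros)
      show "P / 2 \<le> U + e"
      proof (rule ccontr)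
        assume "\<not> P / 2 \<le> U + e"
        then obtain d where d: "d > 0" "\<And>h. 0 < h \<Longrightarrow> h < d \<Longrightarrow> f (0 + h) < f 0"
          using DERIV_neg_dec_right[OF df] by auto
        \<comment> \<open>Short enough for the decrease of \<open>f\<close> and for the segment to
          stay in the ball of radius \<open>r\<close>; \<open>norm v + 1\<close> avoids dividing by
          0.\<close>
        define t where "t = min (d / 2) (r / (2 * (norm v + 1)))"
        have "norm v + 1 > 0" using norm_ge_zero[of v] by linarith
        then have "t > 0" "t < d" using d(1) r(1) by (auto simp: t_def)
        have small: "s * norm v < r" if "0 < s" "s < t" for s
        proof -
          have "s * norm v \<le> s * (norm v + 1)" using that by simp
          also have "\<dots> \<le> r / (2 * (norm v + 1)) * (norm v + 1)"
            using that \<open>norm v + 1 > 0\<close> by (intro mult_right_mono) (auto simp: t_def)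
          also have "\<dots> < r" using \<open>norm v + 1 > 0\<close> r(1) by (simp add: field_simps add_pos_nonneg)
          finally show ?thesis .
        qed
        have "\<bar>u (x0 - 0 *\<^sub>R v) - u (x0 - t *\<^sub>R v)\<bar> \<le> (P / 2 * t - P / 2 * 0) + ((U + e) * t - (U + e) * 0)"
        proof (rule dominated_curve_le[OF u m \<open>t > 0\<close>, where \<gamma>' = "\<lambda>_. - v" and ?g1.0 = "\<lambda>_. P / 2" and ?g2.0 = "\<lambda>_. U + e"])
          fix s assume s: "0 < s" "s < t"
          show "((\<lambda>s. x0 - s *\<^sub>R v) has_vector_derivative - v) (at s)"
            by (auto intro!: derivative_eq_intros)
          show "((\<lambda>s. P / 2 * s) has_real_derivative P / 2) (at s)" by (auto intro!: derivative_eq_intros)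
          show "((\<lambda>s. (U + e) * s) has_real_derivative U + e) (at s)" by (auto intro!: derivative_eq_intros)
          show "mass_norm_sq m (- v) / 2 \<le> P / 2" using mv mass_norm_sq_scaleR[of m "- 1" v] by simp
          show "potential m \<kappa> (x0 - s *\<^sub>R v) \<le> ennreal (U + e)"
            using r(2)[of "x0 - s *\<^sub>R v"] small[OF s] s by (auto simp: dist_norm intro: less_imp_le)
        qed (use U \<open>e > 0\<close> in \<open>auto intro!: continuous_intros\<close>)
        then have "u x0 - u (x0 - t *\<^sub>R v) \<le> t * (P / 2 + (U + e))" by (simp add: algebra_simps)
        moreover have "u (x0 - t *\<^sub>R v) - \<psi> (x0 - t *\<^sub>R v) \<le> u x0 - \<psi> x0" using max by blast
        ultimately have "f 0 \<le> f t" by (simp add: f_def)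
        then show False using d(2)[OF \<open>t > 0\<close> \<open>t < d\<close>] by simp
      qed
    qed
    then have "ennreal P \<le> ennreal (2 * U)" by (intro ennreal_leI) simp
    also have "\<dots> = 2 * potential m \<kappa> x0" using U by (simp add: ennreal_mult)
    finally show ?thesis by (simp add: P_def p_def)
  qed (simp add: ennreal_mult_top)
qed

subsection \<open>Continuity and growth of dominated functions\<close>

text \<open>Real values instead of a permutation, so that they serve directly as positions on a
  line; separation by 1 turns the scale factor of an ejection into a lower bound for the
  gaps.\<close>

definition ranking :: "('n::finite \<Rightarrow> real) \<Rightarrow> bool" where
  "ranking \<sigma> \<longleftrightarrow> (\<forall>i j. i \<noteq> j \<longrightarrow> 1 \<le> \<bar>\<sigma> i - \<sigma> j\<bar>) \<and> (\<forall>i. 0 \<le> \<sigma> i \<and> \<sigma> i \<le> real CARD('n))"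

definition ordered_gap :: "'e::euclidean_space \<Rightarrow> ('n::finite \<Rightarrow> real) \<Rightarrow> real \<Rightarrow> ('e ^ 'n) set" where
  "ordered_gap w \<sigma> r = {x. \<forall>i j. \<sigma> i < \<sigma> j \<longrightarrow> w \<bullet> x $ i + r \<le> w \<bullet> x $ j}"

definition spread :: "'e::euclidean_space \<Rightarrow> ('n::finite \<Rightarrow> real) \<Rightarrow> 'e ^ 'n" where
  "spread w \<sigma> = (\<chi> i. \<sigma> i *\<^sub>R w)"

text \<open>Each index is ranked by the number of its predecessors when the bodies are sorted by
  their projection to \<open>w\<close>. Breaking ties by the order of the index type makes the
  comparison total, as is needed at collisions.\<close>

lemma ex_ranking:
  fixes x :: "'e::euclidean_space ^ 'n::{finite,linorder}"
  obtains \<sigma> where "ranking \<sigma>" "x \<in> ordered_gap w \<sigma> 0"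
proof -
  define R where "R j i \<longleftrightarrow> w \<bullet> x $ j < w \<bullet> x $ i \<or> (w \<bullet> x $ j = w \<bullet> x $ i \<and> j < i)" for i j
  define \<sigma> where "\<sigma> i = real (card {j. R j i})" for i
  have less: "\<sigma> j + 1 \<le> \<sigma> i" if "R j i" for i j
  proof -
    have "{k. R k j} \<subset> {k. R k i}" using that unfolding R_def by fastforce
    then have "card {k. R k j} < card {k. R k i}" by (intro psubset_card_mono) auto
    then show ?thesis by (simp add: \<sigma>_def)
  qed
  have total: "R i j \<or> R j i" if "i \<noteq> j" for i j using that unfolding R_def by auto
  show thesis
  proof
    have "1 \<le> \<bar>\<sigma> i - \<sigma> j\<bar>" if "i \<noteq> j" for i j using total[OF that] less[of i j] less[of j i] by auto
    moreover have "0 \<le> \<sigma> i \<and> \<sigma> i \<le> real CARD('n)" for i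
      unfolding \<sigma>_def by (auto intro: card_mono)
    ultimately show "ranking \<sigma>" by (simp add: ranking_def)
    have "w \<bullet> x $ i \<le> w \<bullet> x $ j" if "\<sigma> i < \<sigma> j" for i j
    proof -
      have "\<not> R j i" using less[of j i] that by auto
      then show ?thesis unfolding R_def by linarith
    qed
    then show "x \<in> ordered_gap w \<sigma> 0" by (simp add: ordered_gap_def)
  qed
qed

text \<open>Strict inequalities between projections of \<open>x0\<close> persist nearby, so an order
  compatible with a nearby \<open>y\<close> cannot violate one of them. The converse fails: ties of
  \<open>x0\<close> may be resolved differently by \<open>y\<close>.\<close>

lemma ordered_gap_nhds:
  fixes x0 :: "'e::euclidean_space ^ 'n::finite"
  obtains r where "r > 0" "\<And>y \<sigma>. y \<in> ball x0 r \<Longrightarrow> y \<in> ordered_gap w \<sigma> 0 \<Longrightarrow> x0 \<in> ordered_gap w \<sigma> 0"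
proof -
  have "\<forall>\<^sub>F y in nhds x0. w \<bullet> x0 $ j < w \<bullet> x0 $ i \<longrightarrow> w \<bullet> y $ j < w \<bullet> y $ i" for i j
  proof (cases "w \<bullet> x0 $ j < w \<bullet> x0 $ i")
    case True
    have "((\<lambda>y. w \<bullet> y $ i - w \<bullet> y $ j) \<longlongrightarrow> w \<bullet> x0 $ i - w \<bullet> x0 $ j) (nhds x0)"
      by (intro tendsto_intros filterlim_ident)
    from order_tendstoD(1)[OF this, of 0] True show ?thesis by (auto elim: eventually_mono)
  qed simp
  then have "\<forall>\<^sub>F y in nhds x0. \<forall>i j. w \<bullet> x0 $ j < w \<bullet> x0 $ i \<longrightarrow> w \<bullet> y $ j < w \<bullet> y $ i"
    by (intro eventually_all_finite)
  then obtain r where "r > 0" and r: "\<And>y i j. dist y x0 < r \<Longrightarrow> w \<bullet> x0 $ j < w \<bullet> x0 $ i \<Longrightarrow> w \<bullet> y $ j < w \<bullet> y $ i"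
    unfolding eventually_nhds_metric by blast
  show thesis
  proof (rule that[OF \<open>r > 0\<close>])
    fix y \<sigma> assume y: "y \<in> ball x0 r" "y \<in> ordered_gap w \<sigma> 0"
    show "x0 \<in> ordered_gap w \<sigma> 0"
      unfolding ordered_gap_def
    proof (clarsimp, rule ccontr)
      fix i j assume ij: "\<sigma> i < \<sigma> j" "\<not> w \<bullet> x0 $ i \<le> w \<bullet> x0 $ j"
      then have "w \<bullet> y $ j < w \<bullet> y $ i" using r[of y j i] y(1) by (simp add: dist_commute)
      moreover have "w \<bullet> y $ i \<le> w \<bullet> y $ j" using y(2) ij(1) by (simp add: ordered_gap_def)
      ultimately show False by simp
    qed
  qed
qed

lemma convex_ordered_gap: "convex (ordered_gap w \<sigma> r)"
proof (rule convexI)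
  fix x y u v assume xy: "x \<in> ordered_gap w \<sigma> r" "y \<in> ordered_gap w \<sigma> r" and uv: "0 \<le> u" "0 \<le> v" "u + v = (1::real)"
  have "w \<bullet> (u *\<^sub>R x + v *\<^sub>R y) $ i + r \<le> w \<bullet> (u *\<^sub>R x + v *\<^sub>R y) $ j" if "\<sigma> i < \<sigma> j" for i j
  proof -
    have "u * (w \<bullet> x $ i + r) + v * (w \<bullet> y $ i + r) \<le> u * (w \<bullet> x $ j) + v * (w \<bullet> y $ j)"
      using xy that uv unfolding ordered_gap_def by (intro add_mono mult_left_mono) auto
    moreover have "u * r + v * r = r" using uv(3) by (simp add: distrib_right[symmetric])
    ultimately show ?thesis by (simp add: inner_add_right distrib_left)
  qed
  then show "u *\<^sub>R x + v *\<^sub>R y \<in> ordered_gap w \<sigma> r" by (simp add: ordered_gap_def)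
qed

lemma add_spread_in_ordered_gap:
  assumes "ranking \<sigma>" "norm w = 1" "x \<in> ordered_gap w \<sigma> 0" "0 \<le> r"
  shows "x + r *\<^sub>R spread w \<sigma> \<in> ordered_gap w \<sigma> r"
proof -
  have "w \<bullet> (x + r *\<^sub>R spread w \<sigma>) $ i + r \<le> w \<bullet> (x + r *\<^sub>R spread w \<sigma>) $ j" if ij: "\<sigma> i < \<sigma> j" for i j
  proof -
    have "w \<bullet> w = 1" using assms(2) by (simp add: norm_eq_1)
    have "i \<noteq> j" using ij by auto
    then have "\<sigma> i + 1 \<le> \<sigma> j" using assms(1) ij unfolding ranking_def by fastforce
    then have "r * (\<sigma> i + 1) \<le> r * \<sigma> j" using assms(4) by (intro mult_left_mono)
    moreover have "w \<bullet> x $ i \<le> w \<bullet> x $ j" using assms(3) ij by (simp add: ordered_gap_def)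
    ultimately show ?thesis using \<open>w \<bullet> w = 1\<close> by (simp add: spread_def inner_add_right distrib_left)
  qed
  then show ?thesis by (simp add: ordered_gap_def)
qed

lemma ordered_gap_separated:
  assumes "ranking \<sigma>" "norm w = 1" "x \<in> ordered_gap w \<sigma> r" "i \<noteq> j"
  shows "r \<le> norm (x $ i - x $ j)"
proof -
  have "\<sigma> i < \<sigma> j \<or> \<sigma> j < \<sigma> i" using assms(1,4) unfolding ranking_def by fastforce
  then have "r \<le> \<bar>w \<bullet> (x $ i - x $ j)\<bar>"
    using assms(3) unfolding ordered_gap_def by (fastforce simp: inner_diff_right)
  also have "\<dots> \<le> norm (x $ i - x $ j)" using Cauchy_Schwarz_ineq2[of w "x $ i - x $ j"] assms(2) by simp
  finally show ?thesis .
qed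

lemma mass_norm_sq_spread_le:
  fixes \<sigma> :: "'n::finite \<Rightarrow> real"
  assumes "ranking \<sigma>" "norm w = 1" "\<And>i. m i > 0"
  shows "mass_norm_sq m (spread w \<sigma>) \<le> (\<Sum>i\<in>UNIV. m i) * (real CARD('n))\<^sup>2"
  unfolding mass_norm_sq_def spread_def sum_distrib_right
proof (rule sum_mono)
  fix i
  have "(\<sigma> i)\<^sup>2 \<le> (real CARD('n))\<^sup>2" using assms(1) by (intro power_mono) (auto simp: ranking_def)
  then show "m i * (norm ((\<chi> i. \<sigma> i *\<^sub>R w) $ i))\<^sup>2 \<le> m i * (real CARD('n))\<^sup>2"
    using assms(2) less_imp_le[OF assms(3)] by (auto intro: mult_left_mono)
qed

lemma potential_ordered_gap_le:
  fixes x :: "('e::euclidean_space, 'n::{finite,linorder}) vec"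
  assumes "ranking \<sigma>" "norm w = 1" "\<And>i. m i > 0" "\<kappa> > 0" "r > 0" "x \<in> ordered_gap w \<sigma> r"
  shows "potential m \<kappa> x \<le> ennreal ((\<Sum>(i, j) | i < j. m i * m j) * r powr (- 2 * \<kappa>))"
  by (rule potential_le_separated) (use assms ordered_gap_separated in blast)+

text \<open>The exponent \<open>1 / (1 + \<kappa>)\<close> is that of a parabolic ejection from a collision: kinetic energy and
  potential are then both of order \<open>s powr (- 2 * \<kappa> / (1 + \<kappa>))\<close>, which is integrable as \<open>\<kappa> < 1\<close>.\<close>

lemma dominated_ejection_le:
  fixes u :: "('e::euclidean_space, 'n::{finite,linorder}) vec \<Rightarrow> real"
  assumes u: "dominated m \<kappa> u" and m: "\<And>i. m i > 0" and \<kappa>: "0 < \<kappa>" "\<kappa> < 1"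
    and w: "norm w = 1" and \<sigma>: "ranking \<sigma>" and x: "x \<in> ordered_gap w \<sigma> 0" and t: "0 < t"
  defines "\<beta> \<equiv> (1 - \<kappa>) / (1 + \<kappa>)"
  shows "\<bar>u x - u (x + t powr (1 / (1 + \<kappa>)) *\<^sub>R spread w \<sigma>)\<bar> \<le>
    ((\<Sum>i\<in>UNIV. m i) * (real CARD('n))\<^sup>2 + (\<Sum>(i, j) | i < j. m i * m j)) / \<beta> * t powr \<beta>"
proof -
  define \<alpha> where "\<alpha> = 1 / (1 + \<kappa>)"
  define M where "M = (\<Sum>i\<in>UNIV. m i) * (real CARD('n))\<^sup>2"
  define W where "W = (\<Sum>(i, j) | i < j. m i * m j)"
  have W: "W \<ge> 0" unfolding W_def using less_imp_le[OF m] by (intro sum_nonneg) auto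
  have \<alpha>: "0 < \<alpha>" "\<alpha> \<le> 1" using \<kappa> by (auto simp: \<alpha>_def)
  have \<beta>: "0 < \<beta>" using \<kappa> by (simp add: \<beta>_def)
  have e1: "2 * (\<alpha> - 1) = \<beta> - 1" and e2: "\<alpha> * (- 2 * \<kappa>) = \<beta> - 1"
    using \<kappa> by (simp_all add: \<alpha>_def \<beta>_def field_simps)
  let ?\<gamma> = "\<lambda>s. x + s powr \<alpha> *\<^sub>R spread w \<sigma>"
  have der: "((\<lambda>s. s powr c) has_real_derivative c * s powr (c - 1)) (at s)" if "s > 0" for c s :: real
    by (rule has_real_derivative_powr[OF that])
  have cont: "continuous_on {0..t} (\<lambda>s. s powr c)" if "c > 0" for c :: real
    using that by (intro continuous_on_powr' continuous_intros) auto
  \<comment> \<open>Both boundary terms at 0 vanish and the curve starts at \<open>x\<close>, since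
    \<open>0 powr c = 0\<close>.\<close>
  have "\<bar>u (?\<gamma> 0) - u (?\<gamma> t)\<bar> \<le> (M / \<beta> * t powr \<beta> - M / \<beta> * 0 powr \<beta>) + (W / \<beta> * t powr \<beta> - W / \<beta> * 0 powr \<beta>)"
  proof (rule dominated_curve_le[OF u m t, where \<gamma>' = "\<lambda>s. (\<alpha> * s powr (\<alpha> - 1)) *\<^sub>R spread w \<sigma>"
        and ?g1.0 = "\<lambda>s. M * s powr (\<beta> - 1)" and ?g2.0 = "\<lambda>s. W * s powr (\<beta> - 1)"])
    fix s assume s: "0 < s" "s < t"
    have "((\<lambda>s. s powr \<alpha> *\<^sub>R spread w \<sigma>) has_vector_derivative s powr \<alpha> *\<^sub>R 0 + (\<alpha> * s powr (\<alpha> - 1)) *\<^sub>R spread w \<sigma>) (at s)"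
      by (rule has_vector_derivative_scaleR[OF der[OF s(1)] has_vector_derivative_const])
    then show "(?\<gamma> has_vector_derivative (\<alpha> * s powr (\<alpha> - 1)) *\<^sub>R spread w \<sigma>) (at s)"
      using has_vector_derivative_add[OF has_vector_derivative_const[of x]] by fastforce
    have d\<beta>: "((\<lambda>s. C / \<beta> * s powr \<beta>) has_real_derivative C * s powr (\<beta> - 1)) (at s)" for C
      using DERIV_cmult[OF der[OF s(1), of \<beta>], of "C / \<beta>"] \<beta> by simp
    show "((\<lambda>s. M / \<beta> * s powr \<beta>) has_real_derivative M * s powr (\<beta> - 1)) (at s)"
      "((\<lambda>s. W / \<beta> * s powr \<beta>) has_real_derivative W * s powr (\<beta> - 1)) (at s)" by (rule d\<beta>)+
    have "(\<alpha> * s powr (\<alpha> - 1))\<^sup>2 = \<alpha>\<^sup>2 * s powr (\<beta> - 1)"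
      using s(1) by (simp add: power_mult_distrib powr_power e1[symmetric] mult.commute)
    then have "mass_norm_sq m ((\<alpha> * s powr (\<alpha> - 1)) *\<^sub>R spread w \<sigma>) / 2
        = (\<alpha>\<^sup>2 / 2 * mass_norm_sq m (spread w \<sigma>)) * s powr (\<beta> - 1)"
      by (simp add: mass_norm_sq_scaleR)
    also have "\<dots> \<le> M * s powr (\<beta> - 1)"
    proof (rule mult_right_mono)
      have "\<alpha>\<^sup>2 \<le> 1" using \<alpha> by (simp add: power_le_one)
      then have "\<alpha>\<^sup>2 / 2 * mass_norm_sq m (spread w \<sigma>) \<le> 1 * mass_norm_sq m (spread w \<sigma>)"
        using mass_norm_sq_nonneg[of m "spread w \<sigma>"] m by (intro mult_right_mono) auto
      also have "\<dots> \<le> M" unfolding M_def using mass_norm_sq_spread_le[of \<sigma> w m] \<sigma> w m by simp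
      finally show "\<alpha>\<^sup>2 / 2 * mass_norm_sq m (spread w \<sigma>) \<le> M" .
    qed simp
    finally show "mass_norm_sq m ((\<alpha> * s powr (\<alpha> - 1)) *\<^sub>R spread w \<sigma>) / 2 \<le> M * s powr (\<beta> - 1)" .
    have "?\<gamma> s \<in> ordered_gap w \<sigma> (s powr \<alpha>)"
      by (rule add_spread_in_ordered_gap[OF \<sigma> w x]) simp
    then have "potential m \<kappa> (?\<gamma> s) \<le> ennreal (W * (s powr \<alpha>) powr (- 2 * \<kappa>))"
      unfolding W_def using s by (intro potential_ordered_gap_le[OF \<sigma> w m \<kappa>(1)]) auto
    also have "(s powr \<alpha>) powr (- 2 * \<kappa>) = s powr (\<beta> - 1)" unfolding powr_powr e2 ..
    finally show "potential m \<kappa> (?\<gamma> s) \<le> ennreal (W * s powr (\<beta> - 1))" .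
  qed (use W \<alpha> \<beta> in \<open>auto intro!: continuous_intros cont\<close>)
  then show ?thesis
    using \<alpha> \<beta> by (simp add: \<alpha>_def M_def W_def add_divide_distrib distrib_right)
qed

text \<open>Eject both configurations for time \<open>t\<close>, join the two ends by a segment
  inside the convex set of gap \<open>r t\<close>, and run one ejection backwards. The ejections
  cost \<open>K * t powr \<beta>\<close> together; the segment costs its length times
  \<open>L t\<close>, which may blow up as \<open>t\<close> tends to 0. Leaving \<open>t\<close>
  free serves both uses: small for continuity, 1 for growth.\<close>

lemma dominated_increment_le:
  fixes u :: "('e::euclidean_space, 'n::{finite,linorder}) vec \<Rightarrow> real"
  assumes u: "dominated m \<kappa> u" and m: "\<And>i. m i > 0" and \<kappa>: "0 < \<kappa>" "\<kappa> < 1"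
  obtains K \<beta> and L :: "real \<Rightarrow> real" where "K \<ge> 0" "\<beta> > 0" "\<And>t. 0 < t \<Longrightarrow> 0 \<le> L t"
    "\<And>w \<sigma> x y t. norm w = 1 \<Longrightarrow> ranking \<sigma> \<Longrightarrow> x \<in> ordered_gap w \<sigma> 0 \<Longrightarrow> y \<in> ordered_gap w \<sigma> 0 \<Longrightarrow> 0 < t \<Longrightarrow>
      \<bar>u x - u y\<bar> \<le> K * t powr \<beta> + L t * norm (x - y)"
proof -
  define \<beta> where "\<beta> = (1 - \<kappa>) / (1 + \<kappa>)"
  define M where "M = (\<Sum>i\<in>UNIV. m i)"
  define W where "W = (\<Sum>(i, j) | i < j. m i * m j)"
  define K where "K = (M * (real CARD('n))\<^sup>2 + W) / \<beta>"
  define r where "r t = t powr (1 / (1 + \<kappa>))" for t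
  define L where "L t = M / 2 + W * r t powr (- 2 * \<kappa>)" for t
  have "W \<ge> 0" unfolding W_def using less_imp_le[OF m] by (intro sum_nonneg) auto
  have "M \<ge> 0" unfolding M_def using less_imp_le[OF m] by (intro sum_nonneg) auto
  have "\<beta> > 0" using \<kappa> by (simp add: \<beta>_def)
  show thesis
  proof (rule that[of "2 * K" \<beta> L])
    show "2 * K \<ge> 0" "\<And>t. 0 < t \<Longrightarrow> 0 \<le> L t" using \<open>W \<ge> 0\<close> \<open>M \<ge> 0\<close> \<open>\<beta> > 0\<close> by (auto simp: K_def L_def)
    fix w :: 'e and \<sigma> :: "'n \<Rightarrow> real" and x y :: "('e, 'n) vec" and t :: real
    assume w: "norm w = 1" and \<sigma>: "ranking \<sigma>" and xy: "x \<in> ordered_gap w \<sigma> 0" "y \<in> ordered_gap w \<sigma> 0" and t: "0 < (t::real)"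
    have "r t > 0" using t by (simp add: r_def)
    have leg: "\<bar>u z - u (z + r t *\<^sub>R spread w \<sigma>)\<bar> \<le> K * t powr \<beta>" if "z \<in> ordered_gap w \<sigma> 0" for z
      using dominated_ejection_le[OF u m \<kappa> w \<sigma> that t] by (simp add: K_def \<beta>_def r_def M_def W_def)
    have "(L t)-lipschitz_on (ordered_gap w \<sigma> (r t)) u"
      unfolding L_def M_def
    proof (rule dominated_lipschitz_on_convex[OF u m convex_ordered_gap])
      show "potential m \<kappa> z \<le> ennreal (W * r t powr (- 2 * \<kappa>))" if "z \<in> ordered_gap w \<sigma> (r t)" for z
        unfolding W_def by (rule potential_ordered_gap_le[OF \<sigma> w m \<kappa>(1) \<open>r t > 0\<close> that])
    qed (use \<open>W \<ge> 0\<close> in simp)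
    then have "\<bar>u (x + r t *\<^sub>R spread w \<sigma>) - u (y + r t *\<^sub>R spread w \<sigma>)\<bar> \<le> L t * norm (x - y)"
      using lipschitz_onD[OF _ add_spread_in_ordered_gap[OF \<sigma> w xy(1)] add_spread_in_ordered_gap[OF \<sigma> w xy(2)]] \<open>r t > 0\<close>
      by (fastforce simp: dist_real_def dist_norm)
    then show "\<bar>u x - u y\<bar> \<le> 2 * K * t powr \<beta> + L t * norm (x - y)" using leg[OF xy(1)] leg[OF xy(2)] by linarith
  qed fact
qed

lemma dominated_continuous:
  fixes u :: "('e::euclidean_space, 'n::{finite,linorder}) vec \<Rightarrow> real"
  assumes u: "dominated m \<kappa> u" and m: "\<And>i. m i > 0" and \<kappa>: "0 < \<kappa>" "\<kappa> < 1"
  shows "continuous_on UNIV u"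
  unfolding continuous_on_iff
proof (intro ballI allI impI)
  fix x0 :: "('e, 'n) vec" and e :: real assume "e > 0"
  obtain K \<beta> and L :: "real \<Rightarrow> real" where KL: "K \<ge> 0" "\<beta> > 0" "\<And>t. 0 < t \<Longrightarrow> 0 \<le> L t"
    "\<And>w \<sigma> x y t. norm w = 1 \<Longrightarrow> ranking \<sigma> \<Longrightarrow> x \<in> ordered_gap w \<sigma> 0 \<Longrightarrow> y \<in> ordered_gap w \<sigma> 0 \<Longrightarrow> 0 < t \<Longrightarrow>
      \<bar>u x - u y\<bar> \<le> K * t powr \<beta> + L t * norm (x - y)"
    using dominated_increment_le[OF u m \<kappa>] by blast
  obtain w :: 'e where "w \<in> Basis" using nonempty_Basis by blast
  then have w: "norm w = 1" by simp
  obtain r where "r > 0" and r: "\<And>y \<sigma>. y \<in> ball x0 r \<Longrightarrow> y \<in> ordered_gap w \<sigma> 0 \<Longrightarrow> x0 \<in> ordered_gap w \<sigma> 0"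
    using ordered_gap_nhds[of x0 w] by blast
  \<comment> \<open>The time \<open>t\<close> is fixed first, by the cost of the ejections; only
    then is the radius \<open>d\<close> adapted to \<open>L t\<close>.\<close>
  define c where "c = e / (2 * (K + 1))"
  define t where "t = c powr (1 / \<beta>)"
  have "c > 0" using \<open>e > 0\<close> KL(1) by (simp add: c_def)
  then have "t > 0" by (simp add: t_def)
  have "t powr \<beta> = c" using \<open>c > 0\<close> KL(2) by (simp add: t_def powr_powr)
  moreover have "K * c \<le> e / 2" using KL(1) \<open>e > 0\<close> by (simp add: c_def field_simps)
  ultimately have Kt: "K * t powr \<beta> \<le> e / 2" by simp
  define d where "d = min r (e / (2 * (L t + 1)))"
  have Lt: "0 \<le> L t" by (rule KL(3)[OF \<open>t > 0\<close>])
  have "d > 0" using \<open>r > 0\<close> \<open>e > 0\<close> Lt by (simp add: d_def)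
  have "dist (u y) (u x0) < e" if y: "dist y x0 < d" for y
  proof -
    \<comment> \<open>The order is read off from \<open>y\<close>, not from \<open>x0\<close>,
      because compatibility passes only from \<open>y\<close> to \<open>x0\<close>.\<close>
    obtain \<sigma> where \<sigma>: "ranking \<sigma>" "y \<in> ordered_gap w \<sigma> 0" using ex_ranking[of y w] .
    have "x0 \<in> ordered_gap w \<sigma> 0" using r[OF _ \<sigma>(2)] y by (simp add: d_def dist_commute)
    then have "\<bar>u y - u x0\<bar> \<le> K * t powr \<beta> + L t * norm (y - x0)"
      using KL(4)[OF w \<sigma>(1) \<sigma>(2) _ \<open>t > 0\<close>] by blast
    also have "L t * norm (y - x0) \<le> L t * d" using y Lt by (intro mult_left_mono) (auto simp: dist_norm)
    also have "L t * d \<le> L t * (e / (2 * (L t + 1)))" using Lt by (intro mult_left_mono) (auto simp: d_def)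
    also have "\<dots> < e / 2" using Lt \<open>e > 0\<close> by (simp add: field_simps)
    finally show ?thesis using Kt by (simp add: dist_real_def)
  qed
  then show "\<exists>d>0. \<forall>y\<in>UNIV. dist y x0 < d \<longrightarrow> dist (u y) (u x0) < e" using \<open>d > 0\<close> by blast
qed

text \<open>The total collision at the origin is compatible with every order, so every configuration
  can be compared with it in time 1.\<close>

lemma dominated_linear_growth:
  fixes u :: "('e::euclidean_space, 'n::{finite,linorder}) vec \<Rightarrow> real"
  assumes u: "dominated m \<kappa> u" and m: "\<And>i. m i > 0" and \<kappa>: "0 < \<kappa>" "\<kappa> < 1"
  obtains a b where "a \<ge> 0" "b \<ge> 0" "\<And>x y. u x - u y \<le> a + b * norm x + b * norm (y - x)"
proof -
  obtain K \<beta> and L :: "real \<Rightarrow> real" where KL: "K \<ge> 0" "\<beta> > 0" "\<And>t. 0 < t \<Longrightarrow> 0 \<le> L t"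
    "\<And>w \<sigma> x y t. norm w = 1 \<Longrightarrow> ranking \<sigma> \<Longrightarrow> x \<in> ordered_gap w \<sigma> 0 \<Longrightarrow> y \<in> ordered_gap w \<sigma> 0 \<Longrightarrow> 0 < t \<Longrightarrow>
      \<bar>u x - u y\<bar> \<le> K * t powr \<beta> + L t * norm (x - y)"
    using dominated_increment_le[OF u m \<kappa>] by blast
  obtain w :: 'e where "w \<in> Basis" using nonempty_Basis by blast
  then have w: "norm w = 1" by simp
  have bound: "\<bar>u x - u 0\<bar> \<le> K + L 1 * norm x" for x
  proof -
    obtain \<sigma> where \<sigma>: "ranking \<sigma>" "x \<in> ordered_gap w \<sigma> 0" using ex_ranking[of x w] .
    have "0 \<in> ordered_gap w \<sigma> 0" by (simp add: ordered_gap_def)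
    then show ?thesis using KL(4)[OF w \<sigma>, of 0 1] by simp
  qed
  have L1: "0 \<le> L 1" by (rule KL(3)) simp
  show thesis
  proof (rule that[of "2 * K" "2 * L 1"])
    fix x y :: "('e, 'n) vec"
    have "norm y \<le> norm x + norm (y - x)" using norm_triangle_ineq[of x "y - x"] by simp
    then have "L 1 * norm y \<le> L 1 * norm x + L 1 * norm (y - x)"
      using L1 mult_left_mono[of "norm y" "norm x + norm (y - x)" "L 1"] by (simp add: distrib_left)
    moreover have "0 \<le> L 1 * norm (y - x)" using L1 by simp
    ultimately show "u x - u y \<le> 2 * K + 2 * L 1 * norm x + 2 * L 1 * norm (y - x)"
      using bound[of x] bound[of y] by linarith
  qed (use KL(1) L1 in auto)
qed

subsection \<open>The supersolution property\<close>

lemma lax_oleinik_almost_minimizer: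
  assumes fp: "lax_oleinik m \<kappa> t u x = ereal (u x)" and "0 < t" "0 < e"
  obtains y \<gamma> A where "\<gamma> \<in> curves x y t" "action m \<kappa> 0 t \<gamma> = ennreal A" "0 \<le> A" "u y + A \<le> u x + e"
proof -
  have "(INF y. ereal (u y) + enn2ereal (min_action m \<kappa> x y t)) < ereal (u x + e)"
    using fp \<open>0 < t\<close> \<open>0 < e\<close> by (simp add: lax_oleinik_def)
  then obtain y where y: "ereal (u y) + enn2ereal (min_action m \<kappa> x y t) < ereal (u x + e)"
    unfolding INF_less_iff by blast
  have "min_action m \<kappa> x y t < ennreal (u x + e - u y)"
  proof (cases "min_action m \<kappa> x y t")
    case (real a)
    then have "a < u x + e - u y" using y by (simp add: enn2ereal_ennreal)
    then show ?thesis using real by (simp add: ennreal_less_iff)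
  next
    case top
    then show ?thesis using y by simp
  qed
  then obtain \<gamma> where \<gamma>: "\<gamma> \<in> curves x y t" "action m \<kappa> 0 t \<gamma> < ennreal (u x + e - u y)"
    unfolding min_action_def INF_less_iff by blast
  then obtain A where A: "action m \<kappa> 0 t \<gamma> = ennreal A" "0 \<le> A"
    by (cases "action m \<kappa> 0 t \<gamma>") auto
  then have "A < u x + e - u y" using \<gamma>(2) by (simp add: ennreal_less_iff)
  then show thesis using that[OF \<gamma>(1) A] by simp
qed

lemma action_eq_realD:
  assumes "action m \<kappa> a b \<gamma> = ennreal A" "0 \<le> A"
  obtains j v where "0 \<le> j" "0 \<le> v" "j / 2 + v = A"
    "(\<integral>\<^sup>+s\<in>{a..b}. ennreal (mass_norm_sq m (vector_derivative \<gamma> (at s within {a..b}))) \<partial>lebesgue) = ennreal j"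
    "(\<integral>\<^sup>+s\<in>{a..b}. potential m \<kappa> (\<gamma> s) \<partial>lebesgue) = ennreal v"
proof -
  let ?J = "\<integral>\<^sup>+s\<in>{a..b}. ennreal (mass_norm_sq m (vector_derivative \<gamma> (at s within {a..b}))) \<partial>lebesgue"
  let ?V = "\<integral>\<^sup>+s\<in>{a..b}. potential m \<kappa> (\<gamma> s) \<partial>lebesgue"
  have eq: "ennreal (1 / 2) * ?J + ?V = ennreal A"
    using assms(1) unfolding action_def half_ennreal .
  then have "ennreal (1 / 2) * ?J \<noteq> top" "?V \<noteq> top" by (auto simp: ennreal_add_eq_top)
  then have "?J \<noteq> top" by (auto simp: ennreal_mult_top)
  then obtain j where j: "?J = ennreal j" "0 \<le> j" by (cases ?J) auto
  obtain v where v: "?V = ennreal v" "0 \<le> v" using \<open>?V \<noteq> top\<close> by (cases ?V) auto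
  have "ennreal (1 / 2) * ennreal j + ennreal v = ennreal (1 / 2 * j + v)"
    using j(2) v(2) by (simp only: ennreal_mult[symmetric] ennreal_plus[symmetric])
  then have "ennreal (1 / 2 * j + v) = ennreal A" using eq unfolding j(1) v(1) by simp
  then have "1 / 2 * j + v = A" using j(2) v(2) assms(2) by (subst (asm) ennreal_inj) auto
  then show thesis using that[of j v] j v by simp
qed

text \<open>Expand the nonnegative mass norm of \<open>z\<close> plus \<mu> times the vector with
  components \<open>q $ i / m i\<close>, and divide by \<open>2 * \<mu>\<close>. The free weight
  \<mu> is later taken slightly larger than the elapsed time.\<close>

lemma covector_young:
  fixes p :: "'e::euclidean_space ^ 'n::finite \<Rightarrow> real"
  assumes p: "linear p" and m: "\<And>i. m i > 0" and \<mu>: "\<mu> > 0"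
  shows "- p z \<le> mass_norm_sq m z / (2 * \<mu>) + \<mu> * dual_norm_sq m p / 2"
proof -
  define q where "q = covector_components p"
  have "- ((q $ i) \<bullet> (z $ i)) \<le> m i * (norm (z $ i))\<^sup>2 / (2 * \<mu>) + \<mu> * (inverse (m i) * (norm (q $ i))\<^sup>2) / 2" for i
  proof -
    have "0 \<le> m i / (2 * \<mu>) * (norm (z $ i + (\<mu> / m i) *\<^sub>R q $ i))\<^sup>2"
      using less_imp_le[OF m[of i]] \<mu> by simp
    also have "(norm (z $ i + (\<mu> / m i) *\<^sub>R q $ i))\<^sup>2 =
        (norm (z $ i))\<^sup>2 + 2 * (\<mu> / m i) * ((q $ i) \<bullet> (z $ i)) + (\<mu> / m i)\<^sup>2 * (norm (q $ i))\<^sup>2"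
      unfolding power2_norm_eq_inner
      by (simp add: inner_add_left inner_add_right inner_commute power2_eq_square)
    also have "m i / (2 * \<mu>) * \<dots> = m i * (norm (z $ i))\<^sup>2 / (2 * \<mu>) + (q $ i) \<bullet> (z $ i) + \<mu> * (inverse (m i) * (norm (q $ i))\<^sup>2) / 2"
      using m[of i] \<mu> by (simp add: field_simps power2_eq_square)
    finally show ?thesis by simp
  qed
  then have "(\<Sum>i\<in>UNIV. - ((q $ i) \<bullet> (z $ i))) \<le>
      (\<Sum>i\<in>UNIV. m i * (norm (z $ i))\<^sup>2 / (2 * \<mu>) + \<mu> * (inverse (m i) * (norm (q $ i))\<^sup>2) / 2)"
    by (intro sum_mono)
  then show ?thesis
    using covector_components[OF p, of z]
    by (simp add: q_def[symmetric] mass_norm_sq_def dual_norm_sq_def sum_negf sum.distrib sum_divide_distrib sum_distrib_left)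
qed

text \<open>Almost minimizers on \<open>[0, t]\<close> stay within a distance of order \<open>sqrt t\<close> of \<open>x0\<close>, so no calibrated
  curve is required: comparing their action with the first-order expansion of \<open>\<psi>\<close> and letting
  \<open>t\<close> tend to \<open>0\<close> suffices.\<close>

lemma lax_oleinik_fixed_point_supersolution:
  fixes u :: "('e::euclidean_space, 'n::{finite,linorder}) vec \<Rightarrow> real"
  assumes u: "dominated m \<kappa> u" and m: "\<And>i. m i > 0" and \<kappa>: "0 < \<kappa>" "\<kappa> < 1"
    and fp: "\<And>t x. 0 \<le> t \<Longrightarrow> lax_oleinik m \<kappa> t u x = ereal (u x)"
  shows "viscosity_supersolution_at m \<kappa> u x0"
  unfolding viscosity_supersolution_at_def
proof (intro allI impI, elim conjE, rule ccontr)
  fix \<psi> :: "('e, 'n) vec \<Rightarrow> real"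
  assume C1: "C1_function \<psi>" and min: "\<forall>x. u x - \<psi> x \<ge> u x0 - \<psi> x0"
    and contra: "\<not> ennreal (dual_norm_sq m (frechet_derivative \<psi> (at x0))) \<ge> 2 * potential m \<kappa> x0"
  define p where "p = frechet_derivative \<psi> (at x0)"
  have p: "(\<psi> has_derivative p) (at x0)"
    using C1 unfolding C1_function_def p_def by (metis differentiableI frechet_derivative_works)
  define P where "P = dual_norm_sq m p"
  have "P \<ge> 0" unfolding P_def dual_norm_sq_def using less_imp_le[OF m] by (intro sum_nonneg) auto
  have "ennreal (P / 2) < potential m \<kappa> x0"
  proof (rule ccontr)
    assume "\<not> ennreal (P / 2) < potential m \<kappa> x0"
    then have "2 * potential m \<kappa> x0 \<le> 2 * ennreal (P / 2)" by (intro mult_left_mono) auto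
    also have "2 * ennreal (P / 2) = ennreal (2 * (P / 2))"
      using \<open>P \<ge> 0\<close> by (subst ennreal_mult) auto
    finally show False using contra by (simp add: P_def p_def)
  qed
  then obtain c where c: "ennreal (P / 2) < c" "c < potential m \<kappa> x0" using dense by blast
  then obtain L where L: "c = ennreal L" "0 \<le> L" by (cases c) auto
  define gap where "gap = L - P / 2"
  have "gap > 0" using c(1) L \<open>P \<ge> 0\<close> by (simp add: gap_def ennreal_less_iff)
  obtain r1 where r1: "r1 > 0" "\<And>x. x \<in> ball x0 r1 \<Longrightarrow> ennreal L < potential m \<kappa> x"
    using potential_greater_nhds[of m \<kappa> c x0, OF m \<kappa>(1) c(2)] L(1) by blast
  obtain c0 where c0: "c0 > 0" "\<And>v :: ('e, 'n) vec. c0 * (norm v)\<^sup>2 \<le> mass_norm_sq m v"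
    using mass_norm_sq_ge[of m, OF m] by blast
  define \<theta> where "\<theta> = gap / (P + 1)"
  have "\<theta> > 0" using \<open>gap > 0\<close> \<open>P \<ge> 0\<close> by (simp add: \<theta>_def)
  have \<theta>P: "(1 + \<theta>) * P / 2 \<le> P / 2 + gap / 2"
    using \<open>gap > 0\<close> \<open>P \<ge> 0\<close> by (simp add: \<theta>_def field_simps)
  define \<eta> where "\<eta> = min (gap / 2) (c0 * (\<theta> / (1 + \<theta>)))"
  have \<eta>: "\<eta> > 0" "\<eta> \<le> gap / 2" "\<eta> \<le> c0 * (\<theta> / (1 + \<theta>))"
  proof -
    show "\<eta> > 0" using \<open>gap > 0\<close> c0(1) \<open>\<theta> > 0\<close> by (simp add: \<eta>_def)
    show "\<eta> \<le> gap / 2" unfolding \<eta>_def by (rule min.cobounded1)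
    show "\<eta> \<le> c0 * (\<theta> / (1 + \<theta>))" unfolding \<eta>_def by (rule min.cobounded2)
  qed
  obtain r2 where r2: "r2 > 0" "\<And>y. norm (y - x0) < r2 \<Longrightarrow> norm (\<psi> y - \<psi> x0 - p (y - x0)) \<le> \<eta> * norm (y - x0)"
    using p \<eta>(1) unfolding has_derivative_at_alt by blast
  define r where "r = min r1 r2"
  have "r > 0" using r1(1) r2(1) by (simp add: r_def)
  obtain a b where ab: "a \<ge> 0" "b \<ge> 0" "\<And>x y. u x - u y \<le> a + b * norm x + b * norm (y - x)"
    using dominated_linear_growth[OF u m \<kappa>] by blast
  \<comment> \<open>The added 1 dominates the excess \<open>t\<^sup>2\<close> of the almost
    minimizer.\<close>
  define a' where "a' = a + b * norm x0 + 1"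
  have "a' \<ge> 1" using ab by (simp add: a'_def)
  \<comment> \<open>An a priori bound for the distance \<open>D\<close> of the endpoint, which will
    satisfy \<open>c0 * D\<^sup>2 \<le> 2 * a' + 2 * b * D\<close>: for \<open>D > 1\<close> divide
    by \<open>D\<close>, and the summand 1 covers the rest.\<close>
  define D0 where "D0 = (2 * a' + 2 * b) / c0 + 1"
  have "D0 \<ge> 1" using \<open>a' \<ge> 1\<close> ab c0(1) by (simp add: D0_def)
  define A0 where "A0 = a' + b * D0"
  have "A0 \<ge> 1" using \<open>a' \<ge> 1\<close> \<open>D0 \<ge> 1\<close> ab by (simp add: A0_def add_increasing2)
  \<comment> \<open>The last bound keeps the whole curve within distance \<open>r\<close> of
    \<open>x0\<close>; \<open>gap / 8\<close> controls the excess action per unit time.\<close>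
  define t where "t = min 1 (min (gap / 8) (c0 * r\<^sup>2 / (4 * A0)))"
  have t: "0 < t" "t \<le> 1" "t \<le> gap / 8" "t \<le> c0 * r\<^sup>2 / (4 * A0)"
    using \<open>gap > 0\<close> c0(1) \<open>r > 0\<close> \<open>A0 \<ge> 1\<close> by (auto simp: t_def)
  have tA0: "t * (2 * A0) < c0 * r\<^sup>2"
  proof -
    have "t * (2 * A0) \<le> c0 * r\<^sup>2 / (4 * A0) * (2 * A0)" using t(4) \<open>A0 \<ge> 1\<close> by (intro mult_right_mono) auto
    also have "\<dots> = c0 * r\<^sup>2 / 2" using \<open>A0 \<ge> 1\<close> by simp
    also have "\<dots> < c0 * r\<^sup>2" using c0(1) \<open>r > 0\<close> by simp
    finally show ?thesis .
  qed
  obtain y \<gamma> A where \<gamma>: "\<gamma> \<in> curves x0 y t" and A: "action m \<kappa> 0 t \<gamma> = ennreal A" "0 \<le> A" "u y + A \<le> u x0 + t\<^sup>2"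
    using lax_oleinik_almost_minimizer[OF fp[OF less_imp_le[OF t(1)]] t(1) zero_less_power[OF t(1)]] by blast
  have ac: "abs_continuous_curve 0 t \<gamma>" and ends: "\<gamma> 0 = x0" "\<gamma> t = y" using \<gamma> by (auto simp: curves_def)
  obtain j v where jv: "0 \<le> j" "0 \<le> v" "j / 2 + v = A"
    "(\<integral>\<^sup>+s\<in>{0..t}. ennreal (mass_norm_sq m (vector_derivative \<gamma> (at s within {0..t}))) \<partial>lebesgue) = ennreal j"
    "(\<integral>\<^sup>+s\<in>{0..t}. potential m \<kappa> (\<gamma> s) \<partial>lebesgue) = ennreal v"
    using action_eq_realD[OF A(1,2)] by blast
  have disp: "mass_norm_sq m (\<gamma> s - x0) \<le> s * j" if s: "0 \<le> s" "s \<le> t" for s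
  proof -
    have "ennreal (mass_norm_sq m (\<gamma> s - x0)) \<le> ennreal s * ennreal j"
      using mass_norm_sq_displacement_le[of m, OF m ac s] unfolding jv(4) ends(1) .
    then show ?thesis using s(1) jv(1) by (simp add: ennreal_mult[symmetric])
  qed
  define D where "D = norm (y - x0)"
  define d2 where "d2 = mass_norm_sq m (y - x0)"
  have d2: "d2 \<le> t * j" "c0 * D\<^sup>2 \<le> d2"
    using disp[of t] t(1) ends c0(2)[of "y - x0"] by (auto simp: d2_def D_def)
  have t2: "t\<^sup>2 \<le> 1" using t(1,2) by (simp add: power_le_one)
  have "A \<le> u x0 - u y + t\<^sup>2" using A(3) by simp
  then have A_D: "A \<le> a' + b * D" using ab(3)[of x0 y] t2 by (simp add: a'_def D_def)
  have jA: "j \<le> 2 * A" using jv by simp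
  have "c0 * D\<^sup>2 \<le> 1 * (2 * A)"
    using d2 mult_mono[OF t(2) jA] jv(1) by linarith
  then have c0D: "c0 * D\<^sup>2 \<le> 2 * a' + 2 * b * D" using A_D by linarith
  have "D \<ge> 0" by (simp add: D_def)
  have "D \<le> D0"
  proof (cases "D \<le> 1")
    case False
    then have "2 * a' \<le> 2 * a' * D" using \<open>a' \<ge> 1\<close> by simp
    then have "c0 * D * D \<le> (2 * a' + 2 * b) * D" using c0D by (simp add: power2_eq_square algebra_simps)
    then have "c0 * D \<le> 2 * a' + 2 * b" using False by simp
    then show ?thesis using c0(1) by (simp add: D0_def field_simps)
  qed (use \<open>D0 \<ge> 1\<close> in simp)
  then have "b * D \<le> b * D0" using ab(2) by (rule mult_left_mono)
  then have "A \<le> A0" using A_D by (simp add: A0_def)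
  have near: "norm (\<gamma> s - x0) < r" if s: "0 \<le> s" "s \<le> t" for s
  proof -
    have "c0 * (norm (\<gamma> s - x0))\<^sup>2 \<le> s * j" using disp[OF s] c0(2)[of "\<gamma> s - x0"] by linarith
    also have "\<dots> \<le> t * (2 * A0)" using s t(1) jv(1) jA \<open>A \<le> A0\<close> by (intro mult_mono) auto
    also have "\<dots> < c0 * r\<^sup>2" by (rule tA0)
    finally have "(norm (\<gamma> s - x0))\<^sup>2 < r\<^sup>2" using c0(1) by simp
    then show ?thesis using \<open>r > 0\<close> by (rule power2_less_imp_less[OF _ less_imp_le])
  qed
  have "ennreal (L * t) \<le> ennreal v"
  proof -
    have "ennreal (L * t) = (\<integral>\<^sup>+s\<in>{0..t}. ennreal L \<partial>lebesgue)"
      using L(2) t(1) by (simp add: nn_integral_cmult_indicator ennreal_mult)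
    also have "\<dots> \<le> (\<integral>\<^sup>+s\<in>{0..t}. potential m \<kappa> (\<gamma> s) \<partial>lebesgue)"
    proof (rule nn_integral_mono)
      fix s
      show "ennreal L * indicator {0..t} s \<le> potential m \<kappa> (\<gamma> s) * indicator {0..t} s"
        using near[of s] r1(2)[of "\<gamma> s"] by (auto simp: indicator_def dist_norm norm_minus_commute r_def intro: less_imp_le)
    qed
    finally show ?thesis unfolding jv(5) .
  qed
  then have "L * t \<le> v" using jv(2) by simp
  moreover have "d2 / (2 * t) \<le> j / 2" using d2(1) t(1) by (simp add: field_simps)
  ultimately have lower: "d2 / (2 * t) + L * t \<le> A" using jv(3) by linarith
  have "norm (y - x0) < r2" using near[of t] t(1) ends by (simp add: r_def)
  then have "\<bar>\<psi> y - \<psi> x0 - p (y - x0)\<bar> \<le> \<eta> * D" using r2(2) by (simp add: D_def)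
  moreover have "u x0 - u y \<le> \<psi> x0 - \<psi> y" using min[rule_format, of y] by linarith
  ultimately have upper: "A \<le> - p (y - x0) + \<eta> * D + t\<^sup>2" using A(3) by linarith
  have "t * (1 + \<theta>) > 0" using t(1) \<open>\<theta> > 0\<close> by simp
  then have young: "- p (y - x0) \<le> d2 / (2 * (t * (1 + \<theta>))) + t * (1 + \<theta>) * P / 2"
    unfolding d2_def P_def by (rule covector_young[OF has_derivative_linear[OF p] m])
  \<comment> \<open>The error is linear in \<open>D\<close> and not a multiple of \<open>t\<close>;
    the inequality of arithmetic and geometric means splits it into a kinetic part and one
    proportional to \<open>t\<close>.\<close>
  have \<eta>D: "\<eta> * D \<le> \<eta> / c0 * (d2 / (2 * t)) + \<eta> * t / 2"
  proof -
    have "0 \<le> (D - t)\<^sup>2" by simp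
    then have "D \<le> D\<^sup>2 / (2 * t) + t / 2" using t(1) by (simp add: power2_eq_square field_simps)
    moreover have "D\<^sup>2 / (2 * t) \<le> (d2 / c0) / (2 * t)"
      using d2(2) c0(1) t(1) by (intro divide_right_mono) (auto simp: field_simps)
    ultimately have "D \<le> (d2 / c0) / (2 * t) + t / 2" by linarith
    then have "\<eta> * D \<le> \<eta> * ((d2 / c0) / (2 * t) + t / 2)" using \<eta>(1) by (intro mult_left_mono) auto
    then show ?thesis by (simp add: distrib_left)
  qed
  have "d2 \<ge> 0" unfolding d2_def using m by (rule mass_norm_sq_nonneg)
  have "\<eta> / c0 \<le> \<theta> / (1 + \<theta>)" using \<eta>(3) c0(1) by (simp add: pos_divide_le_eq mult.commute)
  then have "\<eta> / c0 + 1 / (1 + \<theta>) \<le> \<theta> / (1 + \<theta>) + 1 / (1 + \<theta>)" by simp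
  also have "\<dots> = 1" using \<open>\<theta> > 0\<close> by (simp add: add_divide_distrib[symmetric])
  finally have "(\<eta> / c0 + 1 / (1 + \<theta>)) * (d2 / (2 * t)) \<le> 1 * (d2 / (2 * t))"
    using \<open>d2 \<ge> 0\<close> t(1) by (intro mult_right_mono) auto
  moreover have "d2 / (2 * (t * (1 + \<theta>))) = 1 / (1 + \<theta>) * (d2 / (2 * t))" by simp
  ultimately have "\<eta> / c0 * (d2 / (2 * t)) + d2 / (2 * (t * (1 + \<theta>))) \<le> d2 / (2 * t)"
    by (simp only: distrib_right mult_1)
  then have "L * t \<le> t * (1 + \<theta>) * P / 2 + \<eta> * t / 2 + t\<^sup>2"
    using lower upper young \<eta>D by linarith
  also have "\<dots> = ((1 + \<theta>) * P / 2 + \<eta> / 2 + t) * t" by (simp add: power2_eq_square algebra_simps)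
  finally have "L \<le> (1 + \<theta>) * P / 2 + \<eta> / 2 + t" using t(1) by simp
  \<comment> \<open>The three losses add up to \<open>7 / 8 * gap\<close>, which is less than the
    distance \<open>gap\<close> from \<open>P / 2\<close> to \<open>L\<close>.\<close>
  also have "\<dots> \<le> (P / 2 + gap / 2) + gap / 4 + gap / 8" using \<theta>P \<eta>(2) t(3) by linarith
  also have "\<dots> < L" using \<open>gap > 0\<close> gap_def by linarith
  finally show False by simp
qed

theorem proposition14:
  fixes m :: "'n::{finite,linorder} \<Rightarrow> real" and \<kappa> :: real
  assumes "CARD('n) \<ge> 2"
    and "\<And>i. m i > 0"
    and "0 < \<kappa>" and "\<kappa> < 1"
  shows "(\<forall>u :: ('e::euclidean_space, 'n) vec \<Rightarrow> real. dominated m \<kappa> u \<longrightarrow>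
            (AE x in lebesgue. u differentiable (at x)) \<and>
            viscosity_subsolution_on m \<kappa> UNIV u)
       \<and> (\<forall>u :: ('e, 'n) vec \<Rightarrow> real. dominated m \<kappa> u \<and>
            (\<forall>t\<ge>0. \<forall>x. lax_oleinik m \<kappa> t u x = ereal (u x)) \<longrightarrow>
            viscosity_solution_on m \<kappa> UNIV u)"
proof (intro conjI allI impI)
  fix u :: "('e, 'n) vec \<Rightarrow> real"
  assume u: "dominated m \<kappa> u"
  show "AE x in lebesgue. u differentiable (at x)"
    by (rule dominated_differentiable_AE[OF u assms(2,3)])
  show "viscosity_subsolution_on m \<kappa> UNIV u"
    unfolding viscosity_subsolution_on_def using dominated_subsolution[OF u assms(2,3)] by blast
next
  fix u :: "('e, 'n) vec \<Rightarrow> real"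
  assume "dominated m \<kappa> u \<and> (\<forall>t\<ge>0. \<forall>x. lax_oleinik m \<kappa> t u x = ereal (u x))"
  then have u: "dominated m \<kappa> u" and fp: "\<And>t x. 0 \<le> t \<Longrightarrow> lax_oleinik m \<kappa> t u x = ereal (u x)" by auto
  show "viscosity_solution_on m \<kappa> UNIV u"
    unfolding viscosity_solution_on_def viscosity_subsolution_on_def viscosity_supersolution_on_def
    using dominated_continuous[OF u assms(2-4)] dominated_subsolution[OF u assms(2,3)]
      lax_oleinik_fixed_point_supersolution[OF u assms(2-4) fp] by blast
qed

end
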